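(* Let $P,Q$ be distributions on $\mathcal{X}\times\{0,1\}$ and let $(X_1,Y_1),\dots,(X_m,Y_m)\stackrel{iid}{\sim}P$ and $X_{m+1},\dots,X_{m+n}\stackrel{iid}{\sim}Q_X$ be independent samples. Assume (A), (B), (C') below hold. Let $k$ be a universal kernel with RKHS $\mathcal{H}$, and let $\lambda=\lambda_m$ satisfy $\lambda\to0$ and $m\lambda^2\to\infty$. Let $\widehat f_P$ solve $$\min_{f\in\mathcal{H}}\ \frac{\lambda}{2}\|f\|_{\mathcal{H}}^2+\frac1m\sum_{i=1}^m\log\big(1+\exp(-(2Y_i-1)f(X_i))\big),$$ $\widehat\eta_P(x)=1/(1+\exp(-\widehat f_P(x)))$, $\widehat Q_X(G)=\frac1n\sum_{i=m+1}^{m+n}\mathbf{1}\{X_i\in G\}$, $\epsilon_n=4(\log(n+1)/n)^{1/2}$, and for tuning parameters $\beta,\gamma$, $$\widehat t_{P,Q,\alpha}=\inf\{t:\widehat Q_X(\{x:\widehat\eta_P(x)\ge t+\beta\})\le\alpha+\gamma+\epsilon_n\},\qquad \widehat G_{P,Q,\alpha}=\{x:\widehat\eta_P(x)\ge\widehat t_{P,Q,\alpha}\}.$$ Then for every $\epsilon>0$ there exist $\beta$ and $\gamma$ such that $\Pr\big(Q_X(\widehat G_{P,Q,\alpha}\Delta G_{P,Q,\alpha})\le\epsilon\big)\to1$ as $m,n\to\infty$. Assumptions: (A) there exists $t_{P,Q,\alpha}\in(0,1]$ with $Q_X(\{x:\eta_P(x)\ge t_{P,Q,\alpha}\})=\alpha$;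 (B) there are positive constants $\delta_0,b_1,b_2,\kappa$ such that for all $\delta\in[-\delta_0,\delta_0]$, $b_1|\delta|^\kappa\le|F_{P,Q}(t_{P,Q,\alpha}+\delta)-F_{P,Q}(t_{P,Q,\alpha})|\le b_2|\delta|^\kappa$; (C') there exists $c_0>0$ with $Q_X\le c_0P_X$.
   Context: $\mathcal{X}$ is a compact subset of $\mathbb{R}^d$. For a distribution $P$ of $(X,Y)\in\mathcal{X}\times\{0,1\}$, $P_X$ is the marginal of $X$ and $\eta_P(x)=P(Y=1\mid X=x)$; similarly $Q_X$ for $Q$. $\alpha\in(0,1)$ is fixed. $F_{P,Q}(t)=Q_X(\{x:\eta_P(x)\le t\})$; $G_{P,Q,\alpha}=\{x:\eta_P(x)\ge t_{P,Q,\alpha}\}$ with $t_{P,Q,\alpha}$ the (unique, under (A),(B)) threshold from (A). A universal kernel is a continuous symmetric positive definite kernel whose RKHS is dense in the continuous functions on $\mathcal{X}$ in sup norm. $\Pr$ is the product measure governing both samples; $\Delta$ is symmetric difference. *)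

theory Defs
  imports "HOL-Probability.Probability"
begin

text \<open>Elements of the pre-Hilbert space H_0 = span {k(x,.) : x in X} are represented by
  finitely supported coefficient functions c (support inside X); the function represented is
  y |-> sum_x c x * k x y, and its squared norm is sum_x sum_x' c x c x' k x x'.\<close>

definition fin_coeffs :: "'a set \<Rightarrow> ('a \<Rightarrow> real) set" where
  "fin_coeffs X = {c. finite {x. c x \<noteq> 0} \<and> {x. c x \<noteq> 0} \<subseteq> X}"

definition kcomb :: "('a \<Rightarrow> 'a \<Rightarrow> real) \<Rightarrow> ('a \<Rightarrow> real) \<Rightarrow> 'a \<Rightarrow> real" where
  "kcomb k c = (\<lambda>y. \<Sum>x\<in>{x. c x \<noteq> 0}. c x * k x y)"

definition knorm2 :: "('a \<Rightarrow> 'a \<Rightarrow> real) \<Rightarrow> ('a \<Rightarrow> real) \<Rightarrow> real" where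
  "knorm2 k c = (\<Sum>x\<in>{x. c x \<noteq> 0}. \<Sum>x'\<in>{x. c x \<noteq> 0}. c x * c x' * k x x')"

text \<open>The RKHS is the completion of H_0: limits (pointwise on X) of H_0-Cauchy sequences.
  Functions are extended by 0 outside X.\<close>

definition rkhs_approx :: "('a \<Rightarrow> 'a \<Rightarrow> real) \<Rightarrow> 'a set \<Rightarrow> ('a \<Rightarrow> real) \<Rightarrow> (nat \<Rightarrow> 'a \<Rightarrow> real) \<Rightarrow> bool" where
  "rkhs_approx k X f cs \<longleftrightarrow>
     (\<forall>n. cs n \<in> fin_coeffs X) \<and>
     (\<forall>e>0. \<exists>N. \<forall>p\<ge>N. \<forall>q\<ge>N. knorm2 k (\<lambda>x. cs p x - cs q x) < e) \<and>
     (\<forall>y\<in>X. (\<lambda>n. kcomb k (cs n) y) \<longlonglongrightarrow> f y) \<and>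
     (\<forall>y. y \<notin> X \<longrightarrow> f y = 0)"

definition rkhs :: "('a \<Rightarrow> 'a \<Rightarrow> real) \<Rightarrow> 'a set \<Rightarrow> ('a \<Rightarrow> real) set" where
  "rkhs k X = {f. \<exists>cs. rkhs_approx k X f cs}"

definition rkhs_norm :: "('a \<Rightarrow> 'a \<Rightarrow> real) \<Rightarrow> 'a set \<Rightarrow> ('a \<Rightarrow> real) \<Rightarrow> real" where
  "rkhs_norm k X f = lim (\<lambda>n. sqrt (knorm2 k ((SOME cs. rkhs_approx k X f cs) n)))"

definition universal_kernel :: "('a::topological_space \<Rightarrow> 'a \<Rightarrow> real) \<Rightarrow> 'a set \<Rightarrow> bool" where
  "universal_kernel k X \<longleftrightarrow>
     continuous_on (X \<times> X) (\<lambda>(x, y). k x y) \<and>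
     (\<forall>x\<in>X. \<forall>y\<in>X. k x y = k y x) \<and>
     (\<forall>c\<in>fin_coeffs X. knorm2 k c \<ge> 0) \<and>
     (\<forall>g. continuous_on X g \<longrightarrow>
        (\<forall>e>0. \<exists>f\<in>rkhs k X. \<forall>x\<in>X. \<bar>f x - g x\<bar> < e))"

definition logistic_obj :: "('a \<Rightarrow> 'a \<Rightarrow> real) \<Rightarrow> 'a set \<Rightarrow> real \<Rightarrow> nat \<Rightarrow> (nat \<Rightarrow> 'a \<times> bool)
    \<Rightarrow> ('a \<Rightarrow> real) \<Rightarrow> real" where
  "logistic_obj k X lam m S f =
     lam / 2 * (rkhs_norm k X f)\<^sup>2 +
     (1 / real m) * (\<Sum>i<m. ln (1 + exp (- (2 * of_bool (snd (S i)) - 1) * f (fst (S i)))))"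

definition fhat :: "('a \<Rightarrow> 'a \<Rightarrow> real) \<Rightarrow> 'a set \<Rightarrow> real \<Rightarrow> nat \<Rightarrow> (nat \<Rightarrow> 'a \<times> bool) \<Rightarrow> 'a \<Rightarrow> real" where
  "fhat k X lam m S = (SOME f. f \<in> rkhs k X \<and>
       (\<forall>g\<in>rkhs k X. logistic_obj k X lam m S f \<le> logistic_obj k X lam m S g))"

definition etahat :: "('a \<Rightarrow> 'a \<Rightarrow> real) \<Rightarrow> 'a set \<Rightarrow> real \<Rightarrow> nat \<Rightarrow> (nat \<Rightarrow> 'a \<times> bool) \<Rightarrow> 'a \<Rightarrow> real" where
  "etahat k X lam m S x = 1 / (1 + exp (- fhat k X lam m S x))"

definition Qhat :: "nat \<Rightarrow> (nat \<Rightarrow> 'a) \<Rightarrow> 'a set \<Rightarrow> real" where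
  "Qhat n T G = real (card {i\<in>{..<n}. T i \<in> G}) / real n"

definition eps_n :: "nat \<Rightarrow> real" where
  "eps_n n = 4 * sqrt (ln (real n + 1) / real n)"

text \<open>Estimated threshold (an extended real, so that an infimum of an unbounded set is -\<infinity>)
  and estimated set.\<close>
definition that :: "('a \<Rightarrow> real) \<Rightarrow> nat \<Rightarrow> (nat \<Rightarrow> 'a) \<Rightarrow> real \<Rightarrow> real \<Rightarrow> real \<Rightarrow> ereal" where
  "that eh n T alpha beta gamma =
     Inf {ereal t | t. Qhat n T {x. eh x \<ge> t + beta} \<le> alpha + gamma + eps_n n}"

definition Ghat :: "('a \<Rightarrow> real) \<Rightarrow> nat \<Rightarrow> (nat \<Rightarrow> 'a) \<Rightarrow> real \<Rightarrow> real \<Rightarrow> real \<Rightarrow> 'a set" where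
  "Ghat eh n T alpha beta gamma = {x. ereal (eh x) \<ge> that eh n T alpha beta gamma}"

definition sample_space :: "('a \<times> bool) measure \<Rightarrow> 'a measure \<Rightarrow> nat \<Rightarrow> nat
    \<Rightarrow> ((nat \<Rightarrow> 'a \<times> bool) \<times> (nat \<Rightarrow> 'a)) measure" where
  "sample_space P QX m n = (PiM {..<m} (\<lambda>_. P)) \<Otimes>\<^sub>M (PiM {..<n} (\<lambda>_. QX))"

end

theory Submission
  imports Defs
begin

text \<open>
  Taking both tuning parameters to be 0 works for every tolerance. Comparing the minimisers for two
  samples that differ in one point shows that they differ by O(1 / (m lam)) in sup norm; hence the
  expected logistic risk of the estimator exceeds its expected empirical risk by no more than that,
  and the empirical risk is controlled by comparing with a fixed element of the RKHS. By
  universality this element can be taken with almost minimal risk, and the excess logistic risk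
  dominates the squared distance between the estimated and the true regression function in
  L2(P_X). So the estimated regression function is close to the true one outside a set of small
  P_X-measure, hence of small Q_X-measure.

  By (B), the level sets of the regression function at t0 + d and t0 - d have Q_X-measure bounded away
  from alpha, so by Hoeffding's inequality at only two levels the estimated threshold lies in
  [t0 - 2 d, t0 + 2 d], and the symmetric difference is contained in the exceptional set and a strip
  around t0 whose Q_X-measure is small by (B).

  Since the measure of a non-measurable set is 0, the event itself has to be shown measurable; this
  rests on the continuous dependence of the estimator on the sample.
\<close>

section \<open>The pre-Hilbert space of finite kernel expansions\<close>

text \<open>Both \<open>rkhs_norm\<close> and \<open>fhat\<close> are given by choice, so nothing is
  known of them until the norm is shown to be independent of the approximating sequence and a
  minimiser is shown to exist. Existence, stability under a changed sample point and continuity in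
  the sample all come from one strong convexity inequality, the parallelogram law applied to the
  penalty. Stability takes the place of a uniform bound over RKHS balls, whose radius sqrt (2 ln 2 /
  lam) grows as \<open>lam\<close> tends to 0. The true logit ln (eta / (1 - eta)) may be infinite,
  so what is approximated is the logit of a regression function pushed away from 0 and 1.
  Approximation in L1 suffices because the logistic loss is 1-Lipschitz in the score; this is how a
  merely measurable regression function is reached from continuous ones. The tuning parameters can
  vanish because the tolerance fixes a margin d and a slack r once and for all, and
  \<open>eps_n n\<close> eventually falls below r.\<close>

definition kinner :: "('a \<Rightarrow> 'a \<Rightarrow> real) \<Rightarrow> ('a \<Rightarrow> real) \<Rightarrow> ('a \<Rightarrow> real) \<Rightarrow> real" where
  "kinner k c d = (\<Sum>x\<in>{x. c x \<noteq> 0}. \<Sum>y\<in>{x. d x \<noteq> 0}. c x * d y * k x y)"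

lemma fin_coeffs_add: "c \<in> fin_coeffs X \<Longrightarrow> d \<in> fin_coeffs X \<Longrightarrow> (\<lambda>x. a * c x + b * d x) \<in> fin_coeffs X"
  by (cases "a = 0 \<or> b = 0")
    (auto simp: fin_coeffs_def subset_iff
      intro!: finite_subset[of "{x. a * c x + b * d x \<noteq> 0}" "{x. c x \<noteq> 0} \<union> {x. d x \<noteq> 0}"],
      (metis mult_zero_right add_0)+)

lemma fin_coeffs_diff: "c \<in> fin_coeffs X \<Longrightarrow> d \<in> fin_coeffs X \<Longrightarrow> (\<lambda>x. c x - d x) \<in> fin_coeffs X"
  using fin_coeffs_add[of c X d 1 "-1"] by simp

lemma fin_coeffs_single: "x \<in> X \<Longrightarrow> (\<lambda>z. of_bool (z = x)) \<in> fin_coeffs X"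
  unfolding fin_coeffs_def by auto

lemma fin_coeffs_zero: "(\<lambda>x. 0) \<in> fin_coeffs X"
  unfolding fin_coeffs_def by auto

lemma kcomb_superset:
  "finite F \<Longrightarrow> {x. c x \<noteq> 0} \<subseteq> F \<Longrightarrow> kcomb k c y = (\<Sum>x\<in>F. c x * k x y)"
  unfolding kcomb_def by (rule sum.mono_neutral_left) auto

lemma kinner_superset:
  assumes "finite F" "{x. c x \<noteq> 0} \<subseteq> F" "{x. d x \<noteq> 0} \<subseteq> F"
  shows "kinner k c d = (\<Sum>x\<in>F. \<Sum>y\<in>F. c x * d y * k x y)"
proof -
  have "kinner k c d = (\<Sum>x\<in>{x. c x \<noteq> 0}. \<Sum>y\<in>F. c x * d y * k x y)"
    unfolding kinner_def using assms by (intro sum.cong refl sum.mono_neutral_left) auto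
  also have "\<dots> = (\<Sum>x\<in>F. \<Sum>y\<in>F. c x * d y * k x y)"
    using assms by (intro sum.mono_neutral_left) auto
  finally show ?thesis .
qed

lemma knorm2_kinner: "knorm2 k c = kinner k c c"
  unfolding knorm2_def kinner_def by simp

lemma kcomb_linear:
  assumes "c \<in> fin_coeffs X" "d \<in> fin_coeffs X"
  shows "kcomb k (\<lambda>x. a * c x + b * d x) y = a * kcomb k c y + b * kcomb k d y"
proof -
  let ?F = "{x. c x \<noteq> 0} \<union> {x. d x \<noteq> 0}"
  have F: "finite ?F" using assms by (auto simp: fin_coeffs_def)
  have "{x. a * c x + b * d x \<noteq> 0} \<subseteq> ?F" by auto
  then show ?thesis
    using F by (simp add: kcomb_superset[of ?F] sum.distrib sum_distrib_left algebra_simps)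
qed

lemma kcomb_diff:
  assumes "c \<in> fin_coeffs X" "d \<in> fin_coeffs X"
  shows "kcomb k (\<lambda>x. c x - d x) y = kcomb k c y - kcomb k d y"
  using kcomb_linear[OF assms, of k 1 "-1"] by simp

lemma kinner_linear_right:
  assumes "c \<in> fin_coeffs X" "d \<in> fin_coeffs X" "e \<in> fin_coeffs X"
  shows "kinner k e (\<lambda>x. a * c x + b * d x) = a * kinner k e c + b * kinner k e d"
proof -
  let ?F = "{x. c x \<noteq> 0} \<union> {x. d x \<noteq> 0} \<union> {x. e x \<noteq> 0}"
  have F: "finite ?F" using assms by (auto simp: fin_coeffs_def)
  have "kinner k e (\<lambda>x. a * c x + b * d x) = (\<Sum>x\<in>?F. \<Sum>y\<in>?F. e x * (a * c y + b * d y) * k x y)"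
    by (rule kinner_superset[OF F]) auto
  also have "\<dots> = a * (\<Sum>x\<in>?F. \<Sum>y\<in>?F. e x * c y * k x y) + b * (\<Sum>x\<in>?F. \<Sum>y\<in>?F. e x * d y * k x y)"
    by (simp add: sum.distrib sum_distrib_left algebra_simps)
  also have "(\<Sum>x\<in>?F. \<Sum>y\<in>?F. e x * c y * k x y) = kinner k e c"
    by (rule kinner_superset[OF F, symmetric]) auto
  also have "(\<Sum>x\<in>?F. \<Sum>y\<in>?F. e x * d y * k x y) = kinner k e d"
    by (rule kinner_superset[OF F, symmetric]) auto
  finally show ?thesis .
qed

text \<open>The reproducing property of the pre-Hilbert space: for fixed \<open>d\<close> the
  pairing sees only finitely many values of the function represented by \<open>c\<close>, so
  pointwise convergence passes to inner products.\<close>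

lemma kinner_eq_sum_kcomb:
  "kinner k c d = (\<Sum>y\<in>{x. d x \<noteq> 0}. d y * kcomb k c y)"
  unfolding kinner_def kcomb_def
  by (subst sum.swap) (simp add: sum_distrib_left algebra_simps)

locale psd_kernel =
  fixes k :: "'a \<Rightarrow> 'a \<Rightarrow> real" and X :: "'a set"
  assumes sym: "x \<in> X \<Longrightarrow> y \<in> X \<Longrightarrow> k x y = k y x"
    and psd: "c \<in> fin_coeffs X \<Longrightarrow> 0 \<le> knorm2 k c"
begin

lemma kinner_commute:
  assumes "c \<in> fin_coeffs X" "d \<in> fin_coeffs X"
  shows "kinner k c d = kinner k d c"
proof -
  have "k x y = k y x" if "c x \<noteq> 0" "d y \<noteq> 0" for x y
    using assms that by (intro sym) (auto simp: fin_coeffs_def)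
  then show ?thesis
    unfolding kinner_def by (subst sum.swap) (auto intro!: sum.cong)
qed

lemma knorm2_linear:
  assumes "c \<in> fin_coeffs X" "d \<in> fin_coeffs X"
  shows "knorm2 k (\<lambda>x. a * c x + b * d x)
    = a\<^sup>2 * knorm2 k c + 2 * a * b * kinner k c d + b\<^sup>2 * knorm2 k d"
proof -
  let ?e = "\<lambda>x. a * c x + b * d x"
  note e = fin_coeffs_add[OF assms, of a b]
  have "knorm2 k ?e = a * kinner k ?e c + b * kinner k ?e d"
    unfolding knorm2_kinner by (rule kinner_linear_right[OF assms e])
  moreover have "kinner k ?e c = a * knorm2 k c + b * kinner k c d"
    using assms e by (simp add: kinner_commute[of ?e] kinner_linear_right knorm2_kinner)
  moreover have "kinner k ?e d = a * kinner k c d + b * knorm2 k d"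
    using assms e by (simp add: kinner_commute[of ?e] kinner_linear_right knorm2_kinner kinner_commute[of d c])
  ultimately show ?thesis by (simp add: power2_eq_square algebra_simps)
qed

text \<open>The kernel may be degenerate, so \<open>knorm2\<close> is only a seminorm on
  coefficients and a vanishing norm has to be treated apart.\<close>

lemma kinner_CS:
  assumes "c \<in> fin_coeffs X" "d \<in> fin_coeffs X"
  shows "\<bar>kinner k c d\<bar> \<le> sqrt (knorm2 k c) * sqrt (knorm2 k d)"
proof -
  let ?C = "knorm2 k c" and ?D = "knorm2 k d" and ?I = "kinner k c d"
  have *: "0 \<le> a\<^sup>2 * ?C + 2 * a * b * ?I + b\<^sup>2 * ?D" for a b
    using psd[OF fin_coeffs_add[OF assms, of a b]] knorm2_linear[OF assms] by simp
  have C: "0 \<le> ?C" and D: "0 \<le> ?D" using psd assms by auto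
  have "?I\<^sup>2 \<le> ?C * ?D"
  proof (cases "?D = 0")
    case True
    have "?I = 0"
    proof (rule ccontr)
      assume "?I \<noteq> 0"
      \<comment> \<open>For \<open>?D\<close> = 0 the quadratic form is affine in b; this b makes it
        equal to -1, against positivity.\<close>
      then have "?C + 2 * (- (?C + 1) / (2 * ?I)) * ?I = - 1" by (simp add: field_simps)
      with *[of 1 "- (?C + 1) / (2 * ?I)"] True show False by simp
    qed
    with C D show ?thesis by simp
  next
    case False
    with D have "0 < ?D" by simp
    \<comment> \<open>The pair a = D, b = -I minimises the form up to scaling; what remains is D
      times the Gram determinant C D - I^2.\<close>
    have "0 \<le> ?D\<^sup>2 * ?C + 2 * ?D * (- ?I) * ?I + (- ?I)\<^sup>2 * ?D" by (rule *)
    then have "0 \<le> ?D * (?C * ?D - ?I\<^sup>2)" by (simp add: power2_eq_square algebra_simps)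
    with \<open>0 < ?D\<close> show ?thesis by (simp add: zero_le_mult_iff)
  qed
  then have "sqrt (?I\<^sup>2) \<le> sqrt (?C * ?D)" by (rule real_sqrt_le_mono)
  then show ?thesis by (simp add: real_sqrt_mult)
qed

lemma knorm_triangle:
  assumes "c \<in> fin_coeffs X" "d \<in> fin_coeffs X"
  shows "\<bar>sqrt (knorm2 k c) - sqrt (knorm2 k d)\<bar> \<le> sqrt (knorm2 k (\<lambda>x. c x - d x))"
proof -
  have "(sqrt (knorm2 k c) - sqrt (knorm2 k d))\<^sup>2
      = knorm2 k c - 2 * (sqrt (knorm2 k c) * sqrt (knorm2 k d)) + knorm2 k d"
    using assms psd by (simp add: power2_diff)
  also have "\<dots> \<le> knorm2 k c - 2 * kinner k c d + knorm2 k d"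
    using kinner_CS[OF assms] by linarith
  also have "\<dots> = knorm2 k (\<lambda>x. c x - d x)"
    using knorm2_linear[OF assms, of 1 "-1"] by simp
  finally have "sqrt ((sqrt (knorm2 k c) - sqrt (knorm2 k d))\<^sup>2) \<le> sqrt (knorm2 k (\<lambda>x. c x - d x))"
    by (rule real_sqrt_le_mono)
  then show ?thesis by simp
qed

lemma kinner_single: "kinner k c (\<lambda>z. of_bool (z = x)) = kcomb k c x"
proof -
  have "{z. of_bool (z = x) \<noteq> (0::real)} = {x}" by auto
  then show ?thesis unfolding kinner_eq_sum_kcomb by simp
qed

lemma kcomb_single: "kcomb k (\<lambda>z. of_bool (z = x)) y = k x y"
proof -
  have "{z. of_bool (z = x) \<noteq> (0::real)} = {x}" by auto
  then show ?thesis unfolding kcomb_def by simp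
qed

lemma kcomb_bound:
  assumes "c \<in> fin_coeffs X" "x \<in> X"
  shows "\<bar>kcomb k c x\<bar> \<le> sqrt (knorm2 k c) * sqrt (k x x)"
  using kinner_CS[OF assms(1) fin_coeffs_single[OF assms(2)]]
  by (simp add: kinner_single knorm2_kinner[of k "\<lambda>z. of_bool (z = x)"] kcomb_single)

text \<open>Cauchy-Schwarz against the difference of the two point masses, whose squared norm is the
  last factor under the root.\<close>

lemma kcomb_diff_bound:
  assumes "c \<in> fin_coeffs X" "x \<in> X" "y \<in> X"
  shows "\<bar>kcomb k c x - kcomb k c y\<bar> \<le> sqrt (knorm2 k c) * sqrt (k x x - 2 * k x y + k y y)"
proof -
  let ?x = "\<lambda>z. of_bool (z = x) :: real" and ?y = "\<lambda>z. of_bool (z = y) :: real"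
  note s = fin_coeffs_single[OF assms(2)] fin_coeffs_single[OF assms(3)]
  have "kinner k c (\<lambda>z. 1 * ?x z + (-1) * ?y z) = kcomb k c x - kcomb k c y"
    by (subst kinner_linear_right[OF s assms(1)]) (simp add: kinner_single)
  moreover have "knorm2 k (\<lambda>z. 1 * ?x z + (-1) * ?y z) = k x x - 2 * k x y + k y y"
    by (subst knorm2_linear[OF s]) (simp add: knorm2_kinner kinner_single kcomb_single)
  ultimately show ?thesis
    using kinner_CS[OF assms(1) fin_coeffs_add[OF s, of 1 "-1"]] by metis
qed

section \<open>The reproducing kernel Hilbert space\<close>

lemma knorm_Cauchy:
  assumes "\<And>n. cs n \<in> fin_coeffs X"
    and "\<forall>e>0. \<exists>N. \<forall>p\<ge>N. \<forall>q\<ge>N. knorm2 k (\<lambda>x. cs p x - cs q x) < e"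
  shows "convergent (\<lambda>n. sqrt (knorm2 k (cs n)))"
proof -
  have "Cauchy (\<lambda>n. sqrt (knorm2 k (cs n)))"
  proof (rule metric_CauchyI)
    fix e :: real assume "0 < e"
    then obtain N where N: "\<forall>p\<ge>N. \<forall>q\<ge>N. knorm2 k (\<lambda>x. cs p x - cs q x) < e\<^sup>2"
      using assms(2) by (metis zero_less_power)
    have "dist (sqrt (knorm2 k (cs p))) (sqrt (knorm2 k (cs q))) < e" if "p \<ge> N" "q \<ge> N" for p q
    proof -
      have "sqrt (knorm2 k (\<lambda>x. cs p x - cs q x)) < sqrt (e\<^sup>2)"
        using N that by (intro real_sqrt_less_mono) blast
      then show ?thesis
        using knorm_triangle[OF assms(1) assms(1), of p q] \<open>0 < e\<close> by (simp add: dist_real_def)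
    qed
    then show "\<exists>N. \<forall>p\<ge>N. \<forall>q\<ge>N. dist (sqrt (knorm2 k (cs p))) (sqrt (knorm2 k (cs q))) < e"
      by blast
  qed
  then show ?thesis by (simp add: Cauchy_convergent_iff)
qed

text \<open>This makes the completion a space of functions: a Cauchy sequence vanishing pointwise in
  the limit vanishes in norm. The squared norm of \<open>cs n\<close> is its pairing with
  \<open>cs n\<close> - \<open>cs N\<close> plus its pairing with \<open>cs N\<close>. The first is
  small by Cauchy-Schwarz and boundedness; the second involves only the finite support of
  \<open>cs N\<close>, where pointwise convergence applies.\<close>

lemma knorm_tendsto_zero:
  assumes cs: "\<And>n. cs n \<in> fin_coeffs X"
    and Cau: "\<forall>e>0. \<exists>N. \<forall>p\<ge>N. \<forall>q\<ge>N. knorm2 k (\<lambda>x. cs p x - cs q x) < e"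
    and zero: "\<forall>y\<in>X. (\<lambda>n. kcomb k (cs n) y) \<longlonglongrightarrow> 0"
  shows "(\<lambda>n. knorm2 k (cs n)) \<longlonglongrightarrow> 0"
proof (rule LIMSEQ_I)
  fix e :: real assume "0 < e"
  have "Bseq (\<lambda>n. sqrt (knorm2 k (cs n)))"
    using knorm_Cauchy[OF cs Cau] by (simp add: convergent_imp_Bseq)
  then obtain B where B: "0 < B" "\<And>n. norm (sqrt (knorm2 k (cs n))) \<le> B"
    by (meson BseqE)
  obtain N where N: "\<forall>p\<ge>N. \<forall>q\<ge>N. knorm2 k (\<lambda>x. cs p x - cs q x) < (e / (2 * B))\<^sup>2"
    using Cau \<open>0 < e\<close> B(1) by (metis divide_pos_pos mult_pos_pos zero_less_numeral zero_less_power)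
  have "(\<lambda>n. \<Sum>y\<in>{x. cs N x \<noteq> 0}. cs N y * kcomb k (cs n) y) \<longlonglongrightarrow> (\<Sum>y\<in>{x. cs N x \<noteq> 0}. cs N y * 0)"
    using zero cs[of N] by (intro tendsto_sum tendsto_mult tendsto_const) (auto simp: fin_coeffs_def)
  then have "(\<lambda>n. kinner k (cs n) (cs N)) \<longlonglongrightarrow> 0" by (simp add: kinner_eq_sum_kcomb)
  then obtain M where M: "\<And>n. n \<ge> M \<Longrightarrow> \<bar>kinner k (cs n) (cs N)\<bar> < e / 2"
    using LIMSEQ_D[of _ 0 "e/2"] \<open>0 < e\<close> by (metis diff_zero half_gt_zero real_norm_def)
  have "norm (knorm2 k (cs n) - 0) < e" if n: "n \<ge> max M N" for n
  proof -
    have "knorm2 k (cs n) = kinner k (cs n) (\<lambda>x. cs n x - cs N x) + kinner k (cs n) (cs N)"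
      using kinner_linear_right[OF cs[of n] cs[of N] cs[of n], of k 1 "-1"]
      by (simp add: knorm2_kinner)
    moreover have "\<bar>kinner k (cs n) (\<lambda>x. cs n x - cs N x)\<bar>
        \<le> sqrt (knorm2 k (cs n)) * sqrt (knorm2 k (\<lambda>x. cs n x - cs N x))"
      by (intro kinner_CS fin_coeffs_diff cs)
    moreover have "\<dots> \<le> B * (e / (2 * B))"
    proof (intro mult_mono)
      show "sqrt (knorm2 k (cs n)) \<le> B" using B(2)[of n] by simp
      have "knorm2 k (\<lambda>x. cs n x - cs N x) \<le> (e / (2 * B))\<^sup>2" using N n by (simp add: less_imp_le)
      then have "sqrt (knorm2 k (\<lambda>x. cs n x - cs N x)) \<le> sqrt ((e / (2 * B))\<^sup>2)"
        by (rule real_sqrt_le_mono)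
      then show "sqrt (knorm2 k (\<lambda>x. cs n x - cs N x)) \<le> e / (2 * B)"
        using \<open>0 < e\<close> B(1) by simp
      show "0 \<le> sqrt (knorm2 k (\<lambda>x. cs n x - cs N x))"
        by (simp add: psd fin_coeffs_diff cs)
    qed (use B in auto)
    moreover have "B * (e / (2 * B)) = e / 2" using B(1) by simp
    ultimately show ?thesis
      using M[of n] n psd[OF cs, of n] by auto
  qed
  then show "\<exists>no. \<forall>n\<ge>no. norm (knorm2 k (cs n) - 0) < e" by blast
qed

text \<open>The two sides differ by the squared norm of a c - b d.\<close>

lemma knorm2_diff_linear_le:
  assumes "c \<in> fin_coeffs X" "d \<in> fin_coeffs X"
  shows "knorm2 k (\<lambda>x. a * c x + b * d x) \<le> 2 * a\<^sup>2 * knorm2 k c + 2 * b\<^sup>2 * knorm2 k d"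
  using psd[OF fin_coeffs_add[OF assms, of a "-b"]]
  unfolding knorm2_linear[OF assms] by (simp add: power2_eq_square)

lemma rkhs_approx_linear:
  assumes f: "rkhs_approx k X f cs" and g: "rkhs_approx k X g ds"
  shows "rkhs_approx k X (\<lambda>x. a * f x + b * g x) (\<lambda>n x. a * cs n x + b * ds n x)"
proof -
  have cs: "cs n \<in> fin_coeffs X" and ds: "ds n \<in> fin_coeffs X" for n
    using assms by (auto simp: rkhs_approx_def)
  have Cau: "\<exists>N. \<forall>p\<ge>N. \<forall>q\<ge>N.
      knorm2 k (\<lambda>x. (a * cs p x + b * ds p x) - (a * cs q x + b * ds q x)) < e" if "e > 0" for e
  proof -
    \<comment> \<open>The summand 1 keeps the denominator positive when the coefficient is
      0.\<close>
    have aux: "0 < e / (2 * (2 * t\<^sup>2 + 1))" for t :: real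
      using \<open>e > 0\<close> by (intro divide_pos_pos) (auto intro: add_nonneg_pos)
    obtain N1 where N1: "\<forall>p\<ge>N1. \<forall>q\<ge>N1. knorm2 k (\<lambda>x. cs p x - cs q x) < e / (2 * (2 * a\<^sup>2 + 1))"
      using f aux[of a] unfolding rkhs_approx_def by blast
    obtain N2 where N2: "\<forall>p\<ge>N2. \<forall>q\<ge>N2. knorm2 k (\<lambda>x. ds p x - ds q x) < e / (2 * (2 * b\<^sup>2 + 1))"
      using g aux[of b] unfolding rkhs_approx_def by blast
    have small: "2 * t\<^sup>2 * u < e / 2" if u: "0 \<le> u" "u < e / (2 * (2 * t\<^sup>2 + 1))" for t u :: real
    proof -
      have pos: "0 < 2 * t\<^sup>2 + 1" by (auto intro: add_nonneg_pos)
      have "2 * t\<^sup>2 * u \<le> (2 * t\<^sup>2 + 1) * u" using u by (simp add: algebra_simps)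
      also have "\<dots> < (2 * t\<^sup>2 + 1) * (e / (2 * (2 * t\<^sup>2 + 1)))" using u pos by (intro mult_strict_left_mono)
      also have "\<dots> = e / 2" using pos by (simp add: field_simps)
      finally show ?thesis .
    qed
    have "knorm2 k (\<lambda>x. (a * cs p x + b * ds p x) - (a * cs q x + b * ds q x)) < e"
      if "p \<ge> max N1 N2" "q \<ge> max N1 N2" for p q
    proof -
      have eq: "(\<lambda>x. (a * cs p x + b * ds p x) - (a * cs q x + b * ds q x))
        = (\<lambda>x. a * (cs p x - cs q x) + b * (ds p x - ds q x))" by (auto simp: algebra_simps)
      have "knorm2 k (\<lambda>x. a * (cs p x - cs q x) + b * (ds p x - ds q x))
         \<le> 2 * a\<^sup>2 * knorm2 k (\<lambda>x. cs p x - cs q x) + 2 * b\<^sup>2 * knorm2 k (\<lambda>x. ds p x - ds q x)"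
        by (intro knorm2_diff_linear_le fin_coeffs_diff cs ds)
      moreover have "2 * a\<^sup>2 * knorm2 k (\<lambda>x. cs p x - cs q x) < e / 2"
        using N1 that by (intro small psd fin_coeffs_diff cs) auto
      moreover have "2 * b\<^sup>2 * knorm2 k (\<lambda>x. ds p x - ds q x) < e / 2"
        using N2 that by (intro small psd fin_coeffs_diff ds) auto
      ultimately show ?thesis unfolding eq by linarith
    qed
    then show ?thesis by blast
  qed
  have "(\<lambda>n. kcomb k (\<lambda>x. a * cs n x + b * ds n x) y) \<longlonglongrightarrow> a * f y + b * g y" if "y \<in> X" for y
    using assms that unfolding kcomb_linear[OF cs ds] rkhs_approx_def
    by (intro tendsto_intros) auto
  then show ?thesis
    using assms Cau unfolding rkhs_approx_def by (auto intro: fin_coeffs_add)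
qed

lemma rkhs_linear: "f \<in> rkhs k X \<Longrightarrow> g \<in> rkhs k X \<Longrightarrow> (\<lambda>x. a * f x + b * g x) \<in> rkhs k X"
  unfolding rkhs_def using rkhs_approx_linear by blast

text \<open>The difference of two approximating sequences of the same f represents the zero
  function, so its norm tends to 0. Hence the sequence picked inside \<open>rkhs_norm\<close> may be
  replaced by any other.\<close>

lemma rkhs_norm_tendsto:
  assumes f: "rkhs_approx k X f cs"
  shows "(\<lambda>n. sqrt (knorm2 k (cs n))) \<longlonglongrightarrow> rkhs_norm k X f"
proof -
  define ds where "ds = (SOME ds. rkhs_approx k X f ds)"
  have g: "rkhs_approx k X f ds" unfolding ds_def by (rule someI[of _ cs]) (rule f)
  have cs: "cs n \<in> fin_coeffs X" and ds: "ds n \<in> fin_coeffs X" for n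
    using f g by (auto simp: rkhs_approx_def)
  have "convergent (\<lambda>n. sqrt (knorm2 k (ds n)))"
    using g unfolding rkhs_approx_def by (intro knorm_Cauchy) auto
  then have lim: "(\<lambda>n. sqrt (knorm2 k (ds n))) \<longlonglongrightarrow> rkhs_norm k X f"
    unfolding rkhs_norm_def ds_def[symmetric] by (simp add: convergent_LIMSEQ_iff)
  have "rkhs_approx k X (\<lambda>x. 0) (\<lambda>n x. cs n x - ds n x)"
    using rkhs_approx_linear[OF f g, of 1 "-1"] by simp
  then have "(\<lambda>n. knorm2 k (\<lambda>x. cs n x - ds n x)) \<longlonglongrightarrow> 0"
    unfolding rkhs_approx_def by (intro knorm_tendsto_zero) auto
  then have "(\<lambda>n. sqrt (knorm2 k (\<lambda>x. cs n x - ds n x))) \<longlonglongrightarrow> 0"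
    using tendsto_real_sqrt by fastforce
  then have "(\<lambda>n. sqrt (knorm2 k (cs n)) - sqrt (knorm2 k (ds n))) \<longlonglongrightarrow> 0"
    by (rule Lim_null_comparison[rotated]) (simp add: knorm_triangle cs ds)
  from tendsto_add[OF this lim] show ?thesis by simp
qed

lemma rkhs_norm_nonneg: "f \<in> rkhs k X \<Longrightarrow> 0 \<le> rkhs_norm k X f"
  unfolding rkhs_def
  by (auto dest: rkhs_norm_tendsto intro!: LIMSEQ_le_const[OF rkhs_norm_tendsto]
     simp: rkhs_approx_def psd)

lemma rkhs_approx_norm2:
  assumes "rkhs_approx k X f cs"
  shows "(\<lambda>n. knorm2 k (cs n)) \<longlonglongrightarrow> (rkhs_norm k X f)\<^sup>2"
proof -
  have "(sqrt (knorm2 k (cs n)))\<^sup>2 = knorm2 k (cs n)" for n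
    using assms psd by (auto simp: rkhs_approx_def)
  with tendsto_power[OF rkhs_norm_tendsto[OF assms], of 2] show ?thesis by simp
qed

text \<open>Exact on coefficient functions, hence in the limit. The midpoint form is the one that
  combines with midpoint convexity of the loss.\<close>

lemma rkhs_parallelogram:
  assumes "f \<in> rkhs k X" "g \<in> rkhs k X"
  shows "(rkhs_norm k X (\<lambda>x. (f x + g x) / 2))\<^sup>2
    = (rkhs_norm k X f)\<^sup>2 / 2 + (rkhs_norm k X g)\<^sup>2 / 2 - (rkhs_norm k X (\<lambda>x. f x - g x))\<^sup>2 / 4"
proof -
  obtain cs ds where f: "rkhs_approx k X f cs" and g: "rkhs_approx k X g ds"
    using assms by (auto simp: rkhs_def)
  have cs: "cs n \<in> fin_coeffs X" and ds: "ds n \<in> fin_coeffs X" for n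
    using f g by (auto simp: rkhs_approx_def)
  have 1: "(\<lambda>n. knorm2 k (\<lambda>x. (1/2) * cs n x + (1/2) * ds n x)) \<longlonglongrightarrow> (rkhs_norm k X (\<lambda>x. (f x + g x) / 2))\<^sup>2"
    using rkhs_approx_norm2[OF rkhs_approx_linear[OF f g, of "1/2" "1/2"]]
    by (simp add: add_divide_distrib)
  have 2: "(\<lambda>n. knorm2 k (\<lambda>x. 1 * cs n x + (-1) * ds n x)) \<longlonglongrightarrow> (rkhs_norm k X (\<lambda>x. f x - g x))\<^sup>2"
    using rkhs_approx_norm2[OF rkhs_approx_linear[OF f g, of "1" "-1"]] by simp
  have "(\<lambda>n. knorm2 k (cs n) / 2 + knorm2 k (ds n) / 2 - knorm2 k (\<lambda>x. 1 * cs n x + (-1) * ds n x) / 4)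
    \<longlonglongrightarrow> (rkhs_norm k X f)\<^sup>2 / 2 + (rkhs_norm k X g)\<^sup>2 / 2 - (rkhs_norm k X (\<lambda>x. f x - g x))\<^sup>2 / 4"
    by (intro tendsto_intros 2 rkhs_approx_norm2 f g) simp_all
  moreover have "knorm2 k (cs n) / 2 + knorm2 k (ds n) / 2 - knorm2 k (\<lambda>x. 1 * cs n x + (-1) * ds n x) / 4
     = knorm2 k (\<lambda>x. (1/2) * cs n x + (1/2) * ds n x)" for n
    unfolding knorm2_linear[OF cs ds] by (simp add: power2_eq_square field_simps)
  ultimately show ?thesis using 1 by (simp add: LIMSEQ_unique)
qed

lemma rkhs_zero_outside: "f \<in> rkhs k X \<Longrightarrow> x \<notin> X \<Longrightarrow> f x = 0"
  by (auto simp: rkhs_def rkhs_approx_def)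

lemma rkhs_eval_bound:
  assumes "f \<in> rkhs k X" "x \<in> X"
  shows "\<bar>f x\<bar> \<le> rkhs_norm k X f * sqrt (k x x)"
proof -
  obtain cs where cs: "rkhs_approx k X f cs" using assms by (auto simp: rkhs_def)
  show ?thesis
  proof (rule LIMSEQ_le)
    show "(\<lambda>n. \<bar>kcomb k (cs n) x\<bar>) \<longlonglongrightarrow> \<bar>f x\<bar>"
      using cs assms(2) by (auto simp: rkhs_approx_def intro!: tendsto_intros)
    show "(\<lambda>n. sqrt (knorm2 k (cs n)) * sqrt (k x x)) \<longlonglongrightarrow> rkhs_norm k X f * sqrt (k x x)"
      by (intro tendsto_intros rkhs_norm_tendsto cs)
    show "\<exists>N. \<forall>n\<ge>N. \<bar>kcomb k (cs n) x\<bar> \<le> sqrt (knorm2 k (cs n)) * sqrt (k x x)"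
      using cs assms(2) by (auto simp: rkhs_approx_def intro!: kcomb_bound)
  qed
qed

lemma rkhs_diff_bound:
  assumes "f \<in> rkhs k X" "x \<in> X" "y \<in> X"
  shows "\<bar>f x - f y\<bar> \<le> rkhs_norm k X f * sqrt (k x x - 2 * k x y + k y y)"
proof -
  obtain cs where cs: "rkhs_approx k X f cs" using assms by (auto simp: rkhs_def)
  show ?thesis
  proof (rule LIMSEQ_le)
    show "(\<lambda>n. \<bar>kcomb k (cs n) x - kcomb k (cs n) y\<bar>) \<longlonglongrightarrow> \<bar>f x - f y\<bar>"
      using cs assms by (auto simp: rkhs_approx_def intro!: tendsto_intros)
    show "(\<lambda>n. sqrt (knorm2 k (cs n)) * sqrt (k x x - 2 * k x y + k y y))
        \<longlonglongrightarrow> rkhs_norm k X f * sqrt (k x x - 2 * k x y + k y y)"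
      by (intro tendsto_intros rkhs_norm_tendsto cs)
    show "\<exists>N. \<forall>n\<ge>N. \<bar>kcomb k (cs n) x - kcomb k (cs n) y\<bar>
        \<le> sqrt (knorm2 k (cs n)) * sqrt (k x x - 2 * k x y + k y y)"
      using cs assms by (auto simp: rkhs_approx_def intro!: kcomb_diff_bound)
  qed
qed

text \<open>Cutting off outside \<open>X\<close> follows the convention of
  \<open>rkhs_approx\<close>, so that a finite expansion is itself a member of the RKHS,
  approximated by a constant sequence.\<close>

definition kfun :: "('a \<Rightarrow> real) \<Rightarrow> 'a \<Rightarrow> real" where
  "kfun c = (\<lambda>x. if x \<in> X then kcomb k c x else 0)"

lemma kfun_approx: "c \<in> fin_coeffs X \<Longrightarrow> rkhs_approx k X (kfun c) (\<lambda>_. c)"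
  by (auto simp: rkhs_approx_def kfun_def knorm2_def)

lemma kfun_rkhs: "c \<in> fin_coeffs X \<Longrightarrow> kfun c \<in> rkhs k X"
  using kfun_approx by (auto simp: rkhs_def)

lemma rkhs_norm_kfun: "c \<in> fin_coeffs X \<Longrightarrow> rkhs_norm k X (kfun c) = sqrt (knorm2 k c)"
  using rkhs_norm_tendsto[OF kfun_approx] by (metis LIMSEQ_const_iff)

lemma kfun_diff:
  "c \<in> fin_coeffs X \<Longrightarrow> d \<in> fin_coeffs X \<Longrightarrow> (\<lambda>x. kfun c x - kfun d x) = kfun (\<lambda>x. c x - d x)"
  by (auto simp: kfun_def kcomb_diff)

lemma zero_rkhs: "(\<lambda>x. 0) \<in> rkhs k X" and rkhs_norm_zero: "rkhs_norm k X (\<lambda>x. 0) = 0"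
proof -
  have "kfun (\<lambda>x. 0) = (\<lambda>x. 0)" by (auto simp: kfun_def kcomb_def)
  then show "(\<lambda>x. 0) \<in> rkhs k X" "rkhs_norm k X (\<lambda>x. 0) = 0"
    using kfun_rkhs[OF fin_coeffs_zero] rkhs_norm_kfun[OF fin_coeffs_zero] by (auto simp: knorm2_def)
qed

end

section \<open>The regularised logistic regression estimator\<close>

definition logloss :: "bool \<Rightarrow> real \<Rightarrow> real" where
  "logloss b u = ln (1 + exp (- (2 * of_bool b - 1) * u))"

lemma one_plus_exp_pos: "0 < 1 + exp x" for x :: real
  by (simp add: add_pos_pos)

text \<open>For b \<le> a one has 1 + exp a \<le> exp (a - b) + exp a, and the right side is exp (a
  - b) * (1 + exp b); taking logarithms gives the bound without derivatives.\<close>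

lemma ln_1_exp_diff_le: "\<bar>ln (1 + exp a) - ln (1 + exp b)\<bar> \<le> \<bar>a - b\<bar>" for a b :: real
proof -
  have *: "ln (1 + exp a) \<le> (a - b) + ln (1 + exp b)" if "b \<le> a" for a b :: real
  proof -
    have "1 + exp a \<le> exp (a - b) * (1 + exp b)"
      using that by (simp add: algebra_simps flip: exp_add)
    then have "ln (1 + exp a) \<le> ln (exp (a - b) * (1 + exp b))"
      by (intro ln_mono) (auto intro: add_pos_pos mult_pos_pos)
    also have "\<dots> = (a - b) + ln (1 + exp b)"
      using one_plus_exp_pos[of b] by (subst ln_mult) auto
    finally show ?thesis .
  qed
  have mono: "ln (1 + exp b) \<le> ln (1 + exp a)" if "b \<le> a" for a b :: real
    using that by (intro ln_mono) (auto intro: add_pos_pos)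
  show ?thesis
    using *[of a b] *[of b a] mono[of a b] mono[of b a] by linarith
qed

lemma logloss_lipschitz: "\<bar>logloss b u - logloss b v\<bar> \<le> \<bar>u - v\<bar>"
  using ln_1_exp_diff_le[of "- (2 * of_bool b - 1) * u" "- (2 * of_bool b - 1) * v"]
  by (cases b) (auto simp: logloss_def)

lemma logloss_nonneg: "0 \<le> logloss b u"
  unfolding logloss_def by (intro ln_ge_zero) simp

lemma logloss_zero: "logloss b 0 = ln 2"
  by (simp add: logloss_def)

lemma logloss_bound: "\<bar>logloss b u\<bar> \<le> ln 2 + \<bar>u\<bar>"
  using logloss_lipschitz[of b u 0] logloss_nonneg[of b u] by (simp add: logloss_zero)

text \<open>In this form the label enters linearly, so averaging over the label turns it into the
  regression function.\<close>

lemma logloss_eq: "logloss b u = ln (1 + exp u) - of_bool b * u"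
proof (cases b)
  case True
  have "1 + exp (- u) = exp (- u) * (1 + exp u)" by (simp add: algebra_simps flip: exp_add)
  then have "ln (1 + exp (- u)) = ln (exp (- u) * (1 + exp u))" by simp
  also have "\<dots> = ln (1 + exp u) - u"
    using one_plus_exp_pos[of u] by (subst ln_mult) auto
  finally show ?thesis using True by (simp add: logloss_def)
qed (simp add: logloss_def)

text \<open>The linear part drops out, and for ln (1 + exp u) the claim reduces to the inequality of
  arithmetic and geometric means for exp s and exp t.\<close>

lemma logloss_midpoint: "logloss b ((u + v) / 2) \<le> (logloss b u + logloss b v) / 2"
proof -
  have *: "2 * ln (1 + exp ((s + t) / 2)) \<le> ln (1 + exp s) + ln (1 + exp t)" for s t :: real
  proof -
    have sq: "exp (s / 2) * exp (s / 2) = exp s" for s :: real by (simp flip: exp_add)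
    have "0 \<le> (exp (s / 2) - exp (t / 2))\<^sup>2" by simp
    then have "2 * (exp (s / 2) * exp (t / 2)) \<le> exp s + exp t"
      by (simp add: power2_eq_square algebra_simps sq)
    moreover have "exp ((s + t) / 2) = exp (s / 2) * exp (t / 2)"
      by (simp add: add_divide_distrib exp_add)
    moreover have "(exp (s / 2) * exp (t / 2)) * (exp (s / 2) * exp (t / 2)) = exp s * exp t"
      by (simp flip: exp_add)
    ultimately have "(1 + exp ((s + t) / 2)) * (1 + exp ((s + t) / 2)) \<le> (1 + exp s) * (1 + exp t)"
      by (simp add: algebra_simps)
    then have "ln ((1 + exp ((s + t) / 2)) * (1 + exp ((s + t) / 2))) \<le> ln ((1 + exp s) * (1 + exp t))"
      by (intro ln_mono mult_pos_pos one_plus_exp_pos)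
    then show ?thesis
      using one_plus_exp_pos[of "(s + t) / 2"] one_plus_exp_pos[of s] one_plus_exp_pos[of t]
      by (simp add: ln_mult)
  qed
  show ?thesis
    unfolding logloss_eq using *[of u v] by (simp add: field_simps)
qed

lemma logistic_obj_logloss:
  "logistic_obj k X lam m S f = lam / 2 * (rkhs_norm k X f)\<^sup>2
     + (1 / real m) * (\<Sum>i<m. logloss (snd (S i)) (f (fst (S i))))"
  by (simp add: logistic_obj_def logloss_def)

text \<open>Allows a sample to be rewritten beyond index m, as is done when the estimator is shown
  measurable.\<close>

lemma fhat_cong:
  assumes "\<And>i. i < m \<Longrightarrow> S i = S' i"
  shows "fhat k X lam m S = fhat k X lam m S'"
proof -
  have "logistic_obj k X lam m S = logistic_obj k X lam m S'"
    using assms by (auto simp: logistic_obj_logloss fun_eq_iff)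
  then show ?thesis by (simp add: fhat_def)
qed

section \<open>Strong convexity of the objective and existence of the minimiser\<close>

context psd_kernel
begin

lemma rkhs_diff: "f \<in> rkhs k X \<Longrightarrow> g \<in> rkhs k X \<Longrightarrow> (\<lambda>x. f x - g x) \<in> rkhs k X"
  using rkhs_linear[of f g 1 "-1"] by simp

lemma rkhs_midpoint: "f \<in> rkhs k X \<Longrightarrow> g \<in> rkhs k X \<Longrightarrow> (\<lambda>x. (f x + g x) / 2) \<in> rkhs k X"
  using rkhs_linear[of f g "1/2" "1/2"] by (simp add: add_divide_distrib)

lemma rkhs_norm_minus_commute:
  assumes "f \<in> rkhs k X" "g \<in> rkhs k X"
  shows "rkhs_norm k X (\<lambda>x. f x - g x) = rkhs_norm k X (\<lambda>x. g x - f x)"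
proof -
  have "(rkhs_norm k X (\<lambda>x. f x - g x))\<^sup>2 = (rkhs_norm k X (\<lambda>x. g x - f x))\<^sup>2"
    using rkhs_parallelogram[OF assms] rkhs_parallelogram[OF assms(2,1)] by (simp add: add.commute)
  then show ?thesis
    using assms by (simp add: rkhs_norm_nonneg rkhs_diff)
qed

text \<open>Strong convexity: the 1/4 of the parallelogram law times the penalty weight lam / 2
  gives lam / 8. The loss contributes plain convexity only.\<close>

lemma logistic_obj_midpoint:
  assumes f: "f \<in> rkhs k X" and g: "g \<in> rkhs k X"
  shows "logistic_obj k X lam m S (\<lambda>x. (f x + g x) / 2)
    \<le> (logistic_obj k X lam m S f + logistic_obj k X lam m S g) / 2
      - lam / 8 * (rkhs_norm k X (\<lambda>x. f x - g x))\<^sup>2"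
proof -
  let ?l = "\<lambda>f i. logloss (snd (S i)) (f (fst (S i)))"
  have "(\<Sum>i<m. ?l (\<lambda>x. (f x + g x) / 2) i) \<le> (\<Sum>i<m. (?l f i + ?l g i) / 2)"
    by (intro sum_mono logloss_midpoint)
  also have "\<dots> = ((\<Sum>i<m. ?l f i) + (\<Sum>i<m. ?l g i)) / 2"
    by (simp add: sum.distrib flip: sum_divide_distrib)
  finally have "(1 / real m) * (\<Sum>i<m. ?l (\<lambda>x. (f x + g x) / 2) i)
      \<le> (1 / real m) * (((\<Sum>i<m. ?l f i) + (\<Sum>i<m. ?l g i)) / 2)"
    by (intro mult_left_mono) auto
  then show ?thesis
    unfolding logistic_obj_logloss rkhs_parallelogram[OF f g]
    by (simp add: add_divide_distrib right_diff_distrib distrib_left)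
qed

text \<open>Serves twice: it provides near-minimisers among the finite expansions, and it evaluates
  the objective at the limit of a minimising sequence.\<close>

lemma logistic_obj_kfun_tendsto:
  assumes "rkhs_approx k X f cs"
  shows "(\<lambda>n. logistic_obj k X lam m S (kfun (cs n))) \<longlonglongrightarrow> logistic_obj k X lam m S f"
proof -
  have cs: "cs n \<in> fin_coeffs X" for n using assms by (auto simp: rkhs_approx_def)
  have pt: "(\<lambda>n. kfun (cs n) x) \<longlonglongrightarrow> f x" for x
    using assms by (cases "x \<in> X") (auto simp: kfun_def rkhs_approx_def)
  have "(\<lambda>n. logloss b (kfun (cs n) x)) \<longlonglongrightarrow> logloss b (f x)" for b x
  proof (rule Lim_transform2[OF tendsto_const])
    show "(\<lambda>n. logloss b (f x) - logloss b (kfun (cs n) x)) \<longlonglongrightarrow> 0"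
    proof (rule Lim_null_comparison)
      show "\<forall>\<^sub>F n in sequentially. norm (logloss b (f x) - logloss b (kfun (cs n) x)) \<le> \<bar>f x - kfun (cs n) x\<bar>"
        by (simp add: logloss_lipschitz)
      show "(\<lambda>n. \<bar>f x - kfun (cs n) x\<bar>) \<longlonglongrightarrow> 0"
        using tendsto_rabs[OF tendsto_diff[OF tendsto_const pt[of x], of "f x"]] by simp
    qed
  qed
  moreover have "(\<lambda>n. rkhs_norm k X (kfun (cs n))) \<longlonglongrightarrow> rkhs_norm k X f"
    using rkhs_norm_tendsto[OF assms] cs by (simp add: rkhs_norm_kfun)
  ultimately show ?thesis
    unfolding logistic_obj_logloss by (intro tendsto_intros)
qed

lemma logistic_obj_nonneg: "0 \<le> lam \<Longrightarrow> 0 \<le> logistic_obj k X lam m S f"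
  unfolding logistic_obj_logloss
  by (intro add_nonneg_nonneg mult_nonneg_nonneg sum_nonneg logloss_nonneg) auto

text \<open>A minimising sequence of finite kernel expansions is Cauchy by the parallelogram law,
  and its limit lies in the RKHS by construction of the completion.\<close>

lemma logistic_min_exists:
  assumes lam: "0 < lam"
  shows "\<exists>f\<in>rkhs k X. \<forall>g\<in>rkhs k X. logistic_obj k X lam m S f \<le> logistic_obj k X lam m S g"
proof -
  let ?J = "logistic_obj k X lam m S"
  define I where "I = Inf (?J ` rkhs k X)"
  have bdd: "bdd_below (?J ` rkhs k X)"
    using logistic_obj_nonneg lam by (intro bdd_belowI[of _ 0]) auto
  have I_le: "I \<le> ?J g" if "g \<in> rkhs k X" for g
    unfolding I_def using bdd that by (intro cInf_lower) auto
  have "\<exists>c\<in>fin_coeffs X. ?J (kfun c) < I + 1 / real (Suc n)" for n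
  proof -
    have "I < I + 1 / real (Suc n)" by simp
    then obtain g where g: "g \<in> rkhs k X" "?J g < I + 1 / real (Suc n)"
      using cInf_lessD[of "?J ` rkhs k X"] zero_rkhs unfolding I_def by blast
    then obtain cs where cs: "rkhs_approx k X g cs" by (auto simp: rkhs_def)
    have "\<forall>\<^sub>F j in sequentially. ?J (kfun (cs j)) < I + 1 / real (Suc n)"
      using order_tendstoD(2)[OF logistic_obj_kfun_tendsto[OF cs] g(2)] .
    then obtain j where "?J (kfun (cs j)) < I + 1 / real (Suc n)"
      by (meson eventually_sequentially order_refl)
    with cs show ?thesis by (auto simp: rkhs_approx_def)
  qed
  then obtain c where c: "\<And>n. c n \<in> fin_coeffs X" "\<And>n. ?J (kfun (c n)) < I + 1 / real (Suc n)"
    by metis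
  have gap: "lam / 4 * knorm2 k (\<lambda>x. c p x - c q x) \<le> 1 / real (Suc p) + 1 / real (Suc q)" for p q
  proof -
    have r: "kfun (c p) \<in> rkhs k X" "kfun (c q) \<in> rkhs k X" using c kfun_rkhs by auto
    have "I \<le> ?J (\<lambda>x. (kfun (c p) x + kfun (c q) x) / 2)" using r by (intro I_le rkhs_midpoint)
    also have "\<dots> \<le> (?J (kfun (c p)) + ?J (kfun (c q))) / 2
        - lam / 8 * (rkhs_norm k X (\<lambda>x. kfun (c p) x - kfun (c q) x))\<^sup>2"
      by (rule logistic_obj_midpoint[OF r])
    also have "(rkhs_norm k X (\<lambda>x. kfun (c p) x - kfun (c q) x))\<^sup>2 = knorm2 k (\<lambda>x. c p x - c q x)"
      using c(1) by (simp add: kfun_diff rkhs_norm_kfun fin_coeffs_diff psd)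
    finally have "2 * (lam / 8 * knorm2 k (\<lambda>x. c p x - c q x))
        \<le> ?J (kfun (c p)) + ?J (kfun (c q)) - 2 * I" by argo
    then show ?thesis using c(2)[of p] c(2)[of q] by simp
  qed
  have Cau: "\<exists>N. \<forall>p\<ge>N. \<forall>q\<ge>N. knorm2 k (\<lambda>x. c p x - c q x) < e" if "0 < e" for e
  proof -
    have "0 < e * lam / 8" using that lam by simp
    then obtain N where N: "1 / real (Suc N) < e * lam / 8" by (rule nat_approx_posE)
    have "knorm2 k (\<lambda>x. c p x - c q x) < e" if "p \<ge> N" "q \<ge> N" for p q
    proof -
      have "1 / real (Suc p) \<le> 1 / real (Suc N)" "1 / real (Suc q) \<le> 1 / real (Suc N)"
        using that by (auto simp: field_simps)
      then have "1 / real (Suc p) + 1 / real (Suc q) < e * lam / 8 + e * lam / 8"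
        using N by linarith
      with gap[of p q] have "lam / 4 * knorm2 k (\<lambda>x. c p x - c q x) < e * lam / 8 + e * lam / 8"
        by (rule order_le_less_trans)
      also have "e * lam / 8 + e * lam / 8 = lam / 4 * e" by simp
      finally have "lam / 4 * knorm2 k (\<lambda>x. c p x - c q x) < lam / 4 * e" .
      then show ?thesis using lam by simp
    qed
    then show ?thesis by blast
  qed
  define f where "f = (\<lambda>y. if y \<in> X then lim (\<lambda>n. kcomb k (c n) y) else 0)"
  have "(\<lambda>n. kcomb k (c n) y) \<longlonglongrightarrow> f y" if y: "y \<in> X" for y
  proof -
    have "Cauchy (\<lambda>n. kcomb k (c n) y)"
    proof (rule metric_CauchyI)
      fix e :: real assume e: "0 < e"
      have pos: "0 < \<bar>k y y\<bar> + 1" by simp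
      obtain N where N: "\<forall>p\<ge>N. \<forall>q\<ge>N. knorm2 k (\<lambda>x. c p x - c q x) < e\<^sup>2 / (\<bar>k y y\<bar> + 1)"
        using Cau[of "e\<^sup>2 / (\<bar>k y y\<bar> + 1)"] e pos by auto
      have "dist (kcomb k (c p) y) (kcomb k (c q) y) < e" if "p \<ge> N" "q \<ge> N" for p q
      proof -
        let ?n = "knorm2 k (\<lambda>x. c p x - c q x)"
        have n0: "0 \<le> ?n" by (intro psd fin_coeffs_diff c)
        have "\<bar>kcomb k (c p) y - kcomb k (c q) y\<bar> \<le> sqrt ?n * sqrt (k y y)"
          using kcomb_bound[OF fin_coeffs_diff[OF c(1) c(1)] y, of p q]
          by (simp add: kcomb_diff[OF c(1) c(1)])
        also have "\<dots> \<le> sqrt ?n * sqrt (\<bar>k y y\<bar> + 1)"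
          using n0 by (intro mult_left_mono real_sqrt_le_mono) auto
        also have "\<dots> = sqrt (?n * (\<bar>k y y\<bar> + 1))" by (simp add: real_sqrt_mult)
        also have "\<dots> < sqrt (e\<^sup>2)"
          using N that pos by (intro real_sqrt_less_mono) (simp add: pos_less_divide_eq)
        finally show ?thesis using e by (simp add: dist_real_def)
      qed
      then show "\<exists>N. \<forall>p\<ge>N. \<forall>q\<ge>N. dist (kcomb k (c p) y) (kcomb k (c q) y) < e" by blast
    qed
    then show ?thesis using y by (simp add: f_def Cauchy_convergent_iff convergent_LIMSEQ_iff)
  qed
  then have app: "rkhs_approx k X f c"
    using c Cau by (auto simp: rkhs_approx_def f_def)
  have "(\<lambda>n. I + 1 / real (Suc n)) \<longlonglongrightarrow> I + 0"
    by (intro tendsto_intros LIMSEQ_Suc[OF lim_1_over_n])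
  then have "?J f \<le> I + 0"
    by (rule LIMSEQ_le[OF logistic_obj_kfun_tendsto[OF app]]) (use c(2) in \<open>auto intro: less_imp_le\<close>)
  then have "?J f \<le> ?J g" if "g \<in> rkhs k X" for g using I_le[OF that] by simp
  moreover have "f \<in> rkhs k X" using app by (auto simp: rkhs_def)
  ultimately show ?thesis by blast
qed

text \<open>The RKHS distance of the kernel sections at x and y. The value 0 off \<open>X\<close>
  suits functions that vanish there; it is meaningful only for two points on the same side of
  \<open>X\<close>.\<close>

definition kdist :: "'a \<Rightarrow> 'a \<Rightarrow> real" where
  "kdist x y = (if x \<in> X \<and> y \<in> X then sqrt (k x x - 2 * k x y + k y y) else 0)"

section \<open>Stability and continuity of the minimiser\<close>

context
  fixes lam :: real
  assumes lam: "0 < lam"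
begin

lemma fhat_rkhs: "fhat k X lam m S \<in> rkhs k X"
  and fhat_min: "g \<in> rkhs k X \<Longrightarrow>
    logistic_obj k X lam m S (fhat k X lam m S) \<le> logistic_obj k X lam m S g"
proof -
  have "fhat k X lam m S \<in> rkhs k X \<and>
    (\<forall>g\<in>rkhs k X. logistic_obj k X lam m S (fhat k X lam m S) \<le> logistic_obj k X lam m S g)"
    using someI_ex[OF logistic_min_exists[OF lam, of m S, unfolded Bex_def], folded fhat_def] .
  then show "fhat k X lam m S \<in> rkhs k X"
    "g \<in> rkhs k X \<Longrightarrow> logistic_obj k X lam m S (fhat k X lam m S) \<le> logistic_obj k X lam m S g"
    by auto
qed

text \<open>The midpoint of the minimiser and g cannot beat the minimiser, so the strong convexity
  term has to be covered by the excess of g.\<close>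

lemma fhat_gap:
  assumes "g \<in> rkhs k X"
  shows "lam / 4 * (rkhs_norm k X (\<lambda>x. fhat k X lam m S x - g x))\<^sup>2
    \<le> logistic_obj k X lam m S g - logistic_obj k X lam m S (fhat k X lam m S)"
proof -
  let ?f = "fhat k X lam m S"
  have arith: "lam / 4 * u \<le> b - a" if "a \<le> c" "c \<le> (a + b) / 2 - lam / 8 * u" for a b c u
    using that by (simp add: field_simps)
  show ?thesis
    by (rule arith[OF fhat_min[OF rkhs_midpoint[OF fhat_rkhs assms]] logistic_obj_midpoint[OF fhat_rkhs assms]])
qed

text \<open>Comparison with the zero function, whose objective is ln 2, or 0 in the case m = 0. The
  bound does not depend on the sample, which makes all estimators for one \<open>lam\<close>
  equicontinuous.\<close>

lemma fhat_norm: "rkhs_norm k X (fhat k X lam m S) \<le> sqrt (2 * ln 2 / lam)"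
proof -
  let ?f = "fhat k X lam m S"
  have "lam / 2 * (rkhs_norm k X ?f)\<^sup>2 \<le> logistic_obj k X lam m S ?f"
    unfolding logistic_obj_logloss by (auto intro!: divide_nonneg_nonneg sum_nonneg logloss_nonneg)
  also have "\<dots> \<le> logistic_obj k X lam m S (\<lambda>x. 0)" by (intro fhat_min zero_rkhs)
  also have "\<dots> \<le> ln 2" by (simp add: logistic_obj_logloss logloss_zero rkhs_norm_zero)
  finally have "(rkhs_norm k X ?f)\<^sup>2 \<le> 2 * ln 2 / lam" using lam by (simp add: field_simps)
  then show ?thesis by (rule real_le_rsqrt)
qed

text \<open>The sum of two instances of \<open>fhat_gap\<close>, each sample tested at the minimiser
  of the other. The penalties cancel, only loss differences survive, and lam / 4 doubles.\<close>

lemma fhat_perturb: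
  shows "lam / 2 * (rkhs_norm k X (\<lambda>x. fhat k X lam m S x - fhat k X lam m S' x))\<^sup>2
    \<le> (1 / real m) * (\<Sum>i<m.
        (logloss (snd (S i)) (fhat k X lam m S' (fst (S i))) - logloss (snd (S i)) (fhat k X lam m S (fst (S i))))
      + (logloss (snd (S' i)) (fhat k X lam m S (fst (S' i))) - logloss (snd (S' i)) (fhat k X lam m S' (fst (S' i)))))"
proof -
  let ?f = "fhat k X lam m S" and ?g = "fhat k X lam m S'"
  have "rkhs_norm k X (\<lambda>x. ?g x - ?f x) = rkhs_norm k X (\<lambda>x. ?f x - ?g x)"
    by (intro rkhs_norm_minus_commute fhat_rkhs)
  then show ?thesis
    using fhat_gap[OF fhat_rkhs, of m S m S'] fhat_gap[OF fhat_rkhs, of m S' m S]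
    unfolding logistic_obj_logloss by (simp add: sum.distrib sum_subtractf algebra_simps)
qed

text \<open>In \<open>fhat_perturb\<close> all summands but the i-th cancel. With d the RKHS
  distance of the minimisers this reads lam / 2 * d^2 \<le> 2 d K / m, so d \<le> 4 K / (lam m);
  evaluating at a point costs another factor K.\<close>

lemma fhat_stability:
  assumes K: "\<And>x. x \<in> X \<Longrightarrow> sqrt (k x x) \<le> K" "0 \<le> K" and i: "i < m"
  shows "\<bar>fhat k X lam m S x - fhat k X lam m (S(i := z)) x\<bar> \<le> 4 * K\<^sup>2 / (lam * real m)"
proof -
  let ?S' = "S(i := z)"
  let ?f = "fhat k X lam m S" and ?g = "fhat k X lam m ?S'"
  let ?d = "rkhs_norm k X (\<lambda>x. ?f x - ?g x)"
  have m: "0 < real m" using i by simp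
  have dr: "(\<lambda>x. ?f x - ?g x) \<in> rkhs k X" by (intro rkhs_diff fhat_rkhs)
  have d0: "0 \<le> ?d" by (intro rkhs_norm_nonneg dr)
  have ev: "\<bar>?f x - ?g x\<bar> \<le> ?d * K" for x
  proof (cases "x \<in> X")
    case True
    show ?thesis using rkhs_eval_bound[OF dr True] mult_left_mono[OF K(1)[OF True] d0] by linarith
  next
    case False
    then show ?thesis using rkhs_zero_outside[OF dr False] d0 K(2) by simp
  qed
  have L: "logloss b (?g x) - logloss b (?f x) \<le> ?d * K" "logloss b (?f x) - logloss b (?g x) \<le> ?d * K" for b x
    using logloss_lipschitz[of b "?g x" "?f x"] ev[of x] by linarith+
  have "lam / 2 * ?d\<^sup>2 \<le> (1 / real m) * (\<Sum>j<m. if j = i then 2 * (?d * K) else 0)"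
  proof (rule order_trans[OF fhat_perturb[of m S ?S'] mult_left_mono[OF sum_mono]])
    fix j
    show "(logloss (snd (S j)) (?g (fst (S j))) - logloss (snd (S j)) (?f (fst (S j))))
      + (logloss (snd (?S' j)) (?f (fst (?S' j))) - logloss (snd (?S' j)) (?g (fst (?S' j))))
      \<le> (if j = i then 2 * (?d * K) else 0)"
    proof (cases "j = i")
      case True
      then show ?thesis
        using add_mono[OF L(1)[of "snd (S j)" "fst (S j)"] L(2)[of "snd (?S' j)" "fst (?S' j)"]]
        by (simp only: True if_True mult_2)
    next
      case False
      then have "?S' j = S j" by simp
      then show ?thesis unfolding if_not_P[OF False] by simp
    qed
  qed simp
  also have "\<dots> = 2 * (?d * K) / real m" using i by simp
  finally have "?d * (?d * (lam * real m)) \<le> ?d * (4 * K)"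
    using m by (simp add: field_simps power2_eq_square)
  then have "?d * (lam * real m) \<le> 4 * K"
    using d0 K(2) by (cases "?d = 0") auto
  then have "?d \<le> 4 * K / (lam * real m)" using lam m by (simp add: field_simps)
  then have "?d * K \<le> 4 * K / (lam * real m) * K" using K(2) by (intro mult_right_mono)
  with ev[of x] show ?thesis by (simp add: power2_eq_square)
qed

text \<open>Outside \<open>X\<close> the estimator is 0 and it may jump at the boundary, so the two
  points must lie on the same side. The modulus is the same for all samples.\<close>

lemma fhat_modulus:
  assumes "x \<in> X \<longleftrightarrow> y \<in> X"
  shows "\<bar>fhat k X lam m S x - fhat k X lam m S y\<bar> \<le> sqrt (2 * ln 2 / lam) * kdist x y"
proof (cases "x \<in> X")
  case True
  with assms have y: "y \<in> X" by simp
  have nn: "0 \<le> k x x - 2 * k x y + k y y"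
  proof -
    let ?x = "\<lambda>z. of_bool (z = x) :: real" and ?y = "\<lambda>z. of_bool (z = y) :: real"
    have "knorm2 k (\<lambda>z. 1 * ?x z + (-1) * ?y z) = k x x - 2 * k x y + k y y"
      by (subst knorm2_linear[OF fin_coeffs_single[OF True] fin_coeffs_single[OF y]])
         (simp add: knorm2_kinner kinner_single kcomb_single)
    then show ?thesis
      using psd[OF fin_coeffs_add[OF fin_coeffs_single[OF True] fin_coeffs_single[OF y], of 1 "-1"]] by simp
  qed
  have "\<bar>fhat k X lam m S x - fhat k X lam m S y\<bar>
    \<le> rkhs_norm k X (fhat k X lam m S) * sqrt (k x x - 2 * k x y + k y y)"
    by (intro rkhs_diff_bound fhat_rkhs True y)
  also have "\<dots> \<le> sqrt (2 * ln 2 / lam) * sqrt (k x x - 2 * k x y + k y y)"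
    using nn by (intro mult_right_mono fhat_norm) auto
  finally show ?thesis using True y by (simp add: kdist_def)
next
  case False
  with assms show ?thesis using rkhs_zero_outside[OF fhat_rkhs] by (simp add: kdist_def)
qed

text \<open>Here the points move while the labels stay. Regrouping the four losses by function
  instead of by sample leaves differences of one estimator at two nearby points, which
  \<open>fhat_modulus\<close> bounds.\<close>

lemma fhat_sample_modulus:
  assumes "\<And>i. i < m \<Longrightarrow> fst (S i) \<in> X \<longleftrightarrow> fst (S' i) \<in> X"
    and "\<And>i. i < m \<Longrightarrow> snd (S i) = snd (S' i)"
  shows "lam / 2 * (rkhs_norm k X (\<lambda>x. fhat k X lam m S x - fhat k X lam m S' x))\<^sup>2
    \<le> (1 / real m) * (\<Sum>i<m. 2 * (sqrt (2 * ln 2 / lam) * kdist (fst (S i)) (fst (S' i))))"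
proof (rule order_trans[OF fhat_perturb[of m S S'] mult_left_mono[OF sum_mono]])
  fix i assume "i \<in> {..<m}"
  then have i: "fst (S i) \<in> X \<longleftrightarrow> fst (S' i) \<in> X" "snd (S i) = snd (S' i)" using assms by auto
  let ?f = "fhat k X lam m S" and ?g = "fhat k X lam m S'"
  have "logloss b (?g u) - logloss b (?f u) + (logloss b (?f v) - logloss b (?g v))
      \<le> \<bar>?g u - ?g v\<bar> + \<bar>?f u - ?f v\<bar>" for b u v
    using logloss_lipschitz[of b "?g u" "?g v"] logloss_lipschitz[of b "?f u" "?f v"] by linarith
  then have "logloss (snd (S i)) (?g (fst (S i))) - logloss (snd (S i)) (?f (fst (S i)))
      + (logloss (snd (S i)) (?f (fst (S' i))) - logloss (snd (S i)) (?g (fst (S' i))))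
      \<le> \<bar>?g (fst (S i)) - ?g (fst (S' i))\<bar> + \<bar>?f (fst (S i)) - ?f (fst (S' i))\<bar>" .
  also have "\<dots> \<le> sqrt (2 * ln 2 / lam) * kdist (fst (S i)) (fst (S' i))
      + sqrt (2 * ln 2 / lam) * kdist (fst (S i)) (fst (S' i))"
    by (intro add_mono fhat_modulus i(1))
  finally show "(logloss (snd (S i)) (?g (fst (S i))) - logloss (snd (S i)) (?f (fst (S i))))
      + (logloss (snd (S' i)) (?f (fst (S' i))) - logloss (snd (S' i)) (?g (fst (S' i))))
      \<le> 2 * (sqrt (2 * ln 2 / lam) * kdist (fst (S i)) (fst (S' i)))"
    by (simp only: i(2) mult_2)
qed simp

end

end

section \<open>Measurability of the estimator\<close>

locale compact_kernel = psd_kernel k X for k :: "'a::euclidean_space \<Rightarrow> 'a \<Rightarrow> real" and X +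
  assumes compact_X: "compact X"
    and continuous_k: "continuous_on (X \<times> X) (\<lambda>(x, y). k x y)"
begin

lemma k_tendsto:
  assumes "\<And>n. x n \<in> X" "\<And>n. y n \<in> X" "x \<longlonglongrightarrow> a" "y \<longlonglongrightarrow> b" "a \<in> X" "b \<in> X"
  shows "(\<lambda>n. k (x n) (y n)) \<longlonglongrightarrow> k a b"
proof -
  have "(\<lambda>n. (x n, y n)) \<longlonglongrightarrow> (a, b)" by (intro tendsto_Pair assms)
  from continuous_on_tendsto_compose[OF continuous_k this] show ?thesis
    using assms by simp
qed

lemma kdist_tendsto:
  assumes "\<And>n. x n \<in> X \<longleftrightarrow> a \<in> X" "x \<longlonglongrightarrow> a"
  shows "(\<lambda>n. kdist (x n) a) \<longlonglongrightarrow> 0"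
proof (cases "a \<in> X")
  case True
  have "(\<lambda>n. sqrt (k (x n) (x n) - 2 * k (x n) a + k a a)) \<longlonglongrightarrow> sqrt (k a a - 2 * k a a + k a a)"
    using assms True by (intro tendsto_intros k_tendsto) auto
  then show ?thesis using assms True by (simp add: kdist_def)
qed (simp add: kdist_def)

lemma kernel_bound: obtains K where "0 \<le> K" "\<And>x. x \<in> X \<Longrightarrow> sqrt (k x x) \<le> K"
proof -
  have "continuous_on X (\<lambda>x. k x x)"
    using k_tendsto by (auto simp: continuous_on_sequentially comp_def)
  then have "compact ((\<lambda>x. k x x) ` X)" by (rule compact_continuous_image[OF _ compact_X])
  then obtain B where "\<forall>x\<in>X. \<bar>k x x\<bar> \<le> B"
    by (auto dest!: compact_imp_bounded simp: bounded_iff)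
  then have "sqrt (k x x) \<le> sqrt \<bar>B\<bar>" if "x \<in> X" for x
    using that by (intro real_sqrt_le_mono) fastforce
  then show ?thesis by (intro that[of "sqrt \<bar>B\<bar>"]) auto
qed

lemma rkhs_continuous_on:
  assumes "f \<in> rkhs k X"
  shows "continuous_on X f"
  unfolding continuous_on_sequentially
proof safe
  fix x a assume x: "a \<in> X" "\<forall>n. x n \<in> X" "x \<longlonglongrightarrow> a"
  have "(\<lambda>n. rkhs_norm k X f * kdist (x n) a) \<longlonglongrightarrow> rkhs_norm k X f * 0"
    using x by (intro tendsto_intros kdist_tendsto) auto
  then have lim: "(\<lambda>n. rkhs_norm k X f * kdist (x n) a) \<longlonglongrightarrow> 0" by simp
  have "norm (f (x n) - f a) \<le> rkhs_norm k X f * kdist (x n) a" for n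
    using x rkhs_diff_bound[OF assms, of "x n" a] by (simp add: kdist_def)
  then have "(\<lambda>n. f (x n) - f a) \<longlonglongrightarrow> 0"
    by (rule Lim_null_comparison[OF always_eventually[OF allI] lim])
  then show "(f \<circ> x) \<longlonglongrightarrow> f a" unfolding comp_def by (rule LIM_zero_cancel)
qed

lemma X_borel [measurable]: "X \<in> sets borel"
  using compact_X by (simp add: borel_compact)

lemma rkhs_measurable:
  assumes "f \<in> rkhs k X"
  shows "f \<in> borel_measurable borel"
proof -
  have "(\<lambda>x. if x \<in> X then f x else 0) \<in> borel_measurable borel"
    by (rule borel_measurable_continuous_on_if) (use rkhs_continuous_on[OF assms] in auto)
  moreover have "(\<lambda>x. if x \<in> X then f x else 0) = f"
    using rkhs_zero_outside[OF assms] by auto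
  ultimately show ?thesis by simp
qed

context
  fixes lam :: real
  assumes lam: "0 < lam"
begin

text \<open>Joint continuity in sample points and evaluation point as long as memberships in
  \<open>X\<close> do not change. The error splits into moving the evaluation point, controlled by
  the common modulus, and changing the function at b, controlled by the RKHS distance.\<close>

lemma fhat_tendsto:
  assumes xs: "\<And>i n. i < m \<Longrightarrow> xs n i \<in> X \<longleftrightarrow> as i \<in> X" "\<And>i. i < m \<Longrightarrow> (\<lambda>n. xs n i) \<longlonglongrightarrow> as i"
    and y: "\<And>n. y n \<in> X \<longleftrightarrow> b \<in> X" "y \<longlonglongrightarrow> b"
  shows "(\<lambda>n. fhat k X lam m (\<lambda>i. (xs n i, L i)) (y n)) \<longlonglongrightarrow> fhat k X lam m (\<lambda>i. (as i, L i)) b"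
proof -
  define g where "g n = fhat k X lam m (\<lambda>i. (xs n i, L i))" for n
  define h where "h = fhat k X lam m (\<lambda>i. (as i, L i))"
  define d where "d n = rkhs_norm k X (\<lambda>x. g n x - h x)" for n
  have gr: "(\<lambda>x. g n x - h x) \<in> rkhs k X" for n
    unfolding g_def h_def by (intro rkhs_diff fhat_rkhs lam)
  have d0: "0 \<le> d n" for n unfolding d_def by (intro rkhs_norm_nonneg gr)
  let ?B = "sqrt (2 * ln 2 / lam)"
  let ?r = "\<lambda>n. (1 / real m) * (\<Sum>i<m. 2 * (?B * kdist (xs n i) (as i)))"
  have "?r \<longlonglongrightarrow> (1 / real m) * (\<Sum>i<m. 2 * (?B * 0))"
    using xs by (intro tendsto_intros kdist_tendsto) auto
  then have "(\<lambda>n. 2 / lam * ?r n) \<longlonglongrightarrow> 0"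
    using tendsto_mult[OF tendsto_const[of "2 / lam"]] by fastforce
  moreover have "(d n)\<^sup>2 \<le> 2 / lam * ?r n" for n
  proof -
    have "lam / 2 * (d n)\<^sup>2 \<le> ?r n"
      using fhat_sample_modulus[OF lam, of m "\<lambda>i. (xs n i, L i)" "\<lambda>i. (as i, L i)"] xs(1)
      unfolding d_def g_def h_def by simp
    then have "2 / lam * (lam / 2 * (d n)\<^sup>2) \<le> 2 / lam * ?r n"
      using lam by (intro mult_left_mono) auto
    then show ?thesis using lam by simp
  qed
  ultimately have "(\<lambda>n. (d n)\<^sup>2) \<longlonglongrightarrow> 0"
    by (intro tendsto_sandwich[of "\<lambda>_. 0" "\<lambda>n. (d n)\<^sup>2" _ "\<lambda>n. 2 / lam * ?r n"] always_eventually allI)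
      simp_all
  then have "(\<lambda>n. sqrt ((d n)\<^sup>2)) \<longlonglongrightarrow> sqrt 0" by (rule tendsto_real_sqrt)
  then have d: "d \<longlonglongrightarrow> 0" using d0 by simp
  have "(\<lambda>n. ?B * kdist (y n) b + d n * sqrt \<bar>k b b\<bar>) \<longlonglongrightarrow> 0"
    using tendsto_add[OF tendsto_mult[OF tendsto_const[of ?B] kdist_tendsto[OF y]]
      tendsto_mult[OF d tendsto_const[of "sqrt \<bar>k b b\<bar>"]]] by simp
  then have "(\<lambda>n. g n (y n) - h b) \<longlonglongrightarrow> 0"
  proof (rule Lim_null_comparison[rotated], intro always_eventually allI)
    fix n
    have "\<bar>g n (y n) - g n b\<bar> \<le> ?B * kdist (y n) b"
      unfolding g_def by (rule fhat_modulus[OF lam y(1)])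
    moreover have "\<bar>g n b - h b\<bar> \<le> d n * sqrt \<bar>k b b\<bar>"
    proof (cases "b \<in> X")
      case True
      have "\<bar>g n b - h b\<bar> \<le> d n * sqrt (k b b)"
        using rkhs_eval_bound[OF gr True] by (simp add: d_def)
      also have "\<dots> \<le> d n * sqrt \<bar>k b b\<bar>" using d0 by (intro mult_left_mono) auto
      finally show ?thesis .
    next
      case False
      then show ?thesis using rkhs_zero_outside[OF gr False] d0 by simp
    qed
    ultimately show "norm (g n (y n) - h b) \<le> ?B * kdist (y n) b + d n * sqrt \<bar>k b b\<bar>"
      by simp
  qed
  then show ?thesis unfolding g_def h_def by (rule LIM_zero_cancel)
qed

text \<open>With the labels frozen the argument lives in a topological product. The sets
  \<open>E I b\<close> record which points lie in \<open>X\<close>; they are finitely many Borel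
  sets, and the estimator is continuous on each.\<close>

lemma fhat_measurable_points:
  "(\<lambda>p. fhat k X lam m (\<lambda>i. (fst p i, L i)) (snd p)) \<in> borel_measurable borel"
proof -
  have [measurable]: "(\<lambda>p::(nat \<Rightarrow> 'a) \<times> 'a. fst p i) \<in> borel_measurable borel" for i
    by (rule borel_measurable_continuous_onI)
      (rule continuous_on_product_then_coordinatewise[OF continuous_on_fst[OF continuous_on_id]])
  have [measurable]: "(\<lambda>p::(nat \<Rightarrow> 'a) \<times> 'a. snd p) \<in> borel_measurable borel"
    by (rule borel_measurable_continuous_onI) (rule continuous_on_snd[OF continuous_on_id])
  define E where "E I b = {p :: (nat \<Rightarrow> 'a) \<times> 'a. (\<forall>i\<in>{..<m}. fst p i \<in> X \<longleftrightarrow> i \<in> I) \<and> (snd p \<in> X \<longleftrightarrow> b)}"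
    for I b
  have E_sets: "E I b \<in> sets borel" for I b
  proof -
    have "{p \<in> space borel. (\<forall>i\<in>{..<m}. fst p i \<in> X \<longleftrightarrow> i \<in> I) \<and> (snd p \<in> X \<longleftrightarrow> b)} \<in> sets borel"
      by measurable
    then show ?thesis by (simp add: E_def)
  qed
  show ?thesis
  proof (rule measurable_piecewise_restrict[where C = "(\<lambda>(I, b). E I b) ` (Pow {..<m} \<times> UNIV)"])
    show "countable ((\<lambda>(I, b). E I b) ` (Pow {..<m} \<times> UNIV))"
      by (intro countable_image countable_finite) auto
    show "\<Omega> \<inter> space borel \<in> sets borel" if "\<Omega> \<in> (\<lambda>(I, b). E I b) ` (Pow {..<m} \<times> UNIV)" for \<Omega>
      using that E_sets by auto
    have "p \<in> E {i. i < m \<and> fst p i \<in> X} (snd p \<in> X)" for p by (auto simp: E_def)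
    then show "space borel \<subseteq> \<Union>((\<lambda>(I, b). E I b) ` (Pow {..<m} \<times> UNIV))"
      by force
    fix \<Omega> assume "\<Omega> \<in> (\<lambda>(I, b). E I b) ` (Pow {..<m} \<times> UNIV)"
    then obtain I b where \<Omega>: "\<Omega> = E I b" by auto
    show "(\<lambda>p. fhat k X lam m (\<lambda>i. (fst p i, L i)) (snd p)) \<in> borel_measurable (restrict_space borel \<Omega>)"
      unfolding \<Omega>
    proof (rule borel_measurable_continuous_on_restrict, unfold continuous_on_sequentially, safe)
      fix u a assume a: "a \<in> E I b" "\<forall>n. u n \<in> E I b" "u \<longlonglongrightarrow> a"
      have "(\<lambda>n. fst (u n)) \<longlonglongrightarrow> fst a" "(\<lambda>n. snd (u n)) \<longlonglongrightarrow> snd a"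
        using a(3) by (intro tendsto_fst tendsto_snd; assumption)+
      moreover have "(\<lambda>n. fst (u n) i) \<longlonglongrightarrow> fst a i" for i
        using continuous_on_tendsto_compose[OF continuous_on_product_coordinates[of i] \<open>(\<lambda>n. fst (u n)) \<longlonglongrightarrow> fst a\<close>]
        by simp
      ultimately show "((\<lambda>p. fhat k X lam m (\<lambda>i. (fst p i, L i)) (snd p)) \<circ> u)
          \<longlonglongrightarrow> fhat k X lam m (\<lambda>i. (fst a i, L i)) (snd a)"
        unfolding comp_def using a(1,2) by (intro fhat_tendsto) (auto simp: E_def)
    qed
  qed
qed

text \<open>The finitely many label patterns \<open>F L\<close> cut the sample space into measurable
  pieces. On each piece the labels are constant and the case of frozen labels applies.\<close>

lemma fhat_measurable:
  assumes N: "sets N = sets (borel \<Otimes>\<^sub>M count_space UNIV)"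
  shows "(\<lambda>p. fhat k X lam m (fst p) (snd p)) \<in> borel_measurable (PiM {..<m} (\<lambda>_. N) \<Otimes>\<^sub>M borel)"
proof -
  let ?M = "PiM {..<m} (\<lambda>_. N) \<Otimes>\<^sub>M (borel :: 'a measure)"
  have comp: "(\<lambda>p. fst p i) \<in> measurable ?M (borel \<Otimes>\<^sub>M count_space UNIV)" if "i < m" for i
  proof -
    have "(\<lambda>p. fst p i) \<in> measurable ?M N" 
      using that by (intro measurable_compose[OF measurable_fst] measurable_component_singleton) simp
    then show ?thesis by (simp cong: measurable_cong_sets[OF refl N])
  qed
  have fs: "(\<lambda>p. fst (fst p i)) \<in> borel_measurable ?M" if "i < m" for i
    using measurable_comp[OF comp[OF that] measurable_fst] by (simp add: comp_def)
  have sn: "(\<lambda>p. snd (fst p i)) \<in> measurable ?M (count_space UNIV)" if "i < m" for i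
    using measurable_comp[OF comp[OF that] measurable_snd] by (simp add: comp_def)
  define F where "F L = {p :: (nat \<Rightarrow> 'a \<times> bool) \<times> 'a. \<forall>i\<in>{..<m}. snd (fst p i) \<longleftrightarrow> i \<in> L}" for L
  have F_sets: "F L \<inter> space ?M \<in> sets ?M" for L
  proof -
    have "{p \<in> space ?M. \<forall>i\<in>{..<m}. snd (fst p i) \<longleftrightarrow> i \<in> L} \<in> sets ?M"
    proof (rule sets.sets_Collect_finite_All)
      fix i assume "i \<in> {..<m}"
      then have "(\<lambda>p. snd (fst p i)) \<in> measurable ?M (count_space UNIV)" using sn by simp
      then have "(\<lambda>p. snd (fst p i)) -` {i \<in> L} \<inter> space ?M \<in> sets ?M"
        by (rule measurable_sets) simp
      moreover have "(\<lambda>p. snd (fst p i)) -` {i \<in> L} \<inter> space ?M = {p \<in> space ?M. snd (fst p i) \<longleftrightarrow> i \<in> L}"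
        by auto
      ultimately show "{p \<in> space ?M. snd (fst p i) \<longleftrightarrow> i \<in> L} \<in> sets ?M" by simp
    qed simp
    moreover have "{p \<in> space ?M. \<forall>i\<in>{..<m}. snd (fst p i) \<longleftrightarrow> i \<in> L} = F L \<inter> space ?M"
      by (auto simp: F_def)
    ultimately show ?thesis by simp
  qed
  show ?thesis
  proof (rule measurable_piecewise_restrict[where C = "F ` Pow {..<m}"])
    show "countable (F ` Pow {..<m})"
      by (intro countable_image countable_finite) auto
    show "\<Omega> \<inter> space ?M \<in> sets ?M" if "\<Omega> \<in> F ` Pow {..<m}" for \<Omega>
      using that F_sets by auto
    have "p \<in> F {i. i < m \<and> snd (fst p i)}" for p by (auto simp: F_def)
    then show "space ?M \<subseteq> \<Union>(F ` Pow {..<m})" by force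
    fix \<Omega> assume "\<Omega> \<in> F ` Pow {..<m}"
    then obtain L where \<Omega>: "\<Omega> = F L" by auto
    \<comment> \<open>Coordinates from m on are set to 0 so that every coordinate map is measurable;
      \<open>fhat_cong\<close> shows that the estimator ignores them.\<close>
    let ?p = "\<lambda>p. (\<lambda>i. if i < m then fst (fst p i) else 0, snd p)"
    have "(\<lambda>p i. if i < m then fst (fst p i) else 0) \<in> borel_measurable ?M"
    proof (rule measurable_coordinatewise_then_product)
      show "(\<lambda>p. if i < m then fst (fst p i) else 0) \<in> borel_measurable ?M" for i
        using fs[of i] by (cases "i < m") auto
    qed
    then have "?p \<in> borel_measurable ?M"
      by (rule borel_measurable_Pair[OF _ measurable_snd])
    from measurable_restrict_space1[OF
      measurable_compose[OF this fhat_measurable_points[of m "\<lambda>i. i \<in> L"]], of \<Omega>]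
    show "(\<lambda>p. fhat k X lam m (fst p) (snd p)) \<in> borel_measurable (restrict_space ?M \<Omega>)"
    proof (rule iffD1[OF measurable_cong, rotated])
      fix p assume p: "p \<in> space (restrict_space ?M \<Omega>)"
      have "fhat k X lam m (\<lambda>i. (fst (?p p) i, i \<in> L)) = fhat k X lam m (fst p)"
      proof (rule fhat_cong)
        fix i assume "i < m"
        moreover have "p \<in> F L" using p unfolding \<Omega> space_restrict_space by blast
        ultimately have "snd (fst p i) \<longleftrightarrow> i \<in> L" unfolding F_def by blast
        with \<open>i < m\<close> show "(fst (?p p) i, i \<in> L) = fst p i"
          by (intro prod_eqI) simp_all
      qed
      then show "fhat k X lam m (\<lambda>i. (fst (?p p) i, i \<in> L)) (snd (?p p)) = fhat k X lam m (fst p) (snd p)"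
        by (simp only: snd_conv)
    qed
  qed
qed

end

end

section \<open>Expected risk of the estimator\<close>

lemma logloss_measurable [measurable]:
  "(\<lambda>p. logloss (fst p) (snd p)) \<in> borel_measurable (count_space UNIV \<Otimes>\<^sub>M borel)"
  unfolding logloss_def by measurable

context compact_kernel
begin

lemma logloss_fhat_measurable:
  assumes lam: "0 < lam" and N: "sets N = sets (borel \<Otimes>\<^sub>M count_space UNIV)"
  shows "(\<lambda>p. logloss (snd (snd p)) (fhat k X lam m (fst p) (fst (snd p))))
    \<in> borel_measurable (PiM {..<m} (\<lambda>_. N) \<Otimes>\<^sub>M N)"
proof -
  let ?M = "PiM {..<m} (\<lambda>_. N) \<Otimes>\<^sub>M N"
  have sN: "(\<lambda>p. snd p) \<in> measurable ?M (borel \<Otimes>\<^sub>M count_space UNIV)"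
    using measurable_snd[of "PiM {..<m} (\<lambda>_. N)" N] by (simp cong: measurable_cong_sets[OF refl N])
  have f: "(\<lambda>p. fst (snd p)) \<in> borel_measurable ?M" and s: "(\<lambda>p. snd (snd p)) \<in> measurable ?M (count_space UNIV)"
    using measurable_compose[OF sN measurable_fst] measurable_compose[OF sN measurable_snd] by auto
  have "(\<lambda>p. (fst p, fst (snd p))) \<in> measurable ?M (PiM {..<m} (\<lambda>_. N) \<Otimes>\<^sub>M borel)"
    by (rule measurable_Pair[OF measurable_fst f])
  from measurable_compose[OF this fhat_measurable[OF lam N, of m]]
  have "(\<lambda>p. fhat k X lam m (fst p) (fst (snd p))) \<in> borel_measurable ?M" by simp
  from measurable_compose[OF measurable_Pair[OF s this] logloss_measurable] show ?thesis by simp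
qed

text \<open>The i-th sample point and the fresh point are exchangeable, and stability bounds the cost of
  swapping them.\<close>

lemma fhat_resample:
  assumes "prob_space P" and sP: "sets P = sets (borel \<Otimes>\<^sub>M count_space UNIV)"
    and lam: "0 < lam" and i: "i < m" and K: "0 \<le> K" "\<And>x. x \<in> X \<Longrightarrow> sqrt (k x x) \<le> K"
  shows "(\<integral>\<^sup>+S. \<integral>\<^sup>+z. logloss (snd z) (fhat k X lam m S (fst z)) \<partial>P \<partial>PiM {..<m} (\<lambda>_. P))
    \<le> (\<integral>\<^sup>+S. logloss (snd (S i)) (fhat k X lam m S (fst (S i))) \<partial>PiM {..<m} (\<lambda>_. P))
      + ennreal (4 * K\<^sup>2 / (lam * real m))"
proof -
  interpret P: prob_space P by fact
  interpret product_sigma_finite "\<lambda>_::nat. P" by standard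
  \<comment> \<open>Coordinate i is split off, so that a sample becomes \<open>x(i := y)\<close>
    with y independent of x.\<close>
  define J where "J = {..<m} - {i}"
  have J: "finite J" "i \<notin> J" "insert i J = {..<m}" using i by (auto simp: J_def)
  interpret PJ: prob_space "PiM J (\<lambda>_. P)" by (intro prob_space_PiM P.prob_space_axioms)
  let ?h = "\<lambda>S z. ennreal (logloss (snd z) (fhat k X lam m S (fst z)))"
  let ?c = "4 * K\<^sup>2 / (lam * real m)"
  have c0: "0 \<le> ?c" using lam by simp
  have h [measurable]: "(\<lambda>p. ?h (fst p) (snd p)) \<in> borel_measurable (PiM {..<m} (\<lambda>_. P) \<Otimes>\<^sub>M P)"
    using logloss_fhat_measurable[OF lam sP, of m] by measurable
  have upd: "(\<lambda>p. (fst p)(i := snd p)) \<in> measurable (PiM J (\<lambda>_. P) \<Otimes>\<^sub>M P) (PiM {..<m} (\<lambda>_. P))"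
    using measurable_add_dim[of i J "\<lambda>_. P"] unfolding J(3) by (simp add: case_prod_unfold)
  have risk_m: "(\<lambda>S. \<integral>\<^sup>+z. ?h S z \<partial>P) \<in> borel_measurable (PiM {..<m} (\<lambda>_. P))"
    using P.borel_measurable_nn_integral_fst[OF h] by simp
  have comp_m: "(\<lambda>S. S i) \<in> measurable (PiM {..<m} (\<lambda>_. P)) P"
    using i by (intro measurable_component_singleton) simp
  have emp_m: "(\<lambda>S. ?h S (S i)) \<in> borel_measurable (PiM {..<m} (\<lambda>_. P))"
    using measurable_compose[OF measurable_Pair[OF measurable_ident comp_m] h] by simp
  have g_m: "(\<lambda>p. ?h ((fst p)(i := snd p)) (snd p)) \<in> borel_measurable (PiM J (\<lambda>_. P) \<Otimes>\<^sub>M P)"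
    using measurable_compose[OF measurable_Pair[OF upd measurable_snd] h] by simp
  have g1_m: "(\<lambda>z. ?h (x(i := z)) z) \<in> borel_measurable P" if "x \<in> space (PiM J (\<lambda>_. P))" for x
    using measurable_compose[OF measurable_Pair1'[OF that] g_m] by simp
  have G_m: "(\<lambda>x. \<integral>\<^sup>+z. ?h (x(i := z)) z \<partial>P) \<in> borel_measurable (PiM J (\<lambda>_. P))"
    using P.borel_measurable_nn_integral_fst[OF g_m] by simp
  have swap: "?h (x(i := y)) z \<le> ?h (x(i := z)) z + ennreal ?c" for x y z
  proof -
    have "\<bar>fhat k X lam m (x(i := y)) (fst z) - fhat k X lam m ((x(i := y))(i := z)) (fst z)\<bar> \<le> ?c"
      by (rule fhat_stability[OF lam K(2,1) i])
    then have "logloss (snd z) (fhat k X lam m (x(i := y)) (fst z))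
        \<le> logloss (snd z) (fhat k X lam m (x(i := z)) (fst z)) + ?c"
      using logloss_lipschitz[of "snd z" "fhat k X lam m (x(i := y)) (fst z)" "fhat k X lam m (x(i := z)) (fst z)"]
      by simp
    then show ?thesis
      using c0 by (simp add: logloss_nonneg ennreal_leI flip: ennreal_plus)
  qed
  have "(\<integral>\<^sup>+S. \<integral>\<^sup>+z. ?h S z \<partial>P \<partial>PiM {..<m} (\<lambda>_. P))
      = (\<integral>\<^sup>+x. \<integral>\<^sup>+y. \<integral>\<^sup>+z. ?h (x(i := y)) z \<partial>P \<partial>P \<partial>PiM J (\<lambda>_. P))"
    using product_nn_integral_insert[OF J(1,2), of "\<lambda>S. \<integral>\<^sup>+z. ?h S z \<partial>P"] risk_m unfolding J(3) by simp
  \<comment> \<open>Swapping y for the fresh point z removes y from the integrand, so y integrates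
    out. What remains is the loss of a sample at its own i-th point.\<close>
  also have "\<dots> \<le> (\<integral>\<^sup>+x. (\<integral>\<^sup>+z. ?h (x(i := z)) z \<partial>P) + ennreal ?c \<partial>PiM J (\<lambda>_. P))"
  proof (rule nn_integral_mono)
    fix x assume x: "x \<in> space (PiM J (\<lambda>_. P))"
    have "(\<integral>\<^sup>+z. ?h (x(i := y)) z \<partial>P) \<le> (\<integral>\<^sup>+z. ?h (x(i := z)) z \<partial>P) + ennreal ?c" for y
    proof -
      have "(\<integral>\<^sup>+z. ?h (x(i := y)) z \<partial>P) \<le> (\<integral>\<^sup>+z. ?h (x(i := z)) z + ennreal ?c \<partial>P)"
        by (intro nn_integral_mono swap)
      also have "\<dots> = (\<integral>\<^sup>+z. ?h (x(i := z)) z \<partial>P) + ennreal ?c"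
        using g1_m[OF x] by (subst nn_integral_add) (simp_all add: P.emeasure_space_1)
      finally show ?thesis .
    qed
    then have "(\<integral>\<^sup>+y. \<integral>\<^sup>+z. ?h (x(i := y)) z \<partial>P \<partial>P) \<le> (\<integral>\<^sup>+y. (\<integral>\<^sup>+z. ?h (x(i := z)) z \<partial>P) + ennreal ?c \<partial>P)"
      by (intro nn_integral_mono)
    then show "(\<integral>\<^sup>+y. \<integral>\<^sup>+z. ?h (x(i := y)) z \<partial>P \<partial>P) \<le> (\<integral>\<^sup>+z. ?h (x(i := z)) z \<partial>P) + ennreal ?c"
      by (simp add: P.emeasure_space_1)
  qed
  also have "\<dots> = (\<integral>\<^sup>+x. \<integral>\<^sup>+z. ?h (x(i := z)) z \<partial>P \<partial>PiM J (\<lambda>_. P)) + ennreal ?c"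
    using G_m by (subst nn_integral_add) (simp_all add: PJ.emeasure_space_1)
  also have "(\<integral>\<^sup>+x. \<integral>\<^sup>+z. ?h (x(i := z)) z \<partial>P \<partial>PiM J (\<lambda>_. P)) = (\<integral>\<^sup>+S. ?h S (S i) \<partial>PiM {..<m} (\<lambda>_. P))"
    using product_nn_integral_insert[OF J(1,2), of "\<lambda>S. ?h S (S i)"] emp_m unfolding J(3) by simp
  finally show ?thesis .
qed

text \<open>Averaging the resampling bound over i produces the expected empirical risk of the
  estimator. Minimality bounds it by that of f plus the penalty, and the expected empirical risk of
  a fixed f is its true risk.\<close>

lemma fhat_expected_risk:
  assumes "prob_space P" and sP: "sets P = sets (borel \<Otimes>\<^sub>M count_space UNIV)"
    and lam: "0 < lam" and m: "0 < m" and K: "0 \<le> K" "\<And>x. x \<in> X \<Longrightarrow> sqrt (k x x) \<le> K"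
    and f: "f \<in> rkhs k X"
  shows "(\<integral>\<^sup>+S. \<integral>\<^sup>+z. logloss (snd z) (fhat k X lam m S (fst z)) \<partial>P \<partial>PiM {..<m} (\<lambda>_. P))
    \<le> (\<integral>\<^sup>+z. logloss (snd z) (f (fst z)) \<partial>P)
      + ennreal (lam / 2 * (rkhs_norm k X f)\<^sup>2 + 4 * K\<^sup>2 / (lam * real m))"
proof -
  interpret P: prob_space P by fact
  let ?M = "PiM {..<m} (\<lambda>_. P)"
  interpret M: prob_space ?M by (intro prob_space_PiM P.prob_space_axioms)
  let ?R = "\<integral>\<^sup>+S. \<integral>\<^sup>+z. logloss (snd z) (fhat k X lam m S (fst z)) \<partial>P \<partial>?M"
  let ?c = "4 * K\<^sup>2 / (lam * real m)" and ?d = "lam / 2 * (rkhs_norm k X f)\<^sup>2"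
  let ?Rf = "\<integral>\<^sup>+z. logloss (snd z) (f (fst z)) \<partial>P"
  have c0: "0 \<le> ?c" and d0: "0 \<le> ?d" using lam by auto
  have h: "(\<lambda>p. logloss (snd (snd p)) (fhat k X lam m (fst p) (fst (snd p)))) \<in> borel_measurable (?M \<Otimes>\<^sub>M P)"
    by (rule logloss_fhat_measurable[OF lam sP])
  have comp_m: "(\<lambda>S. S i) \<in> measurable ?M P" if "i < m" for i
    using that by (intro measurable_component_singleton) simp
  have emp_m: "(\<lambda>S. logloss (snd (S i)) (fhat k X lam m S (fst (S i)))) \<in> borel_measurable ?M" if "i < m" for i
    using measurable_compose[OF measurable_Pair[OF measurable_ident comp_m[OF that]] h] by simp
  have f0_m: "(\<lambda>z. logloss (snd z) (f (fst z))) \<in> borel_measurable P"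
  proof -
    have "(\<lambda>z. (snd z, f (fst z))) \<in> measurable (borel \<Otimes>\<^sub>M count_space UNIV) (count_space UNIV \<Otimes>\<^sub>M borel)"
      by (rule measurable_Pair[OF measurable_snd measurable_compose[OF measurable_fst rkhs_measurable[OF f]]])
    from measurable_compose[OF this logloss_measurable] show ?thesis
      by (simp cong: measurable_cong_sets[OF sP refl])
  qed
  have f0_i: "(\<integral>\<^sup>+S. logloss (snd (S i)) (f (fst (S i))) \<partial>?M) = ?Rf" if "i < m" for i
  proof -
    have "(\<integral>\<^sup>+S. logloss (snd (S i)) (f (fst (S i))) \<partial>?M)
       = (\<integral>\<^sup>+z. logloss (snd z) (f (fst z)) \<partial>distr ?M P (\<lambda>S. S i))"
      using measurable_compose[OF f0_m measurable_ennreal]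
      by (subst nn_integral_distr[OF comp_m[OF that]]) (simp_all cong: measurable_cong_sets)
    also have "distr ?M P (\<lambda>S. S i) = P"
      using that by (intro distr_PiM_component P.prob_space_axioms) auto
    finally show ?thesis .
  qed
  \<comment> \<open>The penalty of the minimiser itself is nonnegative and is dropped.\<close>
  have obj: "(\<Sum>i<m. logloss (snd (S i)) (fhat k X lam m S (fst (S i))))
      \<le> (\<Sum>i<m. logloss (snd (S i)) (f (fst (S i)))) + real m * ?d" for S
  proof -
    let ?A = "\<Sum>i<m. logloss (snd (S i)) (fhat k X lam m S (fst (S i)))"
    let ?B = "\<Sum>i<m. logloss (snd (S i)) (f (fst (S i)))"
    have "(1 / real m) * ?A \<le> logistic_obj k X lam m S (fhat k X lam m S)"
      using lam by (simp add: logistic_obj_logloss)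
    also have "\<dots> \<le> logistic_obj k X lam m S f" by (rule fhat_min[OF lam f])
    finally have "(1 / real m) * ?A \<le> ?d + (1 / real m) * ?B" by (simp add: logistic_obj_logloss)
    then have "real m * ((1 / real m) * ?A) \<le> real m * (?d + (1 / real m) * ?B)"
      by (intro mult_left_mono) auto
    also have "real m * (?d + (1 / real m) * ?B) = ?B + real m * ?d"
      using m by (simp add: distrib_left)
    finally show ?thesis using m by simp
  qed
  \<comment> \<open>The risk is written as m equal terms, so that each can be resampled at its own
    index.\<close>
  have "ennreal (real m) * ?R = (\<Sum>i<m. ?R)" by (simp add: ennreal_of_nat_eq_real_of_nat)
  also have "\<dots> \<le> (\<Sum>i<m. (\<integral>\<^sup>+S. logloss (snd (S i)) (fhat k X lam m S (fst (S i))) \<partial>?M) + ennreal ?c)"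
    by (intro sum_mono fhat_resample[OF assms(1) sP lam _ K]) auto
  also have "\<dots> = (\<integral>\<^sup>+S. (\<Sum>i<m. logloss (snd (S i)) (fhat k X lam m S (fst (S i)))) \<partial>?M) + ennreal (real m) * ennreal ?c"
  proof -
    have "(\<Sum>i<m. \<integral>\<^sup>+S. logloss (snd (S i)) (fhat k X lam m S (fst (S i))) \<partial>?M)
        = (\<integral>\<^sup>+S. (\<Sum>i<m. ennreal (logloss (snd (S i)) (fhat k X lam m S (fst (S i))))) \<partial>?M)"
      using emp_m by (subst nn_integral_sum) auto
    then show ?thesis by (simp add: sum.distrib ennreal_of_nat_eq_real_of_nat logloss_nonneg)
  qed
  also have "\<dots> \<le> (\<integral>\<^sup>+S. (\<Sum>i<m. ennreal (logloss (snd (S i)) (f (fst (S i))))) + ennreal (real m * ?d) \<partial>?M)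
      + ennreal (real m) * ennreal ?c"
    using obj d0 by (intro add_right_mono nn_integral_mono)
      (simp add: logloss_nonneg sum_nonneg ennreal_leI flip: ennreal_plus)
  also have "(\<integral>\<^sup>+S. (\<Sum>i<m. ennreal (logloss (snd (S i)) (f (fst (S i))))) + ennreal (real m * ?d) \<partial>?M)
      = (\<Sum>i<m. \<integral>\<^sup>+S. logloss (snd (S i)) (f (fst (S i))) \<partial>?M) + ennreal (real m * ?d)"
  proof -
    have fi: "(\<lambda>S. ennreal (logloss (snd (S i)) (f (fst (S i))))) \<in> borel_measurable ?M" if "i < m" for i
      using measurable_compose[OF comp_m[OF that] f0_m] by simp
    have "(\<integral>\<^sup>+S. (\<Sum>i<m. ennreal (logloss (snd (S i)) (f (fst (S i))))) \<partial>?M)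
        = (\<Sum>i<m. \<integral>\<^sup>+S. logloss (snd (S i)) (f (fst (S i))) \<partial>?M)"
      using fi by (intro nn_integral_sum) simp
    moreover have "(\<lambda>S. \<Sum>i<m. ennreal (logloss (snd (S i)) (f (fst (S i))))) \<in> borel_measurable ?M"
      using fi by (intro borel_measurable_sum) simp
    ultimately show ?thesis
      by (subst nn_integral_add) (simp_all add: M.emeasure_space_1)
  qed
  also have "(\<Sum>i<m. \<integral>\<^sup>+S. logloss (snd (S i)) (f (fst (S i))) \<partial>?M) = ennreal (real m) * ?Rf"
    using f0_i by (simp add: ennreal_of_nat_eq_real_of_nat)
  also have "ennreal (real m * ?d) = ennreal (real m) * ennreal ?d"
    by (rule ennreal_mult) (use d0 in auto)
  finally have "ennreal (real m) * ?R \<le> ennreal (real m) * (?Rf + ennreal (?d + ?c))"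
    by (simp only: ennreal_plus[OF d0 c0] distrib_left add.assoc)
  then show ?thesis
    using m by (subst (asm) ennreal_mult_le_mult_iff) auto
qed

end

section \<open>Excess logistic risk\<close>

definition cond_risk :: "real \<Rightarrow> real \<Rightarrow> real" where
  "cond_risk e u = ln (1 + exp u) - e * u"

text \<open>The infimum over u of \<open>cond_risk e u\<close>, that is, the Bayes risk of the
  logistic loss. It is not attained at e = 0 and e = 1, where the value is 0.\<close>

definition binary_entropy :: "real \<Rightarrow> real" where
  "binary_entropy e = - (e * ln e + (1 - e) * ln (1 - e))"

lemma cond_risk_logloss: "cond_risk e u = e * logloss True u + (1 - e) * logloss False u"
  by (simp add: cond_risk_def logloss_eq algebra_simps)

lemma cond_risk_lipschitz:
  assumes "0 \<le> e" "e \<le> 1"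
  shows "\<bar>cond_risk e u - cond_risk e v\<bar> \<le> \<bar>u - v\<bar>"
proof -
  have "cond_risk e u - cond_risk e v
      = e * (logloss True u - logloss True v) + (1 - e) * (logloss False u - logloss False v)"
    by (simp add: cond_risk_logloss algebra_simps)
  also have "\<bar>\<dots>\<bar> \<le> \<bar>e * (logloss True u - logloss True v)\<bar> + \<bar>(1 - e) * (logloss False u - logloss False v)\<bar>"
    by (rule abs_triangle_ineq)
  also have "\<dots> \<le> e * \<bar>u - v\<bar> + (1 - e) * \<bar>u - v\<bar>"
    unfolding abs_mult using assms by (intro add_mono mult_mono logloss_lipschitz) auto
  finally show ?thesis by (simp add: algebra_simps)
qed

lemma cond_risk_nonneg: "0 \<le> e \<Longrightarrow> e \<le> 1 \<Longrightarrow> 0 \<le> cond_risk e u"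
  unfolding cond_risk_logloss by (intro add_nonneg_nonneg mult_nonneg_nonneg logloss_nonneg) auto

lemma cond_risk_zero: "cond_risk e 0 = ln 2"
  by (simp add: cond_risk_def)

text \<open>The inequality ln y \<le> y - 1 at y = sqrt p / sqrt a. Summed over both labels it
  bounds a Kullback-Leibler divergence below by a squared Hellinger distance.\<close>

lemma mult_ln_diff_ge:
  fixes a p :: real
  assumes "0 \<le> a" "0 < p"
  shows "2 * (a - sqrt p * sqrt a) \<le> a * ln a - a * ln p"
proof (cases "a = 0")
  case False
  with assms have a: "0 < a" by simp
  have "ln (sqrt p / sqrt a) \<le> sqrt p / sqrt a - 1"
    using a assms by (intro ln_le_minus_one) auto
  moreover have "ln (sqrt p / sqrt a) = (ln p - ln a) / 2"
    using a assms by (simp add: ln_div ln_sqrt diff_divide_distrib)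
  ultimately have "(ln p - ln a) / 2 \<le> sqrt p / sqrt a - 1" by (simp only:)
  then have "ln p - ln a \<le> 2 * (sqrt p / sqrt a - 1)" by (simp only: pos_divide_le_eq zero_less_numeral mult.commute)
  then have "a * (ln p - ln a) \<le> a * (2 * (sqrt p / sqrt a - 1))"
    using a by (intro mult_left_mono) auto
  moreover have "a * (sqrt p / sqrt a) = sqrt p * sqrt a"
    using a real_sqrt_mult_self[of a] by (simp add: field_simps)
  moreover have "a * (2 * (x - 1)) = 2 * (a * x) - 2 * a" for x by (simp add: algebra_simps)
  ultimately show ?thesis by (simp only: right_diff_distrib)
qed simp

text \<open>The excess conditional risk is a Kullback--Leibler divergence, which dominates the squared
  Hellinger distance.\<close>

lemma cond_risk_ge:
  assumes e: "0 \<le> e" "e \<le> 1"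
  shows "binary_entropy e + (1 / (1 + exp (- u)) - e)\<^sup>2 / 4 \<le> cond_risk e u"
proof -
  define p where "p = 1 / (1 + exp (- u))"
  have p: "0 < p" "p < 1" unfolding p_def by (auto simp: add_pos_pos)
  have q: "1 - p = 1 / (1 + exp u)"
    unfolding p_def using one_plus_exp_pos[of u] one_plus_exp_pos[of "- u"]
    by (simp add: field_simps exp_minus)
  have lp: "ln p = - logloss True u" and lq: "ln (1 - p) = - logloss False u"
    unfolding q unfolding p_def using one_plus_exp_pos[of u] one_plus_exp_pos[of "- u"]
    by (simp_all add: logloss_def ln_div)
  let ?s = "sqrt p" and ?t = "sqrt e" and ?s' = "sqrt (1 - p)" and ?t' = "sqrt (1 - e)"
  have sq: "?s\<^sup>2 = p" "?t\<^sup>2 = e" "?s'\<^sup>2 = 1 - p" "?t'\<^sup>2 = 1 - e" using p e by auto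
  have "2 * (e - ?s * ?t) + 2 * ((1 - e) - ?s' * ?t')
     \<le> (e * ln e - e * ln p) + ((1 - e) * ln (1 - e) - (1 - e) * ln (1 - p))"
    using e p by (intro add_mono mult_ln_diff_ge) auto
  also have "\<dots> = cond_risk e u - binary_entropy e"
    by (simp add: cond_risk_logloss binary_entropy_def lp lq)
  also have "2 * (e - ?s * ?t) + 2 * ((1 - e) - ?s' * ?t') = (?s - ?t)\<^sup>2 + (?s' - ?t')\<^sup>2"
    unfolding power2_diff sq by simp
  finally have "(?s - ?t)\<^sup>2 \<le> cond_risk e u - binary_entropy e"
    using zero_le_power2[of "?s' - ?t'"] by linarith
  \<comment> \<open>p - e is the difference of the roots times their sum, and the sum is at most 2;
    its square gives the factor 1/4.\<close>
  moreover have "(p - e)\<^sup>2 / 4 \<le> (?s - ?t)\<^sup>2"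
  proof -
    have "?s\<^sup>2 - ?t\<^sup>2 = (?s - ?t) * (?s + ?t)" by (simp add: power2_eq_square algebra_simps)
    then have "p - e = (?s - ?t) * (?s + ?t)" by (simp only: sq)
    then have "(p - e)\<^sup>2 = (?s - ?t)\<^sup>2 * (?s + ?t)\<^sup>2" by (simp add: power_mult_distrib)
    also have "\<dots> \<le> (?s - ?t)\<^sup>2 * 2\<^sup>2"
    proof (intro mult_left_mono power_mono)
      have "?s \<le> 1" "?t \<le> 1" using p e by auto
      then show "?s + ?t \<le> 2" by linarith
    qed (use p e in auto)
    finally show ?thesis by simp
  qed
  ultimately show ?thesis unfolding p_def by linarith
qed

text \<open>The score is the logit of q, so the risk is the cross entropy of e against q. As q and 1
  - q are at least 1 - 2 t times e and 1 - e, it exceeds the entropy by at most -ln (1 - 2 t),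
  uniformly in e.\<close>

lemma cond_risk_smoothed_logit_le:
  assumes e: "0 \<le> e" "e \<le> 1" and t: "0 < t" "t < 1 / 2" and q: "q = t + (1 - 2 * t) * e"
  shows "cond_risk e (ln (q / (1 - q))) \<le> binary_entropy e - ln (1 - 2 * t)"
proof -
  have q1: "(1 - 2 * t) * e \<le> q" "(1 - 2 * t) * (1 - e) \<le> 1 - q" using t q by (auto simp: algebra_simps)
  have te: "0 \<le> (1 - 2 * t) * e" "0 \<le> (1 - 2 * t) * (1 - e)" using t e by auto
  have qp: "0 < q" using q t te(1) by linarith
  have "1 - q = t + (1 - 2 * t) * (1 - e)" by (simp add: q algebra_simps)
  with te(2) t have qq: "0 < 1 - q" by linarith
  have *: "- (a * ln r) \<le> - (a * ln a) - a * ln (1 - 2 * t)" if "0 \<le> a" "(1 - 2 * t) * a \<le> r" "0 < r" for a r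
  proof (cases "a = 0")
    case False
    with that have a: "0 < a" by simp
    have "ln ((1 - 2 * t) * a) \<le> ln r" using that a t by (intro ln_mono) auto
    then have "a * (ln (1 - 2 * t) + ln a) \<le> a * ln r"
      using a t by (intro mult_left_mono) (auto simp: ln_mult)
    then show ?thesis by (simp add: algebra_simps)
  qed simp
  have "1 + q / (1 - q) = 1 / (1 - q)" using qq by (simp add: field_simps)
  then have "cond_risk e (ln (q / (1 - q))) = ln (1 / (1 - q)) - e * ln (q / (1 - q))"
    using qp qq by (simp add: cond_risk_def)
  also have "\<dots> = - (e * ln q) + - ((1 - e) * ln (1 - q))"
    using qp qq by (simp add: ln_div algebra_simps)
  also have "\<dots> \<le> (- (e * ln e) - e * ln (1 - 2 * t)) + (- ((1 - e) * ln (1 - e)) - (1 - e) * ln (1 - 2 * t))"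
    using e q1 qp qq by (intro add_mono *) auto
  also have "\<dots> = binary_entropy e - ln (1 - 2 * t)"
    by (simp add: binary_entropy_def algebra_simps)
  finally show ?thesis .
qed

lemma binary_entropy_nonneg:
  assumes "0 \<le> e" "e \<le> 1"
  shows "0 \<le> binary_entropy e"
proof -
  have "a * ln a \<le> 0" if "0 \<le> a" "a \<le> 1" for a :: real
    using that by (cases "a = 0") (auto intro: mult_nonneg_nonpos)
  from this[of e] this[of "1 - e"] assms show ?thesis by (simp add: binary_entropy_def)
qed

lemma binary_entropy_le: "0 \<le> e \<Longrightarrow> e \<le> 1 \<Longrightarrow> binary_entropy e \<le> ln 2"
  using cond_risk_ge[of e 0] zero_le_power2[of "1 / (1 + exp (- 0)) - e"]
  unfolding cond_risk_zero by linarith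

section \<open>Density of continuous functions in L1\<close>

text \<open>Regularity of finite Borel measures puts A between a compact K and an open U of nearly
  equal measure. A Urysohn function that is 1 on K and 0 off U differs from the indicator only on U
  - K, and there by at most 1.\<close>

lemma indicator_L1_continuous:
  fixes M :: "'a::euclidean_space measure"
  assumes "finite_measure M" and sM: "sets M = sets borel" and A: "A \<in> sets borel" and e: "0 < e"
  obtains g :: "'a \<Rightarrow> real" where "continuous_on UNIV g" "integrable M g"
    "(\<integral>x. \<bar>indicator A x - g x\<bar> \<partial>M) < e"
proof -
  interpret finite_measure M by fact
  have spM: "space M = UNIV" using sets_eq_imp_space_eq[OF sM] by simp
  have fin: "emeasure M (space M) \<noteq> \<infinity>" by simp
  obtain K where K: "K \<subseteq> A" "compact K" "measure M A - e / 2 < measure M K"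
  proof (cases "measure M A < e / 2")
    \<comment> \<open>Here the level \<open>measure M A - e / 2\<close> is negative and would be
      truncated as an extended nonnegative real; the empty set works.\<close>
    case True
    then show ?thesis by (intro that[of "{}"]) auto
  next
    case False
    then have "ennreal (measure M A - e / 2) < emeasure M A"
      using e by (simp add: emeasure_eq_measure ennreal_less_iff)
    then obtain K where "K \<subseteq> A" "compact K" "ennreal (measure M A - e / 2) < emeasure M K"
      unfolding inner_regular[OF sM fin A] less_SUP_iff by blast
    with False show ?thesis
      by (intro that[of K]) (auto simp: emeasure_eq_measure ennreal_less_iff)
  qed
  have "emeasure M A < ennreal (measure M A + e / 2)"
    using e by (simp add: emeasure_eq_measure ennreal_less_iff)
  then obtain U where U: "A \<subseteq> U" "open U" "measure M U < measure M A + e / 2"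
    unfolding outer_regular[OF sM fin A] INF_less_iff
    by (auto simp: emeasure_eq_measure ennreal_less_iff)
  have "closed K" "closed (- U)" "K \<inter> - U = {}" using K U by (auto intro: compact_imp_closed)
  then obtain g :: "'a \<Rightarrow> real" where g: "continuous_on UNIV g" "\<And>x. g x \<in> closed_segment 1 0"
    "\<And>x. x \<in> K \<Longrightarrow> g x = 1" "\<And>x. x \<in> - U \<Longrightarrow> g x = 0"
    by (rule Urysohn[where a = "1 :: real" and b = 0]) blast
  have g01: "0 \<le> g x" "g x \<le> 1" for x using g(2)[of x] by (auto simp: closed_segment_eq_real_ivl)
  have UK: "U \<in> sets M" "K \<in> sets M" "U - K \<in> sets M"
    using K U by (auto simp: sM borel_compact)
  have gm: "g \<in> borel_measurable M"
    using borel_measurable_continuous_onI[OF g(1)] by (simp cong: measurable_cong_sets[OF sM refl])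
  have gi: "integrable M g" by (rule integrable_const_bound[of _ 1]) (use g01 gm in auto)
  have Ai: "integrable M (indicator A :: 'a \<Rightarrow> real)" 
    by (rule integrable_real_indicator) (use A sM in \<open>auto simp: less_top[symmetric]\<close>)
  have "(\<integral>x. \<bar>indicator A x - g x\<bar> \<partial>M) \<le> (\<integral>x. indicator (U - K) x \<partial>M)"
  proof (rule integral_mono)
    show "integrable M (\<lambda>x. \<bar>indicator A x - g x\<bar>)" using gi Ai by auto
    show "integrable M (indicator (U - K) :: 'a \<Rightarrow> real)"
      by (rule integrable_real_indicator) (use UK in \<open>auto simp: less_top[symmetric]\<close>)
    fix x
    show "\<bar>indicator A x - g x\<bar> \<le> indicator (U - K) x"
      using g(3)[of x] g(4)[of x] g01[of x] K(1) U(1) by (auto simp: indicator_def abs_if split: if_splits)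
  qed
  also have "\<dots> = measure M (U - K)" using UK by simp
  also have "\<dots> = measure M U - measure M K"
    using UK K U by (intro finite_measure_Diff) auto
  also have "\<dots> < e" using K(3) U(3) by simp
  finally show ?thesis using g(1) gi by (intro that[of g])
qed

lemma L1_continuous_dense:
  fixes M :: "'a::euclidean_space measure" and f :: "'a \<Rightarrow> real"
  assumes fM: "finite_measure M" and sM: "sets M = sets borel" and f: "integrable M f" and e: "0 < e"
  shows "\<exists>g. continuous_on UNIV g \<and> integrable M g \<and> (\<integral>x. \<bar>f x - g x\<bar> \<partial>M) < e"
  using f e
proof (induction f arbitrary: e)
  case (base A c)
  have A: "A \<in> sets borel" using base sM by simp
  obtain g :: "'a \<Rightarrow> real" where g: "continuous_on UNIV g" "integrable M g"
    "(\<integral>x. \<bar>indicator A x - g x\<bar> \<partial>M) < e / (\<bar>c\<bar> + 1)"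
    using indicator_L1_continuous[OF fM sM A, of "e / (\<bar>c\<bar> + 1)"] \<open>0 < e\<close> by auto
  have "(\<integral>x. \<bar>indicator A x *\<^sub>R c - c * g x\<bar> \<partial>M) = (\<integral>x. \<bar>c\<bar> * \<bar>indicator A x - g x\<bar> \<partial>M)"
    by (intro Bochner_Integration.integral_cong refl) (simp add: algebra_simps flip: abs_mult)
  also have "\<dots> = \<bar>c\<bar> * (\<integral>x. \<bar>indicator A x - g x\<bar> \<partial>M)" by simp
  also have "\<dots> \<le> \<bar>c\<bar> * (e / (\<bar>c\<bar> + 1))" using g(3) by (intro mult_left_mono) auto
  also have "\<dots> < e" using base by (simp add: field_simps)
  finally show ?case
    using g by (intro exI[of _ "\<lambda>x. c * g x"]) (auto intro!: continuous_intros)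
next
  case (add f f')
  obtain g where g: "continuous_on UNIV g" "integrable M g" "(\<integral>x. \<bar>f x - g x\<bar> \<partial>M) < e / 2"
    using add.IH(1)[of "e / 2"] \<open>0 < e\<close> by auto
  obtain g' where g': "continuous_on UNIV g'" "integrable M g'" "(\<integral>x. \<bar>f' x - g' x\<bar> \<partial>M) < e / 2"
    using add.IH(2)[of "e / 2"] \<open>0 < e\<close> by auto
  have "(\<integral>x. \<bar>f x + f' x - (g x + g' x)\<bar> \<partial>M) \<le> (\<integral>x. \<bar>f x - g x\<bar> + \<bar>f' x - g' x\<bar> \<partial>M)"
    using add.hyps g g' by (intro integral_mono) auto
  also have "\<dots> = (\<integral>x. \<bar>f x - g x\<bar> \<partial>M) + (\<integral>x. \<bar>f' x - g' x\<bar> \<partial>M)"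
    using add.hyps g g' by (intro Bochner_Integration.integral_add) auto
  also have "\<dots> < e" using g(3) g'(3) by simp
  finally show ?case
    using g g' by (intro exI[of _ "\<lambda>x. g x + g' x"]) (auto intro!: continuous_intros)
next
  case (lim f s)
  have "(\<lambda>i. \<integral>x. \<bar>f x - s i x\<bar> \<partial>M) \<longlonglongrightarrow> (\<integral>x. 0 \<partial>M)"
  \<comment> \<open>The approximants satisfy |s i| \<le> 2 |f|, hence |f - s i| \<le> 3 |f|.\<close>
  proof (rule integral_dominated_convergence[where w = "\<lambda>x. 3 * \<bar>f x\<bar>"])
    show "AE x in M. (\<lambda>i. \<bar>f x - s i x\<bar>) \<longlonglongrightarrow> 0"
    proof (rule AE_I2)
      fix x assume "x \<in> space M"
      from tendsto_diff[OF tendsto_const[of "f x"] lim.hyps(2)[OF this]]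
      show "(\<lambda>i. \<bar>f x - s i x\<bar>) \<longlonglongrightarrow> 0" using tendsto_rabs_zero by fastforce
    qed
    show "AE x in M. norm \<bar>f x - s i x\<bar> \<le> 3 * \<bar>f x\<bar>" for i
    proof (rule AE_I2)
      fix x assume "x \<in> space M"
      from lim.hyps(3)[OF this, of i] show "norm \<bar>f x - s i x\<bar> \<le> 3 * \<bar>f x\<bar>" by simp
    qed
  qed (use lim.hyps in auto)
  then have "(\<lambda>i. \<integral>x. \<bar>f x - s i x\<bar> \<partial>M) \<longlonglongrightarrow> 0" by simp
  then have "\<forall>\<^sub>F i in sequentially. (\<integral>x. \<bar>f x - s i x\<bar> \<partial>M) < e / 2"
    using \<open>0 < e\<close> by (intro order_tendstoD) auto
  then obtain i where i: "(\<integral>x. \<bar>f x - s i x\<bar> \<partial>M) < e / 2"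
    by (auto simp: eventually_sequentially)
  obtain g where g: "continuous_on UNIV g" "integrable M g" "(\<integral>x. \<bar>s i x - g x\<bar> \<partial>M) < e / 2"
    using lim.IH[of "e / 2" i] \<open>0 < e\<close> by auto
  have "(\<integral>x. \<bar>f x - g x\<bar> \<partial>M) \<le> (\<integral>x. \<bar>f x - s i x\<bar> + \<bar>s i x - g x\<bar> \<partial>M)"
    using lim.hyps g by (intro integral_mono) auto
  also have "\<dots> = (\<integral>x. \<bar>f x - s i x\<bar> \<partial>M) + (\<integral>x. \<bar>s i x - g x\<bar> \<partial>M)"
    using lim.hyps g by (intro Bochner_Integration.integral_add) auto
  also have "\<dots> < e" using i g(3) by simp
  finally show ?case using g by blast
qed

section \<open>The regression function as a density\<close>

text \<open>\<open>cond\<close> says that \<open>eta\<close> is the density, with respect to the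
  marginal, of the image of P weighted by the label. Once the two measures agree, the claim for
  every g is a change of variables.\<close>

lemma regression_integral:
  fixes P :: "('a::topological_space \<times> bool) measure" and eta g :: "'a \<Rightarrow> real"
  assumes P: "prob_space P" and sP: "sets P = sets (borel \<Otimes>\<^sub>M count_space UNIV)"
    and eta: "eta \<in> borel_measurable borel" "\<And>x. 0 \<le> eta x \<and> eta x \<le> 1"
    and cond: "\<And>A. A \<in> sets borel \<Longrightarrow>
         measure P (A \<times> {True}) = (\<integral>x. indicator A x * eta x \<partial>(distr P borel fst))"
    and g: "g \<in> borel_measurable borel"
  shows "(\<integral>z. of_bool (snd z) * g (fst z) \<partial>P) = (\<integral>x. eta x * g x \<partial>(distr P borel fst))"
proof -
  interpret P: prob_space P by fact
  have fst_m: "fst \<in> measurable P borel" and snd_m: "snd \<in> measurable P (count_space UNIV)"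
    by (simp_all cong: measurable_cong_sets[OF sP refl])
  let ?PX = "distr P borel fst"
  interpret PX: prob_space ?PX by (rule P.prob_space_distr[OF fst_m])
  have spP: "space P = UNIV" using sets_eq_imp_space_eq[OF sP] by (simp add: space_pair_measure)
  have T: "(\<lambda>z. of_bool (snd z) :: real) \<in> borel_measurable P"
    by (rule measurable_compose[OF snd_m]) simp
  have eta_PX: "eta \<in> borel_measurable ?PX" using eta(1) by simp
  have eq: "distr (density P (\<lambda>z. ennreal (of_bool (snd z)))) borel fst = density ?PX (\<lambda>x. ennreal (eta x))"
  proof (rule measure_eqI)
    fix A assume "A \<in> sets (distr (density P (\<lambda>z. ennreal (of_bool (snd z)))) borel fst)"
    then have A: "A \<in> sets borel" by simp
    have AT: "A \<times> {True} \<in> sets P" using A by (simp add: sP)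
    have vm: "fst -` A \<in> sets P" using measurable_sets[OF fst_m A] spP by simp
    have "emeasure (distr (density P (\<lambda>z. ennreal (of_bool (snd z)))) borel fst) A
        = (\<integral>\<^sup>+z. ennreal (of_bool (snd z)) * indicator (fst -` A) z \<partial>P)"
      using A T vm fst_m spP by (subst emeasure_distr) (auto simp: emeasure_density)
    also have "\<dots> = (\<integral>\<^sup>+z. indicator (A \<times> {True}) z \<partial>P)"
      by (intro nn_integral_cong) (auto simp: indicator_def)
    also have "\<dots> = ennreal (measure P (A \<times> {True}))"
      using AT by (simp add: P.emeasure_eq_measure)
    also have "\<dots> = ennreal (\<integral>x. indicator A x * eta x \<partial>?PX)" by (simp add: cond[OF A])
    also have "\<dots> = (\<integral>\<^sup>+x. ennreal (indicator A x * eta x) \<partial>?PX)"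
    proof (rule nn_integral_eq_integral[symmetric])
      show "integrable ?PX (\<lambda>x. indicator A x * eta x)"
        by (rule PX.integrable_const_bound[of _ 1])
          (use A eta in \<open>auto simp: indicator_def\<close>)
    qed (use eta in \<open>auto simp: indicator_def\<close>)
    also have "\<dots> = (\<integral>\<^sup>+x. ennreal (eta x) * indicator A x \<partial>?PX)"
      by (intro nn_integral_cong) (auto simp: indicator_def)
    also have "\<dots> = emeasure (density ?PX (\<lambda>x. ennreal (eta x))) A"
      using A eta_PX by (simp add: emeasure_density)
    finally show "emeasure (distr (density P (\<lambda>z. ennreal (of_bool (snd z)))) borel fst) A
        = emeasure (density ?PX (\<lambda>x. ennreal (eta x))) A" .
  qed simp
  have "(\<integral>z. of_bool (snd z) * g (fst z) \<partial>P) = (\<integral>z. g (fst z) \<partial>density P (\<lambda>z. ennreal (of_bool (snd z))))"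
    using T measurable_compose[OF fst_m g] by (subst integral_density) auto
  also have "\<dots> = (\<integral>x. g x \<partial>distr (density P (\<lambda>z. ennreal (of_bool (snd z)))) borel fst)"
    using fst_m g by (subst integral_distr) auto
  also have "\<dots> = (\<integral>x. eta x * g x \<partial>?PX)"
    unfolding eq using eta g by (subst integral_density) auto
  finally show ?thesis .
qed

text \<open>Boundedness of f makes both parts of \<open>logloss_eq\<close> integrable, so the loss
  splits into a part without label and one linear in it; only the latter uses
  \<open>regression_integral\<close>.\<close>

lemma nn_integral_logloss:
  fixes P :: "('a::topological_space \<times> bool) measure" and eta f :: "'a \<Rightarrow> real"
  assumes P: "prob_space P" and sP: "sets P = sets (borel \<Otimes>\<^sub>M count_space UNIV)"
    and eta: "eta \<in> borel_measurable borel" "\<And>x. 0 \<le> eta x \<and> eta x \<le> 1"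
    and cond: "\<And>A. A \<in> sets borel \<Longrightarrow>
         measure P (A \<times> {True}) = (\<integral>x. indicator A x * eta x \<partial>(distr P borel fst))"
    and f: "f \<in> borel_measurable borel" and bd: "\<And>x. \<bar>f x\<bar> \<le> B"
  shows "(\<integral>\<^sup>+z. logloss (snd z) (f (fst z)) \<partial>P) = ennreal (\<integral>x. cond_risk (eta x) (f x) \<partial>(distr P borel fst))"
    and "integrable (distr P borel fst) (\<lambda>x. cond_risk (eta x) (f x))"
proof -
  interpret P: prob_space P by fact
  have fst_m: "fst \<in> measurable P borel" and snd_m: "snd \<in> measurable P (count_space UNIV)"
    by (simp_all cong: measurable_cong_sets[OF sP refl])
  let ?PX = "distr P borel fst"
  interpret PX: prob_space ?PX by (rule P.prob_space_distr[OF fst_m])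
  note f_fst = measurable_compose[OF fst_m f]
  have T: "(\<lambda>z. of_bool (snd z) :: real) \<in> borel_measurable P"
    by (rule measurable_compose[OF snd_m]) simp
  have l_bd: "\<bar>ln (1 + exp u)\<bar> \<le> ln 2 + B" if "\<bar>u\<bar> \<le> B" for u
    using logloss_bound[of False u] that by (simp add: logloss_eq)
  have i1: "integrable ?PX (\<lambda>x. ln (1 + exp (f x)))"
    by (rule PX.integrable_const_bound[of _ "ln 2 + B"]) (use f bd l_bd in auto)
  have i2: "integrable ?PX (\<lambda>x. eta x * f x)"
  proof (rule PX.integrable_const_bound[of _ B])
    have "\<bar>eta x * f x\<bar> \<le> 1 * B" for x
      unfolding abs_mult using eta(2) bd by (intro mult_mono) auto
    then show "AE x in ?PX. norm (eta x * f x) \<le> B" by simp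
  qed (use f eta in auto)
  have j1: "integrable P (\<lambda>z. ln (1 + exp (f (fst z))))"
    by (rule P.integrable_const_bound[of _ "ln 2 + B"]) (use f_fst bd l_bd in auto)
  have j2: "integrable P (\<lambda>z. of_bool (snd z) * f (fst z))"
  proof (rule P.integrable_const_bound[of _ B])
    have "\<bar>of_bool (snd z) * f (fst z)\<bar> \<le> 1 * B" for z
      unfolding abs_mult using bd by (intro mult_mono) auto
    then show "AE z in P. norm (of_bool (snd z) * f (fst z)) \<le> B" by simp
  qed (use f_fst T in auto)
  show "integrable ?PX (\<lambda>x. cond_risk (eta x) (f x))"
    unfolding cond_risk_def using i1 i2 by auto
  have "integrable P (\<lambda>z. logloss (snd z) (f (fst z)))"
    unfolding logloss_eq by (rule Bochner_Integration.integrable_diff[OF j1 j2])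
  then have "(\<integral>\<^sup>+z. logloss (snd z) (f (fst z)) \<partial>P) = ennreal (\<integral>z. logloss (snd z) (f (fst z)) \<partial>P)"
    by (rule nn_integral_eq_integral) (simp add: logloss_nonneg)
  also have "(\<integral>z. logloss (snd z) (f (fst z)) \<partial>P)
      = (\<integral>z. ln (1 + exp (f (fst z))) \<partial>P) - (\<integral>z. of_bool (snd z) * f (fst z) \<partial>P)"
    unfolding logloss_eq using j1 j2 by (rule Bochner_Integration.integral_diff)
  also have "(\<integral>z. ln (1 + exp (f (fst z))) \<partial>P) = (\<integral>x. ln (1 + exp (f x)) \<partial>?PX)"
    using fst_m f by (subst integral_distr) auto
  also have "(\<integral>z. of_bool (snd z) * f (fst z) \<partial>P) = (\<integral>x. eta x * f x \<partial>?PX)"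
    by (rule regression_integral[OF P sP eta cond f])
  also have "(\<integral>x. ln (1 + exp (f x)) \<partial>?PX) - (\<integral>x. eta x * f x \<partial>?PX) = (\<integral>x. cond_risk (eta x) (f x) \<partial>?PX)"
    unfolding cond_risk_def using i1 i2 by (rule Bochner_Integration.integral_diff[symmetric])
  finally show "(\<integral>\<^sup>+z. logloss (snd z) (f (fst z)) \<partial>P) = ennreal (\<integral>x. cond_risk (eta x) (f x) \<partial>?PX)" .
qed

section \<open>Consistency of the estimated regression function\<close>

locale universal_classification = compact_kernel k X
  for k :: "'a::euclidean_space \<Rightarrow> 'a \<Rightarrow> real" and X +
  fixes P :: "('a \<times> bool) measure" and eta :: "'a \<Rightarrow> real"
  assumes dense: "continuous_on X g \<Longrightarrow> 0 < e \<Longrightarrow> \<exists>f\<in>rkhs k X. \<forall>x\<in>X. \<bar>f x - g x\<bar> < e"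
    and P_prob: "prob_space P"
    and P_sets: "sets P = sets (borel \<Otimes>\<^sub>M count_space UNIV)"
    and P_supp: "emeasure P (X \<times> UNIV) = 1"
    and eta_meas [measurable]: "eta \<in> borel_measurable borel"
    and eta_range: "\<And>x. 0 \<le> eta x \<and> eta x \<le> 1"
    and eta_cond: "\<And>A. A \<in> sets borel \<Longrightarrow>
         measure P (A \<times> {True}) = (\<integral>x. indicator A x * eta x \<partial>(distr P borel fst))"
begin

abbreviation "PX \<equiv> distr P borel fst"

sublocale P: prob_space P by (rule P_prob)

lemma fst_P: "fst \<in> measurable P borel"
  by (simp cong: measurable_cong_sets[OF P_sets refl])

sublocale PX: prob_space PX by (rule P.prob_space_distr[OF fst_P])

lemma AE_X: "AE x in PX. x \<in> X"
proof -
  have "space P = UNIV" using sets_eq_imp_space_eq[OF P_sets] by (simp add: space_pair_measure)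
  moreover have "fst -` X = X \<times> (UNIV :: bool set)" by auto
  ultimately have "emeasure PX X = 1"
    using P_supp by (simp add: emeasure_distr[OF fst_P X_borel])
  then have "PX.prob X = 1" by (simp add: PX.emeasure_eq_measure)
  then show ?thesis by (subst (asm) PX.prob_eq_1) auto
qed

lemma rkhs_bounded:
  assumes "f \<in> rkhs k X"
  obtains B where "\<And>x. \<bar>f x\<bar> \<le> B"
proof -
  obtain K where K: "0 \<le> K" "\<And>x. x \<in> X \<Longrightarrow> sqrt (k x x) \<le> K" using kernel_bound by blast
  have "\<bar>f x\<bar> \<le> rkhs_norm k X f * K" for x
  proof (cases "x \<in> X")
    case True
    then show ?thesis
      using rkhs_eval_bound[OF assms True] mult_left_mono[OF K(2)[OF True] rkhs_norm_nonneg[OF assms]]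
      by linarith
  next
    case False
    then show ?thesis using rkhs_zero_outside[OF assms False] rkhs_norm_nonneg[OF assms] K(1) by simp
  qed
  then show ?thesis by (rule that)
qed

lemma integrable_entropy: "integrable PX (\<lambda>x. binary_entropy (eta x))"
proof (rule PX.integrable_const_bound[of _ "ln 2"])
  show "AE x in PX. norm (binary_entropy (eta x)) \<le> ln 2"
    using eta_range binary_entropy_nonneg binary_entropy_le by (intro AE_I2) simp
qed (simp add: binary_entropy_def)

lemma nn_integral_risk:
  assumes "f \<in> borel_measurable borel" "\<And>x. \<bar>f x\<bar> \<le> B"
  shows "(\<integral>\<^sup>+z. logloss (snd z) (f (fst z)) \<partial>P) = ennreal (\<integral>x. cond_risk (eta x) (f x) \<partial>PX)"
  by (rule nn_integral_logloss(1)[OF P_prob P_sets eta_meas eta_range _ assms]) (rule eta_cond)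

lemma integrable_cond_risk:
  assumes "f \<in> borel_measurable borel" "\<And>x. \<bar>f x\<bar> \<le> B"
  shows "integrable PX (\<lambda>x. cond_risk (eta x) (f x))"
  by (rule nn_integral_logloss(2)[OF P_prob P_sets eta_meas eta_range _ assms]) (rule eta_cond)

text \<open>Each of three errors gets e / 3: smoothing \<open>eta\<close>, approximating the bounded
  logit h in L1 by a continuous g, and approximating g uniformly on \<open>X\<close> by an RKHS
  function. The last bound holds on \<open>X\<close> only, hence almost everywhere.\<close>

lemma rkhs_risk_near_entropy:
  assumes e: "0 < e"
  obtains f where "f \<in> rkhs k X"
    "(\<integral>x. cond_risk (eta x) (f x) \<partial>PX) \<le> (\<integral>x. binary_entropy (eta x) \<partial>PX) + e"
proof -
  \<comment> \<open>The second bound is solved from -ln (1 - 2 t) \<le> e / 3.\<close>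
  define t where "t = min (1 / 4) ((1 - exp (- (e / 3))) / 2)"
  have t: "0 < t" "t < 1 / 2" using e by (auto simp: t_def min_def)
  have "t \<le> (1 - exp (- (e / 3))) / 2" unfolding t_def by (rule min.cobounded2)
  then have "exp (- (e / 3)) \<le> 1 - 2 * t" by (simp add: field_simps)
  then have "ln (exp (- (e / 3))) \<le> ln (1 - 2 * t)" by (intro ln_mono) auto
  then have lt: "- ln (1 - 2 * t) \<le> e / 3" by simp
  define q where "q x = t + (1 - 2 * t) * eta x" for x
  define h where "h x = ln (q x / (1 - q x))" for x
  have q: "t \<le> q x" "q x \<le> 1 - t" for x
  proof -
    have u: "0 \<le> (1 - 2 * t) * eta x" using t eta_range[of x] by simp
    have v: "(1 - 2 * t) * eta x \<le> 1 - 2 * t"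
      using mult_left_mono[of "eta x" 1 "1 - 2 * t"] t eta_range[of x] by simp
    show "t \<le> q x" using u by (simp add: q_def)
    have "t + (1 - 2 * t) * eta x \<le> t + (1 - 2 * t)" using v by (rule add_left_mono)
    then show "q x \<le> 1 - t" by (simp add: q_def)
  qed
  have h_m [measurable]: "h \<in> borel_measurable borel" unfolding h_def q_def by measurable
  have h_bd: "\<bar>h x\<bar> \<le> - 2 * ln t" for x
  proof -
    have "ln t \<le> ln (q x)" "ln (q x) \<le> 0" "ln t \<le> ln (1 - q x)" "ln (1 - q x) \<le> 0"
      using q[of x] t by (auto intro!: ln_mono)
    moreover have "h x = ln (q x) - ln (1 - q x)" unfolding h_def using q[of x] t by (simp add: ln_div)
    ultimately show ?thesis by linarith
  qed
  have h_i: "integrable PX h" by (rule PX.integrable_const_bound[of _ "- 2 * ln t"]) (use h_bd in auto)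
  obtain g where g: "continuous_on UNIV g" "integrable PX g" "(\<integral>x. \<bar>h x - g x\<bar> \<partial>PX) < e / 3"
    using L1_continuous_dense[OF PX.finite_measure_axioms _ h_i, of "e / 3"] e by auto
  obtain f where f: "f \<in> rkhs k X" "\<forall>x\<in>X. \<bar>f x - g x\<bar> < e / 3"
    using dense[of g "e / 3"] continuous_on_subset[OF g(1)] e by auto
  obtain B where B: "\<And>x. \<bar>f x\<bar> \<le> B" using rkhs_bounded[OF f(1)] by blast
  have f_m [measurable]: "f \<in> borel_measurable borel" by (rule rkhs_measurable[OF f(1)])
  have "(\<integral>x. cond_risk (eta x) (f x) \<partial>PX)
      \<le> (\<integral>x. binary_entropy (eta x) + e / 3 + \<bar>h x - g x\<bar> + e / 3 \<partial>PX)"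
  proof (rule integral_mono_AE)
    show "integrable PX (\<lambda>x. cond_risk (eta x) (f x))" by (rule integrable_cond_risk[OF f_m B])
    show "integrable PX (\<lambda>x. binary_entropy (eta x) + e / 3 + \<bar>h x - g x\<bar> + e / 3)"
      using integrable_entropy g(2) h_i by auto
    show "AE x in PX. cond_risk (eta x) (f x) \<le> binary_entropy (eta x) + e / 3 + \<bar>h x - g x\<bar> + e / 3"
      using AE_X
    proof eventually_elim
      case (elim x)
      have "cond_risk (eta x) (f x) \<le> cond_risk (eta x) (h x) + \<bar>f x - h x\<bar>"
        using cond_risk_lipschitz[of "eta x" "f x" "h x"] eta_range[of x] by linarith
      moreover have "cond_risk (eta x) (h x) \<le> binary_entropy (eta x) - ln (1 - 2 * t)"
        unfolding h_def using eta_range[of x] t by (intro cond_risk_smoothed_logit_le) (auto simp: q_def)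
      moreover have "\<bar>f x - g x\<bar> < e / 3" using f(2) elim by blast
      ultimately show ?case using lt by linarith
    qed
  qed
  also have "\<dots> = (\<integral>x. binary_entropy (eta x) \<partial>PX) + e / 3 + (\<integral>x. \<bar>h x - g x\<bar> \<partial>PX) + e / 3"
    using integrable_entropy g(2) h_i PX.prob_space by simp
  also have "\<dots> \<le> (\<integral>x. binary_entropy (eta x) \<partial>PX) + e" using g(3) by simp
  finally show ?thesis using f(1) that by blast
qed

section \<open>Mean square error of the estimated regression function\<close>

definition sq_error :: "real \<Rightarrow> nat \<Rightarrow> (nat \<Rightarrow> 'a \<times> bool) \<Rightarrow> real" where
  "sq_error lam m S = (\<integral>x. (etahat k X lam m S x - eta x)\<^sup>2 \<partial>PX)"

abbreviation "Pm m \<equiv> PiM {..<m} (\<lambda>_. P)"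

lemma prob_space_Pm: "prob_space (Pm m)"
  by (intro prob_space_PiM P_prob)

lemma etahat_range: "0 < etahat k X lam m S x" "etahat k X lam m S x < 1"
  by (auto simp: etahat_def add_pos_pos)

context
  fixes lam :: real
  assumes lam: "0 < lam"
begin

lemma etahat_measurable:
  "(\<lambda>p. etahat k X lam m (fst p) (snd p)) \<in> borel_measurable (Pm m \<Otimes>\<^sub>M borel)"
  unfolding etahat_def using fhat_measurable[OF lam P_sets, of m] by measurable

lemma etahat_measurable_x: "etahat k X lam m S \<in> borel_measurable borel"
  unfolding etahat_def[abs_def] using rkhs_measurable[OF fhat_rkhs[OF lam, of m S]] by measurable

lemma etahat_sq_le: "(etahat k X lam m S x - eta x)\<^sup>2 \<le> 1"
proof -
  have "\<bar>etahat k X lam m S x - eta x\<bar> \<le> 1"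
    using etahat_range[of lam m S x] eta_range[of x] by linarith
  then show ?thesis using abs_square_le_1 by blast
qed

lemma integrable_sq_error: "integrable PX (\<lambda>x. (etahat k X lam m S x - eta x)\<^sup>2)"
  by (rule PX.integrable_const_bound[of _ 1]) (use etahat_sq_le etahat_measurable_x in auto)

lemma sq_error_measurable: "sq_error lam m \<in> borel_measurable (Pm m)"
proof -
  have "(\<lambda>p. (etahat k X lam m (fst p) (snd p) - eta (snd p))\<^sup>2) \<in> borel_measurable (Pm m \<Otimes>\<^sub>M borel)"
    using etahat_measurable[of m] by measurable
  then have "(\<lambda>p. (etahat k X lam m (fst p) (snd p) - eta (snd p))\<^sup>2) \<in> borel_measurable (Pm m \<Otimes>\<^sub>M PX)"
    by (simp cong: measurable_cong_sets sets_pair_measure_cong)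
  then have "(\<lambda>S. \<integral>x. (etahat k X lam m S x - eta x)\<^sup>2 \<partial>PX) \<in> borel_measurable (Pm m)"
    using PX.borel_measurable_lebesgue_integral[of "\<lambda>S x. (etahat k X lam m S x - eta x)\<^sup>2"]
    by (simp add: case_prod_unfold)
  then show ?thesis by (simp add: sq_error_def[abs_def])
qed

lemma sq_error_nonneg: "0 \<le> sq_error lam m S"
  unfolding sq_error_def by simp

text \<open>Integrating \<open>cond_risk_ge\<close> shows that the excess risk is at least a quarter
  of the squared error, whence the factor 4; \<open>fhat_expected_risk\<close> bounds the expected
  risk from above.\<close>

lemma expected_sq_error:
  assumes m: "0 < m" and K: "0 \<le> K" "\<And>x. x \<in> X \<Longrightarrow> sqrt (k x x) \<le> K" and f: "f \<in> rkhs k X"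
  shows "(\<integral>\<^sup>+S. sq_error lam m S \<partial>Pm m) \<le> ennreal (4 *
    ((\<integral>x. cond_risk (eta x) (f x) \<partial>PX) - (\<integral>x. binary_entropy (eta x) \<partial>PX)
      + (lam / 2 * (rkhs_norm k X f)\<^sup>2 + 4 * K\<^sup>2 / (lam * real m))))"
proof -
  let ?H = "\<integral>x. binary_entropy (eta x) \<partial>PX" and ?R = "\<integral>x. cond_risk (eta x) (f x) \<partial>PX"
  let ?r = "lam / 2 * (rkhs_norm k X f)\<^sup>2 + 4 * K\<^sup>2 / (lam * real m)"
  interpret M: prob_space "Pm m" by (rule prob_space_Pm)
  have r0: "0 \<le> ?r" using lam by simp
  have H0: "0 \<le> ?H" using eta_range by (intro integral_nonneg_AE AE_I2 binary_entropy_nonneg) auto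
  have Rf0: "0 \<le> ?R" using eta_range by (intro integral_nonneg_AE AE_I2 cond_risk_nonneg) auto
  have low: "ennreal ?H + ennreal (sq_error lam m S / 4)
      \<le> (\<integral>\<^sup>+z. logloss (snd z) (fhat k X lam m S (fst z)) \<partial>P)" for S
  proof -
    have fr: "fhat k X lam m S \<in> rkhs k X" by (rule fhat_rkhs[OF lam])
    obtain B where B: "\<And>x. \<bar>fhat k X lam m S x\<bar> \<le> B" using rkhs_bounded[OF fr] by blast
    note rk = nn_integral_risk[OF rkhs_measurable[OF fr] B] integrable_cond_risk[OF rkhs_measurable[OF fr] B]
    have "?H + sq_error lam m S / 4
        = (\<integral>x. binary_entropy (eta x) + (etahat k X lam m S x - eta x)\<^sup>2 / 4 \<partial>PX)"
      unfolding sq_error_def using integrable_entropy integrable_sq_error[of m S] by simp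
    also have "\<dots> \<le> (\<integral>x. cond_risk (eta x) (fhat k X lam m S x) \<partial>PX)"
      using integrable_entropy integrable_sq_error[of m S] rk(2) eta_range
      by (intro integral_mono) (auto simp: etahat_def intro: cond_risk_ge)
    finally show ?thesis
      unfolding rk(1) using H0 sq_error_nonneg[of m S]
      by (simp add: ennreal_leI flip: ennreal_plus)
  qed
  obtain B where B: "\<And>x. \<bar>f x\<bar> \<le> B" using rkhs_bounded[OF f] by blast
  have q_m: "(\<lambda>S. ennreal (sq_error lam m S / 4)) \<in> borel_measurable (Pm m)"
    using sq_error_measurable[of m] by measurable
  have "ennreal ?H + (\<integral>\<^sup>+S. ennreal (sq_error lam m S / 4) \<partial>Pm m)
      = (\<integral>\<^sup>+S. ennreal ?H + ennreal (sq_error lam m S / 4) \<partial>Pm m)"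
    using q_m by (subst nn_integral_add) (auto simp: M.emeasure_space_1)
  also have "\<dots> \<le> (\<integral>\<^sup>+S. \<integral>\<^sup>+z. logloss (snd z) (fhat k X lam m S (fst z)) \<partial>P \<partial>Pm m)"
    by (intro nn_integral_mono low)
  also have "\<dots> \<le> (\<integral>\<^sup>+z. logloss (snd z) (f (fst z)) \<partial>P) + ennreal ?r"
    by (rule fhat_expected_risk[OF P_prob P_sets lam m K f])
  also have "(\<integral>\<^sup>+z. logloss (snd z) (f (fst z)) \<partial>P) = ennreal ?R"
    by (rule nn_integral_risk[OF rkhs_measurable[OF f] B])
  finally have "ennreal ?H + (\<integral>\<^sup>+S. ennreal (sq_error lam m S / 4) \<partial>Pm m) \<le> ennreal (?R + ?r)"
    using Rf0 r0 by (simp add: ennreal_plus)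
  then have "(\<integral>\<^sup>+S. ennreal (sq_error lam m S / 4) \<partial>Pm m) \<le> ennreal (?R + ?r) - ennreal ?H"
    by (simp add: ennreal_le_minus_iff add.commute)
  also have "\<dots> = ennreal (?R - ?H + ?r)" using H0 by (simp add: ennreal_minus algebra_simps)
  finally have *: "(\<integral>\<^sup>+S. ennreal (sq_error lam m S / 4) \<partial>Pm m) \<le> ennreal (?R - ?H + ?r)" .
  have "ennreal (sq_error lam m S) = ennreal 4 * ennreal (sq_error lam m S / 4)" for S
    using ennreal_mult[of 4 "sq_error lam m S / 4"] sq_error_nonneg[of m S] by simp
  then have "(\<integral>\<^sup>+S. sq_error lam m S \<partial>Pm m) = (\<integral>\<^sup>+S. ennreal 4 * ennreal (sq_error lam m S / 4) \<partial>Pm m)"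
    by (simp only:)
  also have "\<dots> = ennreal 4 * (\<integral>\<^sup>+S. ennreal (sq_error lam m S / 4) \<partial>Pm m)"
    using q_m by (rule nn_integral_cmult)
  also have "\<dots> \<le> ennreal 4 * ennreal (?R - ?H + ?r)" by (intro mult_left_mono *) auto
  also have "\<dots> = ennreal (4 * (?R - ?H + ?r))" by (rule ennreal_mult'[symmetric]) simp
  finally show ?thesis .
qed

end

text \<open>The comparison function is fixed before m grows, so its penalty vanishes with
  \<open>lam\<close>. Markov's inequality turns the bound in mean into one in probability.\<close>

lemma sq_error_tendsto_prob:
  fixes lam :: "nat \<Rightarrow> real"
  assumes lam_pos: "\<And>m. lam m > 0"
    and lam_to_0: "lam \<longlonglongrightarrow> 0"
    and lam_rate: "filterlim (\<lambda>m. real m * (lam m)\<^sup>2) at_top sequentially"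
    and t: "0 < t"
  shows "(\<lambda>m. measure (Pm m) {S \<in> space (Pm m). t \<le> sq_error (lam m) m S}) \<longlonglongrightarrow> 0"
proof (rule LIMSEQ_I)
  fix e :: real assume e: "0 < e"
  \<comment> \<open>Excess risk, penalty and stability term each cost at most d. Four times their
    sum is at most 12 d, that is 3/4 of e t, and dividing by t leaves less than e.\<close>
  define d where "d = e * t / 16"
  have d: "0 < d" using e t by (simp add: d_def)
  obtain K where K: "0 \<le> K" "\<And>x. x \<in> X \<Longrightarrow> sqrt (k x x) \<le> K" using kernel_bound by blast
  obtain f where f: "f \<in> rkhs k X"
    "(\<integral>x. cond_risk (eta x) (f x) \<partial>PX) \<le> (\<integral>x. binary_entropy (eta x) \<partial>PX) + d"
    using rkhs_risk_near_entropy[OF d] by blast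
  have "(\<lambda>m. lam m / 2 * (rkhs_norm k X f)\<^sup>2) \<longlonglongrightarrow> 0 / 2 * (rkhs_norm k X f)\<^sup>2"
    by (intro tendsto_intros lam_to_0) simp
  then have "(\<lambda>m. lam m / 2 * (rkhs_norm k X f)\<^sup>2) \<longlonglongrightarrow> 0" by simp
  then have ev1: "\<forall>\<^sub>F m in sequentially. lam m / 2 * (rkhs_norm k X f)\<^sup>2 < d"
    using d by (rule order_tendstoD)
  have ev2: "\<forall>\<^sub>F m in sequentially. lam m < 1" using lam_to_0 by (rule order_tendstoD) simp
  have ev3: "\<forall>\<^sub>F m in sequentially. 4 * K\<^sup>2 / d + 1 \<le> real m * (lam m)\<^sup>2"
    using lam_rate by (simp add: filterlim_at_top)
  have ev4: "\<forall>\<^sub>F m in sequentially. 0 < m" by (rule eventually_gt_at_top)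
  have "\<forall>\<^sub>F m in sequentially. norm (measure (Pm m) {S \<in> space (Pm m). t \<le> sq_error (lam m) m S} - 0) < e"
    using ev1 ev2 ev3 ev4
  proof eventually_elim
    case (elim m)
    interpret M: prob_space "Pm m" by (rule prob_space_Pm)
    let ?bad = "{S \<in> space (Pm m). t \<le> sq_error (lam m) m S}"
    \<comment> \<open>The stability term is governed by lam m, and for \<open>lam\<close> below 1
      this is at least m lam^2.\<close>
    have "real m * (lam m)\<^sup>2 \<le> lam m * real m"
    proof -
      have "lam m * lam m \<le> 1 * lam m" using elim(2) lam_pos[of m] by (intro mult_right_mono) auto
      then have "real m * (lam m * lam m) \<le> real m * lam m" by (intro mult_left_mono) auto
      then show ?thesis by (simp add: power2_eq_square mult.commute)
    qed
    with elim(3) have big: "4 * K\<^sup>2 / d < lam m * real m" by linarith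
    have arith: "4 * (a - b + (c + r)) \<le> 12 * d" if "a \<le> b + d" "c < d" "r < d" for a b c r
      using that by simp
    have lm: "0 < lam m * real m" using lam_pos[of m] elim(4) by simp
    have "4 * K\<^sup>2 / (lam m * real m) < d"
      using big d lm by (simp add: field_simps)
    then have "4 * ((\<integral>x. cond_risk (eta x) (f x) \<partial>PX) - (\<integral>x. binary_entropy (eta x) \<partial>PX)
      + (lam m / 2 * (rkhs_norm k X f)\<^sup>2 + 4 * K\<^sup>2 / (lam m * real m))) \<le> 12 * d"
      by (rule arith[OF f(2) elim(1)])
    then have int: "(\<integral>\<^sup>+S. sq_error (lam m) m S \<partial>Pm m) \<le> ennreal (12 * d)"
      using expected_sq_error[OF lam_pos elim(4) K f(1)] by (meson ennreal_leI order_trans)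
    have meas: "sq_error (lam m) m \<in> borel_measurable (Pm m)" by (rule sq_error_measurable[OF lam_pos])
    have "?bad \<in> sets (Pm m)" using meas by measurable
    then have "ennreal t * ennreal (M.prob ?bad) = (\<integral>\<^sup>+S. ennreal t * indicator ?bad S \<partial>Pm m)"
      by (simp add: nn_integral_cmult_indicator M.emeasure_eq_measure)
    also have "\<dots> \<le> (\<integral>\<^sup>+S. sq_error (lam m) m S \<partial>Pm m)"
      by (intro nn_integral_mono) (auto simp: indicator_def ennreal_leI)
    also note int
    finally have "ennreal (t * M.prob ?bad) \<le> ennreal (12 * d)" using t by (simp add: ennreal_mult)
    then have "t * M.prob ?bad \<le> 12 * d" using d by (simp add: ennreal_le_iff)
    also have "\<dots> = t * (12 / 16 * e)" by (simp add: d_def)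
    finally have "M.prob ?bad \<le> 12 / 16 * e" using t by simp
    also have "\<dots> < e" using e by simp
    finally show ?case by simp
  qed
  then show "\<exists>no. \<forall>m\<ge>no. norm (measure (Pm m) {S \<in> space (Pm m). t \<le> sq_error (lam m) m S} - 0) < e"
    by (simp add: eventually_sequentially)
qed

end

section \<open>The estimated level set\<close>

lemma Qhat_mono: "A \<subseteq> B \<Longrightarrow> Qhat n T A \<le> Qhat n T B"
  unfolding Qhat_def by (intro divide_right_mono) (auto intro!: card_mono)

lemma that_le:
  "Qhat n T {x. s + b \<le> eh x} \<le> alpha + c + eps_n n \<Longrightarrow> that eh n T alpha b c \<le> ereal s"
  unfolding that_def by (intro Inf_lower) auto

text \<open>Empirical level sets shrink as the level rises, so one infeasible level lies below all
  feasible ones.\<close>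

lemma that_ge:
  assumes "\<not> Qhat n T {x. s + b \<le> eh x} \<le> alpha + c + eps_n n"
  shows "ereal s \<le> that eh n T alpha b c"
  unfolding that_def
proof (rule Inf_greatest, safe)
  fix t assume t: "Qhat n T {x. t + b \<le> eh x} \<le> alpha + c + eps_n n"
  have "\<not> t < s"
  proof
    assume "t < s"
    then have "Qhat n T {x. s + b \<le> eh x} \<le> Qhat n T {x. t + b \<le> eh x}"
      by (intro Qhat_mono) auto
    with t assms show False by linarith
  qed
  then show "ereal s \<le> ereal t" by simp
qed

text \<open>Replaces the infimum over real thresholds by countably many rational levels, which makes
  membership a measurable condition.\<close>

lemma mem_Ghat_iff:
  "x \<in> Ghat eh n T alpha b c \<longleftrightarrow>
    (\<forall>q::rat. eh x < of_rat q \<longrightarrow> Qhat n T {y. of_rat q + b \<le> eh y} \<le> alpha + c + eps_n n)"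
proof
  assume x: "x \<in> Ghat eh n T alpha b c"
  show "\<forall>q::rat. eh x < of_rat q \<longrightarrow> Qhat n T {y. of_rat q + b \<le> eh y} \<le> alpha + c + eps_n n"
  proof (intro allI impI, rule ccontr)
    fix q :: rat assume q: "eh x < of_rat q" "\<not> Qhat n T {y. of_rat q + b \<le> eh y} \<le> alpha + c + eps_n n"
    have "ereal (of_rat q) \<le> ereal (eh x)"
      using order_trans[OF that_ge[OF q(2)]] x by (simp only: Ghat_def mem_Collect_eq)
    with q(1) show False by simp
  qed
next
  assume r: "\<forall>q::rat. eh x < of_rat q \<longrightarrow> Qhat n T {y. of_rat q + b \<le> eh y} \<le> alpha + c + eps_n n"
  have "\<not> ereal (eh x) < that eh n T alpha b c"
  proof
    assume "ereal (eh x) < that eh n T alpha b c"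
    then obtain q :: rat where q: "ereal (eh x) < ereal (of_rat q)" "ereal (of_rat q) < that eh n T alpha b c"
      using ereal_dense3 by blast
    then have "that eh n T alpha b c \<le> ereal (of_rat q)" using r by (intro that_le) simp
    with q(2) show False by simp
  qed
  then show "x \<in> Ghat eh n T alpha b c" by (simp add: Ghat_def)
qed

lemma eps_n_nonneg: "0 \<le> eps_n n"
  unfolding eps_n_def by (auto intro!: divide_nonneg_nonneg ln_ge_zero)

lemma eps_n_tendsto: "eps_n \<longlonglongrightarrow> 0"
proof -
  have "(\<lambda>n. ln (real (Suc n)) / real (Suc n) * (real (Suc n) / real n)) \<longlonglongrightarrow> 0 * 1"
    by (intro tendsto_mult LIMSEQ_Suc[OF lim_ln_over_n] LIMSEQ_Suc_n_over_n)
  then have "(\<lambda>n. ln (real n + 1) / real n) \<longlonglongrightarrow> 0" by (simp add: add.commute)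
  then have "(\<lambda>n. 4 * sqrt (ln (real n + 1) / real n)) \<longlonglongrightarrow> 4 * sqrt 0"
    by (intro tendsto_intros)
  then show ?thesis by (simp add: eps_n_def[abs_def])
qed

text \<open>Deterministic; randomness enters only through \<open>close\<close> and
  \<open>emp\<close>. Off the exceptional set a level of \<open>eh\<close> is a level of
  \<open>eta\<close> shifted by at most d. The slack r is spent on the exceptional set, on the
  empirical error and, for the lower bound of the threshold, on \<open>eps_n n\<close>.\<close>

lemma Ghat_symdiff_le:
  fixes Q :: "'a::topological_space measure"
  assumes Q: "prob_space Q" and sQ: "sets Q = sets borel"
    and m: "eh \<in> borel_measurable borel" "eta \<in> borel_measurable borel"
    and d: "0 < d"
    and close: "measure Q {x. d \<le> \<bar>eh x - eta x\<bar>} \<le> r"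
    and emp: "\<bar>Qhat n T {x. t0 + 2 * d \<le> eh x} - measure Q {x. t0 + 2 * d \<le> eh x}\<bar> \<le> r"
      "\<bar>Qhat n T {x. t0 - 2 * d \<le> eh x} - measure Q {x. t0 - 2 * d \<le> eh x}\<bar> \<le> r"
    and eps: "eps_n n \<le> r"
    and h: "measure Q {x. t0 + d \<le> eta x} + 2 * r \<le> alpha"
      "alpha + 3 * r < measure Q {x. t0 - d \<le> eta x}"
      "measure Q {x. t0 - 3 * d < eta x \<and> eta x < t0 + 3 * d} + r \<le> e"
  shows "measure Q ((Ghat eh n T alpha 0 0 - {x. t0 \<le> eta x}) \<union> ({x. t0 \<le> eta x} - Ghat eh n T alpha 0 0)) \<le> e"
proof -
  interpret prob_space Q by fact
  note [measurable] = m
  have S: "{x. R x} \<in> sets Q" if "Measurable.pred borel R" for R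
    using that by (simp add: sQ pred_def)
  let ?D = "{x. d \<le> \<bar>eh x - eta x\<bar>}"
  have D: "?D \<in> sets Q" by (rule S) measurable
  have "prob {x. t0 + 2 * d \<le> eh x} \<le> prob ({x. t0 + d \<le> eta x} \<union> ?D)"
    by (rule finite_measure_mono) (auto intro!: sets.Un S)
  also have "\<dots> \<le> prob {x. t0 + d \<le> eta x} + prob ?D"
    by (rule measure_Un_le) (auto intro!: S)
  finally have "Qhat n T {x. (t0 + 2 * d) + 0 \<le> eh x} \<le> alpha + 0 + eps_n n"
    using close emp(1) h(1) eps_n_nonneg[of n] by (simp add: abs_le_iff)
  then have up: "that eh n T alpha 0 0 \<le> ereal (t0 + 2 * d)" by (rule that_le)
  have "prob {x. t0 - d \<le> eta x} \<le> prob ({x. t0 - 2 * d \<le> eh x} \<union> ?D)"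
    by (rule finite_measure_mono) (auto intro!: sets.Un S)
  also have "\<dots> \<le> prob {x. t0 - 2 * d \<le> eh x} + prob ?D"
    by (rule measure_Un_le) (auto intro!: S)
  finally have "\<not> Qhat n T {x. (t0 - 2 * d) + 0 \<le> eh x} \<le> alpha + 0 + eps_n n"
    using close emp(2) h(2) eps by (simp add: abs_le_iff)
  then have lo: "ereal (t0 - 2 * d) \<le> that eh n T alpha 0 0" by (rule that_ge)
  have in_G: "t0 - 2 * d \<le> eh x" if "x \<in> Ghat eh n T alpha 0 0" for x
    using order_trans[OF lo, of "ereal (eh x)"] that by (simp add: Ghat_def)
  have notin_G: "eh x < t0 + 2 * d" if "x \<notin> Ghat eh n T alpha 0 0" for x
    using less_le_trans[OF _ up, of "ereal (eh x)"] that by (simp add: Ghat_def not_le)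
  let ?B = "{x. t0 - 3 * d < eta x \<and> eta x < t0 + 3 * d}"
  have "prob ((Ghat eh n T alpha 0 0 - {x. t0 \<le> eta x}) \<union> ({x. t0 \<le> eta x} - Ghat eh n T alpha 0 0))
      \<le> prob (?B \<union> ?D)"
  proof (rule finite_measure_mono)
    show "(Ghat eh n T alpha 0 0 - {x. t0 \<le> eta x}) \<union> ({x. t0 \<le> eta x} - Ghat eh n T alpha 0 0) \<subseteq> ?B \<union> ?D"
    proof
      fix x assume "x \<in> (Ghat eh n T alpha 0 0 - {x. t0 \<le> eta x}) \<union> ({x. t0 \<le> eta x} - Ghat eh n T alpha 0 0)"
      \<comment> \<open>The threshold is off by at most 2 d; replacing \<open>eh\<close> by
        \<open>eta\<close> adds d, hence the strip of half-width 3 d.\<close>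
      then have "(t0 - 2 * d \<le> eh x \<and> eta x < t0) \<or> (eh x < t0 + 2 * d \<and> t0 \<le> eta x)"
        using in_G[of x] notin_G[of x] by auto
      then show "x \<in> ?B \<union> ?D" using d by (auto simp: abs_if)
    qed
  qed (use D in \<open>auto intro!: sets.Un S\<close>)
  also have "\<dots> \<le> prob ?B + prob ?D"
    by (rule measure_Un_le) (use D in \<open>auto intro!: S\<close>)
  finally show ?thesis using close h(3) by linarith
qed

section \<open>Choice of the margins\<close>

text \<open>The lower bound in (B) opens a gap in measure on either side of \<open>t0\<close>, which
  pays for r; the upper bound makes the strip small.\<close>

lemma margin_choice:
  fixes Q :: "'a::topological_space measure" and t0 :: real
  assumes Q: "prob_space Q" and sQ: "sets Q = sets borel" and eta: "eta \<in> borel_measurable borel"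
    and alpha: "measure Q {x. t0 \<le> eta x} = alpha"
    and B: "0 < \<delta>0" "0 < b1" "0 < b2" "0 < \<kappa>"
      "\<And>\<delta>::real. -\<delta>0 \<le> \<delta> \<Longrightarrow> \<delta> \<le> \<delta>0 \<Longrightarrow>
         b1 * \<bar>\<delta>\<bar> powr \<kappa> \<le> \<bar>measure Q {x. eta x \<le> t0 + \<delta>} - measure Q {x. eta x \<le> t0}\<bar> \<and>
         \<bar>measure Q {x. eta x \<le> t0 + \<delta>} - measure Q {x. eta x \<le> t0}\<bar> \<le> b2 * \<bar>\<delta>\<bar> powr \<kappa>"
    and e: "0 < e"
  obtains d r where "0 < d" "0 < r" "measure Q {x. t0 + d \<le> eta x} + 2 * r \<le> alpha"
      "alpha + 3 * r < measure Q {x. t0 - d \<le> eta x}"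
      "measure Q {x. t0 - 3 * d < eta x \<and> eta x < t0 + 3 * d} + r \<le> e"
proof -
  interpret prob_space Q by fact
  note [measurable] = eta
  have spQ: "space Q = UNIV" using sets_eq_imp_space_eq[OF sQ] by simp
  have S: "{x. eta x \<le> c} \<in> sets Q" "{x. c \<le> eta x} \<in> sets Q" "{x. c < eta x} \<in> sets Q" for c
    unfolding sQ by measurable
  define F where "F t = prob {x. eta x \<le> t}" for t
  have B1: "b1 * \<delta> powr \<kappa> \<le> F (t0 + \<delta>) - F t0" "F (t0 + \<delta>) - F t0 \<le> b2 * \<delta> powr \<kappa>"
    "b1 * \<delta> powr \<kappa> \<le> F t0 - F (t0 - \<delta>)" "F t0 - F (t0 - \<delta>) \<le> b2 * \<delta> powr \<kappa>"
    if "0 < \<delta>" "\<delta> \<le> \<delta>0" for \<delta>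
  proof -
    have "F t0 \<le> F (t0 + \<delta>)" "F (t0 - \<delta>) \<le> F t0"
      unfolding F_def using that by (auto intro!: finite_measure_mono simp: S)
    then show "b1 * \<delta> powr \<kappa> \<le> F (t0 + \<delta>) - F t0" "F (t0 + \<delta>) - F t0 \<le> b2 * \<delta> powr \<kappa>"
      "b1 * \<delta> powr \<kappa> \<le> F t0 - F (t0 - \<delta>)" "F t0 - F (t0 - \<delta>) \<le> b2 * \<delta> powr \<kappa>"
      using B(5)[of \<delta>] B(5)[of "- \<delta>"] that by (auto simp: F_def)
  qed
  have compl: "prob {x. t < eta x} = 1 - F t" for t
  proof -
    have "{x. t < eta x} = space Q - {x. eta x \<le> t}" by (auto simp: spQ)
    then show ?thesis unfolding F_def by (simp add: prob_compl S)
  qed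
  have small: "\<exists>u>0. u \<le> a \<and> c * u powr \<kappa> < b" if "0 < a" "0 < b" "0 < c" for a b c :: real
  proof -
    \<comment> \<open>Solved from c * u powr \<kappa> \<le> b / 2.\<close>
    define u where "u = min a ((b / (2 * c)) powr (1 / \<kappa>))"
    have u: "0 < u" "u \<le> a" using that by (auto simp: u_def)
    have "u powr \<kappa> \<le> ((b / (2 * c)) powr (1 / \<kappa>)) powr \<kappa>"
      using u B(4) by (intro powr_mono2) (auto simp: u_def)
    also have "\<dots> = b / (2 * c)" using B(4) that by (simp add: powr_powr)
    finally have "c * u powr \<kappa> \<le> c * (b / (2 * c))" using that by (intro mult_left_mono) auto
    also have "\<dots> < b" using that by simp
    finally show ?thesis using u by blast
  qed
  \<comment> \<open>\<open>alpha\<close> is the mass of a closed level set while 1 - F is that of an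
    open one. The upper bound in (B) rules out an atom of \<open>eta\<close> at \<open>t0\<close>,
    so the two agree.\<close>
  have alpha_le: "alpha \<le> 1 - F t0"
  proof (rule field_le_epsilon)
    fix v :: real assume "0 < v"
    then obtain u where u: "0 < u" "u \<le> \<delta>0" "b2 * u powr \<kappa> < v" using small[of \<delta>0 v b2] B by blast
    have "alpha \<le> prob {x. t0 - u < eta x}"
      unfolding alpha[symmetric] using u by (intro finite_measure_mono) (auto simp: S)
    then show "alpha \<le> 1 - F t0 + v" using B1(4)[OF u(1,2)] u(3) unfolding compl by linarith
  qed
  have alpha_ge: "1 - F t0 \<le> alpha"
    unfolding compl[symmetric] alpha[symmetric] by (intro finite_measure_mono) (auto simp: S)
  \<comment> \<open>The factor 2 counts the two halves of the strip, whose half-width is u = 3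
    d.\<close>
  obtain u where u: "0 < u" "u \<le> \<delta>0" "2 * b2 * u powr \<kappa> < e / 2"
    using small[of \<delta>0 "e / 2" "2 * b2"] B e by auto
  define d where "d = u / 3"
  have d: "0 < d" "3 * d = u" "d \<le> \<delta>0" "d / 2 \<le> \<delta>0" "0 < d / 2" using u by (auto simp: d_def)
  \<comment> \<open>One bound for each of the three claims. The half margin d / 2 leaves room to
    pass from the closed level set at \<open>t0\<close> + d to an open one.\<close>
  define r where "r = min (e / 2) (min (b1 * (d / 2) powr \<kappa> / 2) (b1 * d powr \<kappa> / 4))"
  have r: "0 < r" "r \<le> e / 2" "r \<le> b1 * (d / 2) powr \<kappa> / 2" "r \<le> b1 * d powr \<kappa> / 4"
    using e B d by (auto simp: r_def)
  show ?thesis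
  proof (rule that[of d r])
    have "prob {x. t0 + d \<le> eta x} \<le> prob {x. t0 + d / 2 < eta x}"
      using d by (intro finite_measure_mono) (auto simp: S)
    then show "prob {x. t0 + d \<le> eta x} + 2 * r \<le> alpha"
      using B1(1)[OF d(5,4)] r(3) alpha_ge unfolding compl by linarith
    have "prob {x. t0 - d < eta x} \<le> prob {x. t0 - d \<le> eta x}"
      by (intro finite_measure_mono) (auto simp: S)
    then show "alpha + 3 * r < prob {x. t0 - d \<le> eta x}"
      using B1(3)[OF d(1,3)] r(1,4) alpha_le unfolding compl by linarith
    have "prob {x. t0 - 3 * d < eta x \<and> eta x < t0 + 3 * d} \<le> prob ({x. eta x \<le> t0 + u} - {x. eta x \<le> t0 - u})"
      using d by (intro finite_measure_mono) (auto intro!: sets.Diff simp: S)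
    also have "\<dots> = F (t0 + u) - F (t0 - u)"
      unfolding F_def using u by (intro finite_measure_Diff) (auto simp: S)
    finally show "prob {x. t0 - 3 * d < eta x \<and> eta x < t0 + 3 * d} + r \<le> e"
      using B1(2,4)[OF u(1,2)] u(3) r(2) by linarith
  qed (use d r in auto)
qed

section \<open>Concentration of the empirical measure\<close>

lemma Qhat_eq_sum: "Qhat n T A = (\<Sum>i<n. indicator A (T i)) / real n"
proof -
  have "(\<Sum>i<n. indicator A (T i) :: real) = (\<Sum>i\<in>{i\<in>{..<n}. T i \<in> A}. 1)"
    by (intro sum.mono_neutral_cong_right) (auto simp: indicator_def)
  then show ?thesis by (simp add: Qhat_def)
qed

text \<open>Hoeffding's inequality for the indicators of one fixed set at the coordinates of the
  sample.\<close>

lemma Qhat_concentration: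
  assumes Q: "prob_space Q" and A: "A \<in> sets Q" and n: "0 < n" and r: "0 \<le> r"
  shows "measure (PiM {..<n} (\<lambda>_. Q)) {T \<in> space (PiM {..<n} (\<lambda>_. Q)). r \<le> \<bar>Qhat n T A - measure Q A\<bar>}
    \<le> 2 * exp (- 2 * real n * r\<^sup>2)"
proof -
  let ?N = "PiM {..<n} (\<lambda>_. Q)"
  interpret Q: prob_space Q by fact
  interpret N: prob_space ?N by (intro prob_space_PiM Q)
  have comp: "(\<lambda>T. T i) \<in> measurable ?N Q" if "i < n" for i
    using that by (intro measurable_component_singleton) simp
  have ind: "(\<lambda>T. indicator A (T i) :: real) \<in> borel_measurable ?N" if "i < n" for i
    by (rule measurable_compose[OF comp[OF that] borel_measurable_indicator[OF A]])
  have dcomp: "distr ?N Q (\<lambda>T. T i) = Q" if "i < n" for i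
    using that by (intro distr_PiM_component Q) auto
  have "N.indep_vars (\<lambda>_. Q) (\<lambda>i T. T i) {..<n}"
  \<comment> \<open>The joint law of the coordinates is the product measure itself, which is the
    product of their marginals.\<close>
  proof (subst N.indep_vars_iff_distr_eq_PiM')
    have "distr ?N ?N (\<lambda>T. \<lambda>i\<in>{..<n}. T i) = distr ?N ?N (\<lambda>T. T)"
      by (intro distr_cong) (auto simp: space_PiM PiE_def extensional_restrict)
    also have "\<dots> = ?N" by (simp add: distr_id[unfolded id_def])
    also have "\<dots> = PiM {..<n} (\<lambda>i. distr ?N Q (\<lambda>T. T i))"
      by (rule PiM_cong) (use dcomp in auto)
    finally show "distr ?N ?N (\<lambda>T. \<lambda>i\<in>{..<n}. T i) = PiM {..<n} (\<lambda>i. distr ?N Q (\<lambda>T. T i))" .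
  qed (use n comp in auto)
  then have indep: "N.indep_vars (\<lambda>_. borel) (\<lambda>i T. indicator A (T i) :: real) {..<n}"
    by (rule N.indep_vars_compose2) (use A in auto)
  have dist: "distr ?N borel (\<lambda>T. indicator A (T i) :: real) = distr Q borel (indicator A)" if "i < n" for i
    using distr_distr[OF _ comp[OF that], of "indicator A :: _ \<Rightarrow> real" borel] A dcomp[OF that] by (simp add: comp_def)
  interpret H: Hoeffding_ineq_iid ?N "{..<n}" "\<lambda>i T. indicator A (T i) :: real" "\<lambda>T. indicator A (T 0)" 0 1 "measure Q A"
  proof unfold_locales
    show "distr ?N borel (\<lambda>T. indicator A (T i) :: real) = distr ?N borel (\<lambda>T. indicator A (T 0))" if "i \<in> {..<n}" for i
      using that n dist by simp
    have "N.expectation (\<lambda>T. indicator A (T 0) :: real) = (\<integral>x. indicator A x \<partial>distr ?N Q (\<lambda>T. T 0))"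
      using comp[OF n] A by (subst integral_distr) auto
    also have "\<dots> = measure Q A" using A by (simp add: dcomp[OF n])
    finally show "measure Q A \<equiv> N.expectation (\<lambda>T. indicator A (T 0))" by simp
  qed (use indep ind n in \<open>auto simp: indicator_def\<close>)
  have "N.prob {T \<in> space ?N. real n * r \<le> \<bar>(\<Sum>i<n. indicator A (T i)) - real n * measure Q A\<bar>}
      \<le> 2 * exp (- 2 * (real n * r)\<^sup>2 / (real n * (1 - 0)\<^sup>2))"
    by (rule H.Hoeffding_ineq_abs_ge[of "real n * r", unfolded card_lessThan]) (use n r in auto)
  also have "- 2 * (real n * r)\<^sup>2 / (real n * (1 - 0)\<^sup>2) = - 2 * real n * r\<^sup>2"
    using n by (simp add: power2_eq_square)
  also have "{T \<in> space ?N. real n * r \<le> \<bar>(\<Sum>i<n. indicator A (T i)) - real n * measure Q A\<bar>}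
      = {T \<in> space ?N. r \<le> \<bar>Qhat n T A - measure Q A\<bar>}"
  proof (intro Collect_cong conj_cong refl)
    fix T
    have "(\<Sum>i<n. indicator A (T i)) - real n * measure Q A = real n * (Qhat n T A - measure Q A)"
      using n by (simp add: Qhat_eq_sum algebra_simps)
    then show "real n * r \<le> \<bar>(\<Sum>i<n. indicator A (T i)) - real n * measure Q A\<bar>
        \<longleftrightarrow> r \<le> \<bar>Qhat n T A - measure Q A\<bar>"
      using n by (simp add: abs_mult)
  qed
  finally show ?thesis .
qed

section \<open>Probability of the good event\<close>

locale two_sample = universal_classification k X P eta
  for k :: "'a::euclidean_space \<Rightarrow> 'a \<Rightarrow> real" and X P eta +
  fixes Q :: "'a measure"
  assumes Q_prob: "prob_space Q" and Q_sets: "sets Q = sets borel"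
begin

sublocale Q: prob_space Q by (rule Q_prob)

abbreviation "Qn n \<equiv> PiM {..<n} (\<lambda>_. Q)"

lemma space_Q: "space Q = UNIV"
  using sets_eq_imp_space_eq[OF Q_sets] by simp

lemma prob_space_Qn: "prob_space (Qn n)"
  by (intro prob_space_PiM Q_prob)

lemma measurable_Qn_component: "i < n \<Longrightarrow> (\<lambda>p. snd p i) \<in> borel_measurable (Pm m \<Otimes>\<^sub>M Qn n)"
proof -
  assume "i < n"
  then have "(\<lambda>p. snd p i) \<in> measurable (Pm m \<Otimes>\<^sub>M Qn n) Q"
    by (intro measurable_compose[OF measurable_snd] measurable_component_singleton) simp
  then show ?thesis by (simp cong: measurable_cong_sets[OF refl Q_sets])
qed

lemma prob_space_samples: "prob_space (Pm m \<Otimes>\<^sub>M Qn n)"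
  by (rule prob_space_pair[OF prob_space_Pm prob_space_Qn])

context
  fixes lam :: real
  assumes lam: "0 < lam"
begin

abbreviation "eh m S \<equiv> etahat k X lam m S"

text \<open>The level set depends on the first sample, so the count is written through the estimator
  evaluated at the points of the second one, where joint measurability applies.\<close>

lemma Qhat_measurable:
  "(\<lambda>p. Qhat n (snd p) {y. c \<le> eh m (fst p) y}) \<in> borel_measurable (Pm m \<Otimes>\<^sub>M Qn n)"
proof -
  have "(\<lambda>p. indicator {y. c \<le> eh m (fst p) y} (snd p i) :: real) \<in> borel_measurable (Pm m \<Otimes>\<^sub>M Qn n)" if "i < n" for i
  proof -
    have [measurable]: "(\<lambda>p. eh m (fst p) (snd p i)) \<in> borel_measurable (Pm m \<Otimes>\<^sub>M Qn n)"
      using measurable_compose[OF measurable_Pair[OF measurable_fst measurable_Qn_component[OF that]]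
        etahat_measurable[OF lam]] by simp
    have "(\<lambda>p. if c \<le> eh m (fst p) (snd p i) then 1 else 0 :: real) \<in> borel_measurable (Pm m \<Otimes>\<^sub>M Qn n)"
      by measurable
    then show ?thesis by (simp add: indicator_def of_bool_def)
  qed
  then show ?thesis
    unfolding Qhat_eq_sum by (intro borel_measurable_divide borel_measurable_sum) auto
qed

lemma Q_level_measurable:
  "(\<lambda>S. measure Q {y. c \<le> eh m S y}) \<in> borel_measurable (Pm m)"
proof -
  have [measurable]: "(\<lambda>p. eh m (fst p) (snd p)) \<in> borel_measurable (Pm m \<Otimes>\<^sub>M Q)"
    using etahat_measurable[OF lam, of m] by (simp cong: measurable_cong_sets sets_pair_measure_cong add: Q_sets)
  have "{p \<in> space (Pm m \<Otimes>\<^sub>M Q). c \<le> eh m (fst p) (snd p)} \<in> sets (Pm m \<Otimes>\<^sub>M Q)" by measurable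
  from Q.measurable_emeasure_Pair[OF this]
  have "(\<lambda>S. emeasure Q (Pair S -` {p \<in> space (Pm m \<Otimes>\<^sub>M Q). c \<le> eh m (fst p) (snd p)})) \<in> borel_measurable (Pm m)" .
  moreover have "Pair S -` {p \<in> space (Pm m \<Otimes>\<^sub>M Q). c \<le> eh m (fst p) (snd p)} = {y. c \<le> eh m S y}"
    if "S \<in> space (Pm m)" for S
    using that by (auto simp: space_pair_measure space_Q)
  ultimately have "(\<lambda>S. emeasure Q {y. c \<le> eh m S y}) \<in> borel_measurable (Pm m)"
    by (simp cong: measurable_cong)
  then show ?thesis unfolding measure_def by measurable
qed

text \<open>With the point as a third variable, \<open>mem_Ghat_iff\<close> makes membership
  measurable on the triple product. The symmetric difference is a section of the set where two
  memberships disagree, and section measures are measurable.\<close>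

lemma Ghat_error_measurable:
  "(\<lambda>p. measure Q ((Ghat (eh m (fst p)) n (snd p) a b c - {x. t0 \<le> eta x})
      \<union> ({x. t0 \<le> eta x} - Ghat (eh m (fst p)) n (snd p) a b c))) \<in> borel_measurable (Pm m \<Otimes>\<^sub>M Qn n)"
proof -
  let ?M = "Pm m \<Otimes>\<^sub>M Qn n"
  let ?D = "\<lambda>p. (Ghat (eh m (fst p)) n (snd p) a b c - {x. t0 \<le> eta x})
      \<union> ({x. t0 \<le> eta x} - Ghat (eh m (fst p)) n (snd p) a b c)"
  have snd_m [measurable]: "(\<lambda>w. snd w) \<in> borel_measurable (?M \<Otimes>\<^sub>M Q)"
    using measurable_snd[of ?M Q] by (simp cong: measurable_cong_sets[OF refl Q_sets])
  have [measurable]: "(\<lambda>w. eh m (fst (fst w)) (snd w)) \<in> borel_measurable (?M \<Otimes>\<^sub>M Q)"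
    using measurable_compose[OF measurable_Pair[OF measurable_compose[OF measurable_fst measurable_fst] snd_m]
        etahat_measurable[OF lam]] by simp
  have [measurable]: "(\<lambda>w. Qhat n (snd (fst w)) {y. d \<le> eh m (fst (fst w)) y}) \<in> borel_measurable (?M \<Otimes>\<^sub>M Q)" for d
    by (rule measurable_compose[OF measurable_fst Qhat_measurable])
  have G: "Measurable.pred (?M \<Otimes>\<^sub>M Q) (\<lambda>w. snd w \<in> Ghat (eh m (fst (fst w))) n (snd (fst w)) a b c)"
    unfolding mem_Ghat_iff by measurable
  have "Measurable.pred (?M \<Otimes>\<^sub>M Q) (\<lambda>w. (snd w \<in> Ghat (eh m (fst (fst w))) n (snd (fst w)) a b c) \<noteq> (t0 \<le> eta (snd w)))"
    using G by measurable
  then have W: "{w \<in> space (?M \<Otimes>\<^sub>M Q). (snd w \<in> Ghat (eh m (fst (fst w))) n (snd (fst w)) a b c) \<noteq> (t0 \<le> eta (snd w))}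
      \<in> sets (?M \<Otimes>\<^sub>M Q)" (is "?W \<in> _") by (simp add: pred_def)
  from Q.measurable_emeasure_Pair[OF W]
  have "(\<lambda>p. emeasure Q (Pair p -` ?W)) \<in> borel_measurable ?M" .
  moreover have "Pair p -` ?W = ?D p" if "p \<in> space ?M" for p
    using that by (auto simp: space_pair_measure space_Q)
  ultimately have "(\<lambda>p. emeasure Q (?D p)) \<in> borel_measurable ?M"
    by (simp cong: measurable_cong)
  then show ?thesis unfolding measure_def by measurable
qed

text \<open>Given the first sample, the level set is fixed and independent of the second sample, so
  no uniform law of large numbers is needed.\<close>

lemma prob_Qhat_deviation:
  fixes c r :: real and m n :: nat
  assumes n: "0 < n" and r: "0 \<le> r"
  defines "A \<equiv> {p \<in> space (Pm m \<Otimes>\<^sub>M Qn n).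
    r \<le> \<bar>Qhat n (snd p) {x. c \<le> eh m (fst p) x} - measure Q {x. c \<le> eh m (fst p) x}\<bar>}"
  shows "A \<in> sets (Pm m \<Otimes>\<^sub>M Qn n)"
    and "measure (Pm m \<Otimes>\<^sub>M Qn n) A \<le> 2 * exp (- 2 * real n * r\<^sup>2)"
proof -
  interpret M: prob_space "Pm m" by (rule prob_space_Pm)
  interpret N: prob_space "Qn n" by (rule prob_space_Qn)
  interpret MN: prob_space "Pm m \<Otimes>\<^sub>M Qn n" by (rule prob_space_samples)
  have [measurable]: "(\<lambda>p. measure Q {x. c \<le> eh m (fst p) x}) \<in> borel_measurable (Pm m \<Otimes>\<^sub>M Qn n)"
    by (rule measurable_compose[OF measurable_fst Q_level_measurable])
  note [measurable] = Qhat_measurable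
  show A: "A \<in> sets (Pm m \<Otimes>\<^sub>M Qn n)" unfolding A_def by measurable
  have "emeasure (Pm m \<Otimes>\<^sub>M Qn n) A = (\<integral>\<^sup>+S. emeasure (Qn n) (Pair S -` A) \<partial>Pm m)"
    by (rule N.emeasure_pair_measure_alt[OF A])
  also have "\<dots> \<le> (\<integral>\<^sup>+S. ennreal (2 * exp (- 2 * real n * r\<^sup>2)) \<partial>Pm m)"
  proof (rule nn_integral_mono)
    fix S assume S: "S \<in> space (Pm m)"
    have "Pair S -` A = {T \<in> space (Qn n). r \<le> \<bar>Qhat n T {x. c \<le> eh m S x} - measure Q {x. c \<le> eh m S x}\<bar>}"
      using S by (auto simp: A_def space_pair_measure)
    moreover have "{x. c \<le> eh m S x} \<in> sets Q"
      using etahat_measurable_x[OF lam, of m S] unfolding Q_sets by measurable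
    ultimately have "measure (Qn n) (Pair S -` A) \<le> 2 * exp (- 2 * real n * r\<^sup>2)"
      using Qhat_concentration[OF Q_prob _ n r] by simp
    then show "emeasure (Qn n) (Pair S -` A) \<le> ennreal (2 * exp (- 2 * real n * r\<^sup>2))"
      by (simp add: N.emeasure_eq_measure ennreal_leI)
  qed
  also have "\<dots> = ennreal (2 * exp (- 2 * real n * r\<^sup>2))" by (simp add: M.emeasure_space_1)
  finally show "measure (Pm m \<Otimes>\<^sub>M Qn n) A \<le> 2 * exp (- 2 * real n * r\<^sup>2)"
    by (simp add: MN.emeasure_eq_measure)
qed

text \<open>Chebyshev's inequality under the marginal of P, carried over to Q by domination.\<close>

lemma close_measure_le:
  assumes c0: "0 < c0" "\<And>A. A \<in> sets borel \<Longrightarrow> measure Q A \<le> c0 * measure PX A" and d: "0 < d"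
  shows "measure Q {x. d \<le> \<bar>eh m S x - eta x\<bar>} \<le> c0 * (sq_error lam m S / d\<^sup>2)"
proof -
  let ?D = "{x. d \<le> \<bar>eh m S x - eta x\<bar>}"
  have D: "?D \<in> sets borel" using etahat_measurable_x[OF lam, of m S] by measurable
  have "d\<^sup>2 * PX.prob ?D = (\<integral>x. d\<^sup>2 * indicator ?D x \<partial>PX)" using D by simp
  also have "\<dots> \<le> (\<integral>x. (eh m S x - eta x)\<^sup>2 \<partial>PX)"
  proof (rule integral_mono)
    show "integrable PX (\<lambda>x. d\<^sup>2 * indicator ?D x)"
      using D by (intro integrable_mult_right integrable_real_indicator) (auto simp: less_top[symmetric])
    show "integrable PX (\<lambda>x. (eh m S x - eta x)\<^sup>2)" by (rule integrable_sq_error[OF lam])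
    show "d\<^sup>2 * indicator ?D x \<le> (eh m S x - eta x)\<^sup>2" for x
      using d by (auto simp: indicator_def abs_le_square_iff[symmetric])
  qed
  finally have "PX.prob ?D \<le> sq_error lam m S / d\<^sup>2"
    using d by (simp add: sq_error_def pos_le_divide_eq mult.commute)
  then have "c0 * PX.prob ?D \<le> c0 * (sq_error lam m S / d\<^sup>2)" using c0 by (intro mult_left_mono) auto
  with c0(2)[OF D] show ?thesis by linarith
qed

text \<open>A union bound over a large squared error and a deviation at each of two levels, 2 exp
  (...) apiece. The cut r d^2 / c0 is what \<open>close_measure_le\<close> turns into r.\<close>

lemma prob_good_ge:
  assumes c0: "0 < c0" "\<And>A. A \<in> sets borel \<Longrightarrow> measure Q A \<le> c0 * measure PX A"
    and d: "0 < d" and r: "0 < r" and n: "0 < n" and eps: "eps_n n \<le> r"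
    and h: "measure Q {x. t0 + d \<le> eta x} + 2 * r \<le> alpha"
      "alpha + 3 * r < measure Q {x. t0 - d \<le> eta x}"
      "measure Q {x. t0 - 3 * d < eta x \<and> eta x < t0 + 3 * d} + r \<le> e"
  shows "1 - measure (Pm m) {S \<in> space (Pm m). r * d\<^sup>2 / c0 \<le> sq_error lam m S} - 4 * exp (- 2 * real n * r\<^sup>2)
    \<le> measure (Pm m \<Otimes>\<^sub>M Qn n) {p \<in> space (Pm m \<Otimes>\<^sub>M Qn n).
        measure Q ((Ghat (eh m (fst p)) n (snd p) alpha 0 0 - {x. t0 \<le> eta x})
          \<union> ({x. t0 \<le> eta x} - Ghat (eh m (fst p)) n (snd p) alpha 0 0)) \<le> e}"
proof -
  let ?M = "Pm m \<Otimes>\<^sub>M Qn n"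
  interpret N: prob_space "Qn n" by (rule prob_space_Qn)
  interpret MN: prob_space ?M by (rule prob_space_samples)
  let ?good = "{p \<in> space ?M. measure Q ((Ghat (eh m (fst p)) n (snd p) alpha 0 0 - {x. t0 \<le> eta x})
          \<union> ({x. t0 \<le> eta x} - Ghat (eh m (fst p)) n (snd p) alpha 0 0)) \<le> e}"
  let ?bad = "{S \<in> space (Pm m). r * d\<^sup>2 / c0 \<le> sq_error lam m S}"
  define B where "B c = {p \<in> space ?M.
    r \<le> \<bar>Qhat n (snd p) {x. c \<le> eh m (fst p) x} - measure Q {x. c \<le> eh m (fst p) x}\<bar>}" for c
  have B: "B c \<in> sets ?M" "MN.prob (B c) \<le> 2 * exp (- 2 * real n * r\<^sup>2)" for c
    using prob_Qhat_deviation[OF n, of r m c] r unfolding B_def by auto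
  have bad: "?bad \<in> sets (Pm m)"
    using sq_error_measurable[OF lam, of m] by measurable
  have "emeasure ?M (?bad \<times> space (Qn n)) = emeasure (Pm m) ?bad * emeasure (Qn n) (space (Qn n))"
    using bad by (intro N.emeasure_pair_measure_Times) auto
  then have p_bad: "MN.prob (?bad \<times> space (Qn n)) = measure (Pm m) ?bad"
    by (simp add: N.emeasure_space_1 measure_def)
  have bad': "?bad \<times> space (Qn n) \<in> sets ?M" using bad by auto
  have good: "?good \<in> sets ?M"
    using Ghat_error_measurable[of m n alpha 0 0 t0] by measurable
  have sub: "space ?M - ?good \<subseteq> ?bad \<times> space (Qn n) \<union> (B (t0 + 2 * d) \<union> B (t0 - 2 * d))"
  proof
    fix p assume p: "p \<in> space ?M - ?good"
    show "p \<in> ?bad \<times> space (Qn n) \<union> (B (t0 + 2 * d) \<union> B (t0 - 2 * d))"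
    proof (rule ccontr)
      assume np: "p \<notin> ?bad \<times> space (Qn n) \<union> (B (t0 + 2 * d) \<union> B (t0 - 2 * d))"
      then have "sq_error lam m (fst p) < r * d\<^sup>2 / c0"
        using p by (auto simp: space_pair_measure)
      then have "c0 * (sq_error lam m (fst p) / d\<^sup>2) \<le> r"
        using c0(1) d by (simp add: field_simps)
      then have close: "measure Q {x. d \<le> \<bar>eh m (fst p) x - eta x\<bar>} \<le> r"
        using close_measure_le[OF c0 d, of m "fst p"] by linarith
      have emp: "\<bar>Qhat n (snd p) {x. c \<le> eh m (fst p) x} - measure Q {x. c \<le> eh m (fst p) x}\<bar> \<le> r"
        if "p \<notin> B c" for c
        using that p by (auto simp: B_def)
      have "measure Q ((Ghat (eh m (fst p)) n (snd p) alpha 0 0 - {x. t0 \<le> eta x})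
          \<union> ({x. t0 \<le> eta x} - Ghat (eh m (fst p)) n (snd p) alpha 0 0)) \<le> e"
        by (rule Ghat_symdiff_le[OF Q_prob Q_sets etahat_measurable_x[OF lam] eta_meas d close _ _ eps h])
          (use np emp in auto)
      with p show False by blast
    qed
  qed
  have "1 - MN.prob ?good = MN.prob (space ?M - ?good)" by (rule MN.prob_compl[OF good, symmetric])
  also have "\<dots> \<le> MN.prob (?bad \<times> space (Qn n) \<union> (B (t0 + 2 * d) \<union> B (t0 - 2 * d)))"
    using sub B bad' by (intro MN.finite_measure_mono) auto
  also have "\<dots> \<le> MN.prob (?bad \<times> space (Qn n)) + MN.prob (B (t0 + 2 * d) \<union> B (t0 - 2 * d))"
    using B bad' by (intro measure_Un_le) auto
  also have "MN.prob (B (t0 + 2 * d) \<union> B (t0 - 2 * d)) \<le> MN.prob (B (t0 + 2 * d)) + MN.prob (B (t0 - 2 * d))"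
    using B by (intro measure_Un_le) auto
  finally show ?thesis
    using B(2)[of "t0 + 2 * d"] B(2)[of "t0 - 2 * d"] unfolding p_bad by linarith
qed

end

end

theorem theorem3:
  fixes X :: "'a::euclidean_space set"
    and P :: "('a \<times> bool) measure"
    and QX :: "'a measure"
    and eta :: "'a \<Rightarrow> real"
    and alpha t0 :: real
    and k :: "'a \<Rightarrow> 'a \<Rightarrow> real"
    and lam :: "nat \<Rightarrow> real"
  assumes X_compact: "compact X"
    and P_prob: "prob_space P"
    and P_sets: "sets P = sets (borel \<Otimes>\<^sub>M count_space UNIV)"
    and P_supp: "emeasure P (X \<times> UNIV) = 1"
    and QX_prob: "prob_space QX"
    and QX_sets: "sets QX = sets borel"
    and QX_supp: "emeasure QX X = 1"
    and eta_meas: "eta \<in> borel_measurable borel"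
    and eta_range: "\<And>x. 0 \<le> eta x \<and> eta x \<le> 1"
    and eta_cond: "\<And>A. A \<in> sets borel \<Longrightarrow>
         measure P (A \<times> {True}) = (\<integral>x. indicator A x * eta x \<partial>(distr P borel fst))"
    and alpha: "0 < alpha" "alpha < 1"
    and A: "0 < t0" "t0 \<le> 1" "measure QX {x. eta x \<ge> t0} = alpha"
    and B: "\<exists>\<delta>0 b1 b2 \<kappa>. \<delta>0 > 0 \<and> b1 > 0 \<and> b2 > 0 \<and> \<kappa> > 0 \<and>
            (\<forall>\<delta>::real. -\<delta>0 \<le> \<delta> \<and> \<delta> \<le> \<delta>0 \<longrightarrow>
               b1 * \<bar>\<delta>\<bar> powr \<kappa> \<le>
                 \<bar>measure QX {x. eta x \<le> t0 + \<delta>} - measure QX {x. eta x \<le> t0}\<bar> \<and>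
               \<bar>measure QX {x. eta x \<le> t0 + \<delta>} - measure QX {x. eta x \<le> t0}\<bar>
                 \<le> b2 * \<bar>\<delta>\<bar> powr \<kappa>)"
    and C': "\<exists>c0>0. \<forall>A\<in>sets borel. measure QX A \<le> c0 * measure (distr P borel fst) A"
    and k_univ: "universal_kernel k X"
    and lam_pos: "\<And>m. lam m > 0"
    and lam_to_0: "lam \<longlonglongrightarrow> 0"
    and lam_rate: "filterlim (\<lambda>m. real m * (lam m)\<^sup>2) at_top sequentially"
  shows "\<forall>\<epsilon>>0. \<exists>\<beta> \<gamma>::real.
           ((\<lambda>(m, n). measure (sample_space P QX m n)
               {(S, T) \<in> space (sample_space P QX m n).
                  measure QX
                    ((Ghat (etahat k X (lam m) m S) n T alpha \<beta> \<gamma> - {x. eta x \<ge> t0}) \<union>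
                     ({x. eta x \<ge> t0} - Ghat (etahat k X (lam m) m S) n T alpha \<beta> \<gamma>))
                  \<le> \<epsilon>})
            \<longlongrightarrow> 1) (sequentially \<times>\<^sub>F sequentially)"
proof (intro allI impI)
  fix e :: real assume e: "0 < e"
  interpret two_sample k X P eta QX
  proof (intro two_sample.intro universal_classification.intro compact_kernel.intro psd_kernel.intro
      compact_kernel_axioms.intro universal_classification_axioms.intro two_sample_axioms.intro)
    show "compact X" "prob_space P" "sets P = sets (borel \<Otimes>\<^sub>M count_space UNIV)"
      "emeasure P (X \<times> UNIV) = 1" "eta \<in> borel_measurable borel" "\<And>x. 0 \<le> eta x \<and> eta x \<le> 1"
      "prob_space QX" "sets QX = sets borel"
      by fact+
    show "continuous_on (X \<times> X) (\<lambda>(x, y). k x y)" "\<And>x y. x \<in> X \<Longrightarrow> y \<in> X \<Longrightarrow> k x y = k y x"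
      "\<And>c. c \<in> fin_coeffs X \<Longrightarrow> 0 \<le> knorm2 k c"
      "\<And>g e. continuous_on X g \<Longrightarrow> 0 < e \<Longrightarrow> \<exists>f\<in>rkhs k X. \<forall>x\<in>X. \<bar>f x - g x\<bar> < e"
      using k_univ unfolding universal_kernel_def by blast+
    show "\<And>A. A \<in> sets borel \<Longrightarrow>
         measure P (A \<times> {True}) = (\<integral>x. indicator A x * eta x \<partial>(distr P borel fst))"
      by (rule eta_cond)
  qed
  from B obtain \<delta>0 b1 b2 \<kappa> where B': "0 < \<delta>0" "0 < b1" "0 < b2" "0 < \<kappa>"
    "\<And>\<delta>::real. -\<delta>0 \<le> \<delta> \<Longrightarrow> \<delta> \<le> \<delta>0 \<Longrightarrow>
       b1 * \<bar>\<delta>\<bar> powr \<kappa> \<le> \<bar>measure QX {x. eta x \<le> t0 + \<delta>} - measure QX {x. eta x \<le> t0}\<bar> \<and>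
       \<bar>measure QX {x. eta x \<le> t0 + \<delta>} - measure QX {x. eta x \<le> t0}\<bar> \<le> b2 * \<bar>\<delta>\<bar> powr \<kappa>"
    by blast
  obtain d r where dr: "0 < d" "0 < r" "measure QX {x. t0 + d \<le> eta x} + 2 * r \<le> alpha"
      "alpha + 3 * r < measure QX {x. t0 - d \<le> eta x}"
      "measure QX {x. t0 - 3 * d < eta x \<and> eta x < t0 + 3 * d} + r \<le> e"
    by (rule margin_choice[OF QX_prob QX_sets eta_meas A(3) B' e])
  from C' obtain c0 where c0: "0 < c0" "\<And>A. A \<in> sets borel \<Longrightarrow> measure QX A \<le> c0 * measure PX A" by blast
  \<comment> \<open>Both tuning parameters are set to 0 here, and these are the witnesses at the
    end.\<close>
  define p where "p m n = measure (sample_space P QX m n) {(S, T) \<in> space (sample_space P QX m n).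
      measure QX ((Ghat (etahat k X (lam m) m S) n T alpha 0 0 - {x. eta x \<ge> t0})
        \<union> ({x. eta x \<ge> t0} - Ghat (etahat k X (lam m) m S) n T alpha 0 0)) \<le> e}" for m n
  define u where "u m = measure (Pm m) {S \<in> space (Pm m). r * d\<^sup>2 / c0 \<le> sq_error (lam m) m S}" for m
  define v where "v n = 4 * exp (- 2 * real n * r\<^sup>2)" for n
  have u: "u \<longlonglongrightarrow> 0"
    unfolding u_def using dr(1,2) c0(1)
    by (intro sq_error_tendsto_prob lam_pos lam_to_0 lam_rate) auto
  have v: "v \<longlonglongrightarrow> 0"
  proof -
    have "filterlim (\<lambda>n. (2 * r\<^sup>2) * real n) at_top sequentially"
      using dr(2) by (intro filterlim_tendsto_pos_mult_at_top[OF tendsto_const] filterlim_real_sequentially) auto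
    then have "((\<lambda>n. exp (- (2 * r\<^sup>2 * real n))) \<longlongrightarrow> 0) sequentially"
      by (intro filterlim_compose[OF exp_at_bot] filterlim_compose[OF filterlim_uminus_at_bot_at_top])
    then have "((\<lambda>n. 4 * exp (- (2 * r\<^sup>2 * real n))) \<longlonglongrightarrow> 4 * 0)" by (intro tendsto_intros)
    then show ?thesis by (simp add: v_def[abs_def] mult.commute mult.left_commute)
  qed
  \<comment> \<open>The error is a function of m alone plus a function of n alone, so the joint
    limit needs no relation between the two sample sizes.\<close>
  have low: "1 - u m - v n \<le> p m n" if "0 < n" "eps_n n \<le> r" for m n
    using prob_good_ge[OF lam_pos c0 dr(1,2) that dr(3-5), of m]
    by (simp add: p_def u_def v_def sample_space_def case_prod_unfold)
  have up: "p m n \<le> 1" for m n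
    unfolding p_def sample_space_def by (rule prob_space.prob_le_1[OF prob_space_samples])
  have "((\<lambda>(m, n). p m n) \<longlongrightarrow> 1) (sequentially \<times>\<^sub>F sequentially)"
  proof (rule tendstoI)
    fix s :: real assume s: "0 < s"
    have "\<forall>\<^sub>F m in sequentially. u m < s / 2" using u s by (intro order_tendstoD) auto
    moreover have "\<forall>\<^sub>F n in sequentially. v n < s / 2 \<and> eps_n n < r \<and> 0 < n"
      using order_tendstoD(2)[OF v, of "s / 2"] order_tendstoD(2)[OF eps_n_tendsto dr(2)] s
      by (intro eventually_conj eventually_gt_at_top) auto
    ultimately have "\<forall>\<^sub>F x in sequentially \<times>\<^sub>F sequentially.
        u (fst x) < s / 2 \<and> v (snd x) < s / 2 \<and> eps_n (snd x) < r \<and> 0 < snd x"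
      by (rule eventually_prodI)
    then show "\<forall>\<^sub>F x in sequentially \<times>\<^sub>F sequentially. dist (case x of (m, n) \<Rightarrow> p m n) 1 < s"
    proof (rule eventually_mono)
      fix x assume x: "u (fst x) < s / 2 \<and> v (snd x) < s / 2 \<and> eps_n (snd x) < r \<and> 0 < snd x"
      then have "1 - u (fst x) - v (snd x) \<le> p (fst x) (snd x)" by (intro low) auto
      then have "\<bar>p (fst x) (snd x) - 1\<bar> < s" using x up[of "fst x" "snd x"] by linarith
      then show "dist (case x of (m, n) \<Rightarrow> p m n) 1 < s" by (simp add: dist_real_def case_prod_unfold)
    qed
  qed
  then show "\<exists>\<beta> \<gamma>::real.
           ((\<lambda>(m, n). measure (sample_space P QX m n)
               {(S, T) \<in> space (sample_space P QX m n).
                  measure QX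
                    ((Ghat (etahat k X (lam m) m S) n T alpha \<beta> \<gamma> - {x. eta x \<ge> t0}) \<union>
                     ({x. eta x \<ge> t0} - Ghat (etahat k X (lam m) m S) n T alpha \<beta> \<gamma>))
                  \<le> e})
            \<longlongrightarrow> 1) (sequentially \<times>\<^sub>F sequentially)"
    unfolding p_def by blast
qed

end
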